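(* Let $p$ be a prime and let $G$ be a finite $p$-group with cyclic center $\mathrm{Z}(G)$ and dihedral central quotient $G/\mathrm{Z}(G)$. Then the modular isomorphism problem has a positive answer for $G$; that is, for every field $F$ of characteristic $p$ and every finite $p$-group $H$, if $FG\cong FH$ as $F$-algebras, then $G\cong H$.
   Context: A group is called dihedral if it is a finite $2$-group that is generated by precisely two elements of order $2$; in particular, the Klein four group is dihedral (while the group of order $2$ is not). $FG$ denotes the group algebra of $G$ over $F$. (The hypothesis forces $p=2$.) *)

theory Defs
  imports
    "HOL-Computational_Algebra.Primes"
    "HOL-Algebra.Elementary_Groups"
    "HOL-Algebra.Multiplicative_Group"
    "HOL-Algebra.QuotRing"
    "HOL-Algebra.Module"
begin

definition finite_p_group :: "nat \<Rightarrow> ('a, 'm) monoid_scheme \<Rightarrow> bool" where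
  "finite_p_group p G \<longleftrightarrow> group G \<and> finite (carrier G) \<and> (\<exists>n. order G = p ^ n)"

definition center :: "('a, 'm) monoid_scheme \<Rightarrow> 'a set" where
  "center G = {z \<in> carrier G. \<forall>g \<in> carrier G. z \<otimes>\<^bsub>G\<^esub> g = g \<otimes>\<^bsub>G\<^esub> z}"

text \<open>The two generators are distinct, so the Klein four group is dihedral
  and the group of order two is not.\<close>

definition dihedral :: "('a, 'm) monoid_scheme \<Rightarrow> bool" where
  "dihedral G \<longleftrightarrow> finite_p_group 2 G \<and>
     (\<exists>x \<in> carrier G. \<exists>y \<in> carrier G. x \<noteq> y \<and> group.ord G x = 2 \<and> group.ord G y = 2 \<and>
        generate G {x, y} = carrier G)"

text \<open>The characteristic is the additive order of one; \<^const>\<open>group.ord\<close> returns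
  \<open>0\<close> for elements of infinite order.\<close>

definition ring_char :: "('a, 'm) ring_scheme \<Rightarrow> nat" where
  "ring_char R = group.ord (add_monoid R) \<one>\<^bsub>R\<^esub>"

text \<open>The group algebra over \<open>F\<close> of a finite group \<open>G\<close>: the element
  \<open>\<Sum>g. a\<^sub>g g\<close> is represented by its coefficient function \<open>g \<mapsto> a\<^sub>g\<close>, which is
  \<^const>\<open>undefined\<close> outside \<^term>\<open>carrier G\<close>.  There is no finite-support condition, so this
  is the group algebra only when \<^term>\<open>carrier G\<close> is finite.\<close>

definition group_algebra ::
  "('f, 'r) ring_scheme \<Rightarrow> ('g, 'm) monoid_scheme \<Rightarrow> ('f, 'g \<Rightarrow> 'f) module" where
  "group_algebra F G =
    \<lparr>carrier = carrier G \<rightarrow>\<^sub>E carrier F,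
     mult = (\<lambda>a b. \<lambda>x \<in> carrier G.
       finsum F (\<lambda>y. a y \<otimes>\<^bsub>F\<^esub> b (inv\<^bsub>G\<^esub> y \<otimes>\<^bsub>G\<^esub> x)) (carrier G)),
     one = (\<lambda>x \<in> carrier G. if x = \<one>\<^bsub>G\<^esub> then \<one>\<^bsub>F\<^esub> else \<zero>\<^bsub>F\<^esub>),
     zero = (\<lambda>x \<in> carrier G. \<zero>\<^bsub>F\<^esub>),
     add = (\<lambda>a b. \<lambda>x \<in> carrier G. a x \<oplus>\<^bsub>F\<^esub> b x),
     smult = (\<lambda>c a. \<lambda>x \<in> carrier G. c \<otimes>\<^bsub>F\<^esub> a x)\<rparr>"

definition algebra_iso ::
  "('f, 'r) ring_scheme \<Rightarrow> ('f, 'a, 'm) module_scheme \<Rightarrow> ('f, 'b, 'n) module_scheme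
    \<Rightarrow> ('a \<Rightarrow> 'b) set" where
  "algebra_iso F A B =
    {h \<in> ring_iso A B. \<forall>c \<in> carrier F. \<forall>a \<in> carrier A. h (c \<odot>\<^bsub>A\<^esub> a) = c \<odot>\<^bsub>B\<^esub> h a}"

definition algebras_isomorphic ::
  "('f, 'r) ring_scheme \<Rightarrow> ('f, 'a, 'm) module_scheme \<Rightarrow> ('f, 'b, 'n) module_scheme \<Rightarrow> bool" where
  "algebras_isomorphic F A B \<longleftrightarrow> algebra_iso F A B \<noteq> {}"

lemma (in group) center_normal: "center G \<lhd> G"
proof -
  have "subgroup (center G) G"
  proof (rule subgroupI)
    show "center G \<noteq> {}"
      by (auto simp: center_def intro!: exI[of _ \<one>])
    fix a assume a: "a \<in> center G"
    have "inv a \<otimes> g = g \<otimes> inv a" if g: "g \<in> carrier G" for g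
    proof -
      have *: "a \<in> carrier G" "inv a \<in> carrier G" "a \<otimes> g = g \<otimes> a"
        using a g by (auto simp: center_def)
      have "inv a \<otimes> g = inv a \<otimes> (g \<otimes> (a \<otimes> inv a))"
        using *(1) g by (simp only: r_inv r_one)
      also have "\<dots> = inv a \<otimes> ((g \<otimes> a) \<otimes> inv a)"
        using *(1,2) g by (simp only: m_assoc m_closed)
      also have "\<dots> = inv a \<otimes> ((a \<otimes> g) \<otimes> inv a)"
        by (simp only: *(3))
      also have "\<dots> = (inv a \<otimes> a) \<otimes> (g \<otimes> inv a)"
        using *(1,2) g by (simp only: m_assoc m_closed)
      also have "\<dots> = g \<otimes> inv a"
        using *(1,2) g by simp
      finally show ?thesis .
    qed
    then show "inv a \<in> center G"
      using a by (auto simp: center_def)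
    fix b assume b: "b \<in> center G"
    have "a \<otimes> b \<otimes> g = g \<otimes> (a \<otimes> b)" if g: "g \<in> carrier G" for g
    proof -
      have *: "a \<in> carrier G" "b \<in> carrier G" "a \<otimes> g = g \<otimes> a" "b \<otimes> g = g \<otimes> b"
        using a b g unfolding center_def by blast+
      have "a \<otimes> b \<otimes> g = a \<otimes> (g \<otimes> b)"
        using *(1,2) g by (simp only: m_assoc *(4))
      also have "\<dots> = (g \<otimes> a) \<otimes> b"
        using *(1,2) g by (simp only: m_assoc[symmetric] *(3))
      also have "\<dots> = g \<otimes> (a \<otimes> b)"
        using *(1,2) g by (simp only: m_assoc)
      finally show ?thesis .
    qed
    moreover have "a \<otimes> b \<in> carrier G"
      using a b unfolding center_def by blast
    ultimately show "a \<otimes> b \<in> center G"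
      unfolding center_def by blast
  qed (auto simp: center_def)
  moreover have "g \<otimes> z \<otimes> inv g \<in> center G" if "g \<in> carrier G" "z \<in> center G" for g z
  proof -
    have "g \<otimes> z = z \<otimes> g" "z \<in> carrier G"
      using that unfolding center_def by auto
    then have "g \<otimes> z \<otimes> inv g = z"
      using that(1) by (simp add: m_assoc)
    with that(2) show ?thesis by simp
  qed
  ultimately show ?thesis
    by (simp add: normal_inv_iff)
qed

lemma ring_char_unique:
  fixes R (structure)
  assumes "ring R" and "\<And>n::nat. [n] \<cdot> \<one> = \<zero> \<longleftrightarrow> d dvd n"
  shows "ring_char R = d"
proof -
  interpret ring R by fact
  have "ring_char R dvd n \<longleftrightarrow> d dvd n" for n
    using add.pow_eq_id[of \<one> n] assms(2)[of n] by (simp add: ring_char_def add_pow_def)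
  then show ?thesis
    by (meson dvd_antisym dvd_refl)
qed

text \<open>The record \<^const>\<open>group_algebra\<close> is a unital associative algebra.  The locale
  \<^locale>\<open>algebra\<close> cannot be used to say this, as it demands a commutative multiplication.\<close>

context
  fixes F (structure) and G (structure)
  assumes F: "cring F" and G: "group G" and fin: "finite (carrier G)"
begin

interpretation F: cring F by (rule F)
interpretation G: group G by (rule G)

lemma group_algebra_abelian_group: "abelian_group (group_algebra F G)"
proof (rule abelian_groupI)
  fix a assume a: "a \<in> carrier (group_algebra F G)"
  show "\<exists>b\<in>carrier (group_algebra F G).
      b \<oplus>\<^bsub>group_algebra F G\<^esub> a = \<zero>\<^bsub>group_algebra F G\<^esub>"
    using a by (intro bexI[of _ "\<lambda>x\<in>carrier G. \<ominus> a x"])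
      (auto simp: group_algebra_def PiE_iff F.l_neg intro!: restrict_ext)
qed (auto simp: group_algebra_def PiE_iff fun_eq_iff extensional_def F.a_ac restrict_def)

lemma group_algebra_module: "module F (group_algebra F G)"
  by (rule moduleI[OF F group_algebra_abelian_group])
    (auto simp: group_algebra_def PiE_iff fun_eq_iff extensional_def restrict_def
      F.l_distr F.r_distr F.m_assoc)

lemma group_algebra_mult_apply:
  "x \<in> carrier G \<Longrightarrow> (a \<otimes>\<^bsub>group_algebra F G\<^esub> b) x =
    (\<Oplus>y\<in>carrier G. a y \<otimes> b (inv\<^bsub>G\<^esub> y \<otimes>\<^bsub>G\<^esub> x))"
  by (simp add: group_algebra_def)

lemma group_algebra_eqI:
  assumes "a \<in> carrier (group_algebra F G)" "b \<in> carrier (group_algebra F G)"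
    and "\<And>x. x \<in> carrier G \<Longrightarrow> a x = b x"
  shows "a = b"
  using assms by (auto simp: group_algebra_def intro: PiE_ext)

lemma group_algebra_apply_closed:
  "a \<in> carrier (group_algebra F G) \<Longrightarrow> x \<in> carrier G \<Longrightarrow> a x \<in> carrier F"
  by (auto simp: group_algebra_def)

lemma group_algebra_mult_closed:
  "a \<in> carrier (group_algebra F G) \<Longrightarrow> b \<in> carrier (group_algebra F G) \<Longrightarrow>
    a \<otimes>\<^bsub>group_algebra F G\<^esub> b \<in> carrier (group_algebra F G)"
  by (auto simp: group_algebra_def PiE_iff intro!: F.finsum_closed)

lemma finsum_swap:
  assumes "finite A" "finite B" "\<And>x y. x \<in> A \<Longrightarrow> y \<in> B \<Longrightarrow> f x y \<in> carrier F"
  shows "(\<Oplus>x\<in>A. \<Oplus>y\<in>B. f x y) = (\<Oplus>y\<in>B. \<Oplus>x\<in>A. f x y)"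
  using assms(1,3)
proof (induction A rule: finite_induct)
  case empty
  then show ?case by simp
next
  case (insert a A)
  have "(\<Oplus>x\<in>insert a A. \<Oplus>y\<in>B. f x y) =
      (\<Oplus>y\<in>B. f a y) \<oplus> (\<Oplus>x\<in>A. \<Oplus>y\<in>B. f x y)"
    using insert by (subst F.finsum_insert) (auto intro!: F.finsum_closed)
  also have "\<dots> = (\<Oplus>y\<in>B. f a y \<oplus> (\<Oplus>x\<in>A. f x y))"
    using insert by (subst F.finsum_addf) (auto intro!: F.finsum_closed)
  also have "\<dots> = (\<Oplus>y\<in>B. \<Oplus>x\<in>insert a A. f x y)"
    using insert by (intro F.finsum_cong') (auto intro!: F.finsum_closed)
  finally show ?case .
qed

lemma finsum_translate:
  assumes y: "y \<in> carrier G" and f: "\<And>x. x \<in> carrier G \<Longrightarrow> f x \<in> carrier F"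
  shows "(\<Oplus>w\<in>carrier G. f w) = (\<Oplus>z\<in>carrier G. f (inv\<^bsub>G\<^esub> y \<otimes>\<^bsub>G\<^esub> z))"
proof -
  have inj: "inj_on (\<lambda>z. inv\<^bsub>G\<^esub> y \<otimes>\<^bsub>G\<^esub> z) (carrier G)"
    using y by (auto intro!: inj_onI)
  have "(\<lambda>z. inv\<^bsub>G\<^esub> y \<otimes>\<^bsub>G\<^esub> z) ` carrier G = carrier G"
    using y by (intro endo_inj_surj[OF fin _ inj]) auto
  then show ?thesis
    using F.finsum_reindex[OF _ inj, of f] f by (auto simp: Pi_iff)
qed

lemma group_algebra_mult_assoc:
  assumes a: "a \<in> carrier (group_algebra F G)" and b: "b \<in> carrier (group_algebra F G)"
    and c: "c \<in> carrier (group_algebra F G)"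
  shows "a \<otimes>\<^bsub>group_algebra F G\<^esub> b \<otimes>\<^bsub>group_algebra F G\<^esub> c =
      a \<otimes>\<^bsub>group_algebra F G\<^esub> (b \<otimes>\<^bsub>group_algebra F G\<^esub> c)"
proof (rule group_algebra_eqI)
  note cl = group_algebra_apply_closed[OF a] group_algebra_apply_closed[OF b]
    group_algebra_apply_closed[OF c]
  fix x assume x: "x \<in> carrier G"
  have "(a \<otimes>\<^bsub>group_algebra F G\<^esub> b \<otimes>\<^bsub>group_algebra F G\<^esub> c) x =
      (\<Oplus>z\<in>carrier G. (\<Oplus>y\<in>carrier G. a y \<otimes> b (inv\<^bsub>G\<^esub> y \<otimes>\<^bsub>G\<^esub> z))
        \<otimes> c (inv\<^bsub>G\<^esub> z \<otimes>\<^bsub>G\<^esub> x))"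
    unfolding group_algebra_mult_apply[OF x]
    by (rule F.finsum_cong') (use cl x in \<open>auto simp: group_algebra_mult_apply\<close>)
  also have "\<dots> = (\<Oplus>z\<in>carrier G. \<Oplus>y\<in>carrier G.
      a y \<otimes> b (inv\<^bsub>G\<^esub> y \<otimes>\<^bsub>G\<^esub> z) \<otimes> c (inv\<^bsub>G\<^esub> z \<otimes>\<^bsub>G\<^esub> x))"
    using cl x fin by (intro F.finsum_cong' F.finsum_ldistr) auto
  also have "\<dots> = (\<Oplus>y\<in>carrier G. \<Oplus>z\<in>carrier G.
      a y \<otimes> b (inv\<^bsub>G\<^esub> y \<otimes>\<^bsub>G\<^esub> z) \<otimes> c (inv\<^bsub>G\<^esub> z \<otimes>\<^bsub>G\<^esub> x))"
    using cl x fin by (intro finsum_swap) auto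
  also have "\<dots> = (\<Oplus>y\<in>carrier G. a y \<otimes>
      (\<Oplus>z\<in>carrier G. b (inv\<^bsub>G\<^esub> y \<otimes>\<^bsub>G\<^esub> z) \<otimes> c (inv\<^bsub>G\<^esub> z \<otimes>\<^bsub>G\<^esub> x)))"
    proof (rule F.finsum_cong')
    fix y assume y: "y \<in> carrier G"
    have "a y \<otimes> (\<Oplus>z\<in>carrier G. b (inv\<^bsub>G\<^esub> y \<otimes>\<^bsub>G\<^esub> z) \<otimes> c (inv\<^bsub>G\<^esub> z \<otimes>\<^bsub>G\<^esub> x)) =
        (\<Oplus>z\<in>carrier G. a y \<otimes> (b (inv\<^bsub>G\<^esub> y \<otimes>\<^bsub>G\<^esub> z) \<otimes> c (inv\<^bsub>G\<^esub> z \<otimes>\<^bsub>G\<^esub> x)))"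
      by (rule F.finsum_rdistr) (use cl x y fin in auto)
    also have "\<dots> = (\<Oplus>z\<in>carrier G.
        a y \<otimes> b (inv\<^bsub>G\<^esub> y \<otimes>\<^bsub>G\<^esub> z) \<otimes> c (inv\<^bsub>G\<^esub> z \<otimes>\<^bsub>G\<^esub> x))"
      by (rule F.finsum_cong') (use cl x y in \<open>auto simp: F.m_assoc\<close>)
    finally show "(\<Oplus>z\<in>carrier G.
        a y \<otimes> b (inv\<^bsub>G\<^esub> y \<otimes>\<^bsub>G\<^esub> z) \<otimes> c (inv\<^bsub>G\<^esub> z \<otimes>\<^bsub>G\<^esub> x)) =
        a y \<otimes> (\<Oplus>z\<in>carrier G. b (inv\<^bsub>G\<^esub> y \<otimes>\<^bsub>G\<^esub> z) \<otimes> c (inv\<^bsub>G\<^esub> z \<otimes>\<^bsub>G\<^esub> x))"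
      by simp
  qed (use cl x in auto)
  also have "\<dots> = (\<Oplus>y\<in>carrier G. a y \<otimes>
      (\<Oplus>w\<in>carrier G. b w \<otimes> c (inv\<^bsub>G\<^esub> w \<otimes>\<^bsub>G\<^esub> (inv\<^bsub>G\<^esub> y \<otimes>\<^bsub>G\<^esub> x))))"
  proof (rule F.finsum_cong')
    fix y assume y: "y \<in> carrier G"
    have "(\<Oplus>w\<in>carrier G. b w \<otimes> c (inv\<^bsub>G\<^esub> w \<otimes>\<^bsub>G\<^esub> (inv\<^bsub>G\<^esub> y \<otimes>\<^bsub>G\<^esub> x))) =
        (\<Oplus>z\<in>carrier G. b (inv\<^bsub>G\<^esub> y \<otimes>\<^bsub>G\<^esub> z) \<otimes>
          c (inv\<^bsub>G\<^esub> (inv\<^bsub>G\<^esub> y \<otimes>\<^bsub>G\<^esub> z) \<otimes>\<^bsub>G\<^esub> (inv\<^bsub>G\<^esub> y \<otimes>\<^bsub>G\<^esub> x)))"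
      by (rule finsum_translate) (use cl x y in auto)
    also have "\<dots> = (\<Oplus>z\<in>carrier G. b (inv\<^bsub>G\<^esub> y \<otimes>\<^bsub>G\<^esub> z) \<otimes> c (inv\<^bsub>G\<^esub> z \<otimes>\<^bsub>G\<^esub> x))"
    proof (rule F.finsum_cong')
      fix z assume z: "z \<in> carrier G"
      have "inv\<^bsub>G\<^esub> (inv\<^bsub>G\<^esub> y \<otimes>\<^bsub>G\<^esub> z) \<otimes>\<^bsub>G\<^esub> (inv\<^bsub>G\<^esub> y \<otimes>\<^bsub>G\<^esub> x) =
          inv\<^bsub>G\<^esub> z \<otimes>\<^bsub>G\<^esub> ((y \<otimes>\<^bsub>G\<^esub> inv\<^bsub>G\<^esub> y) \<otimes>\<^bsub>G\<^esub> x)"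
        using x y z by (simp only: G.inv_mult_group G.inv_inv G.inv_closed G.m_closed G.m_assoc)
      then show "b (inv\<^bsub>G\<^esub> y \<otimes>\<^bsub>G\<^esub> z) \<otimes>
          c (inv\<^bsub>G\<^esub> (inv\<^bsub>G\<^esub> y \<otimes>\<^bsub>G\<^esub> z) \<otimes>\<^bsub>G\<^esub> (inv\<^bsub>G\<^esub> y \<otimes>\<^bsub>G\<^esub> x)) =
          b (inv\<^bsub>G\<^esub> y \<otimes>\<^bsub>G\<^esub> z) \<otimes> c (inv\<^bsub>G\<^esub> z \<otimes>\<^bsub>G\<^esub> x)"
        using x y z by simp
    qed (use cl x y in auto)
    finally show "a y \<otimes>
        (\<Oplus>z\<in>carrier G. b (inv\<^bsub>G\<^esub> y \<otimes>\<^bsub>G\<^esub> z) \<otimes> c (inv\<^bsub>G\<^esub> z \<otimes>\<^bsub>G\<^esub> x)) =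
        a y \<otimes> (\<Oplus>w\<in>carrier G. b w \<otimes> c (inv\<^bsub>G\<^esub> w \<otimes>\<^bsub>G\<^esub> (inv\<^bsub>G\<^esub> y \<otimes>\<^bsub>G\<^esub> x)))"
      by simp
  qed (use cl x in auto)
  also have "\<dots> = (a \<otimes>\<^bsub>group_algebra F G\<^esub> (b \<otimes>\<^bsub>group_algebra F G\<^esub> c)) x"
    unfolding group_algebra_mult_apply[OF x]
    by (rule F.finsum_cong') (use cl x in \<open>auto simp: group_algebra_mult_apply\<close>)
  finally show "(a \<otimes>\<^bsub>group_algebra F G\<^esub> b \<otimes>\<^bsub>group_algebra F G\<^esub> c) x =
      (a \<otimes>\<^bsub>group_algebra F G\<^esub> (b \<otimes>\<^bsub>group_algebra F G\<^esub> c)) x" .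
qed (use a b c in \<open>auto intro!: group_algebra_mult_closed\<close>)

lemma group_algebra_one:
  assumes a: "a \<in> carrier (group_algebra F G)"
  shows "\<one>\<^bsub>group_algebra F G\<^esub> \<in> carrier (group_algebra F G)"
    and "\<one>\<^bsub>group_algebra F G\<^esub> \<otimes>\<^bsub>group_algebra F G\<^esub> a = a"
    and "a \<otimes>\<^bsub>group_algebra F G\<^esub> \<one>\<^bsub>group_algebra F G\<^esub> = a"
proof -
  note cl = group_algebra_apply_closed[OF a]
  show one: "\<one>\<^bsub>group_algebra F G\<^esub> \<in> carrier (group_algebra F G)"
    by (auto simp: group_algebra_def)
  have one_apply: "\<one>\<^bsub>group_algebra F G\<^esub> x = (if x = \<one>\<^bsub>G\<^esub> then \<one> else \<zero>)"
    if "x \<in> carrier G" for x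
    using that by (simp add: group_algebra_def)
  show "\<one>\<^bsub>group_algebra F G\<^esub> \<otimes>\<^bsub>group_algebra F G\<^esub> a = a"
  proof (rule group_algebra_eqI)
    fix x assume x: "x \<in> carrier G"
    have "(\<one>\<^bsub>group_algebra F G\<^esub> \<otimes>\<^bsub>group_algebra F G\<^esub> a) x =
        (\<Oplus>y\<in>carrier G. if \<one>\<^bsub>G\<^esub> = y then a (inv\<^bsub>G\<^esub> y \<otimes>\<^bsub>G\<^esub> x) else \<zero>)"
      unfolding group_algebra_mult_apply[OF x]
      by (rule F.finsum_cong') (use cl x in \<open>auto simp: one_apply\<close>)
    also have "\<dots> = a x"
      using F.finsum_singleton[of "\<one>\<^bsub>G\<^esub>" "carrier G" "\<lambda>y. a (inv\<^bsub>G\<^esub> y \<otimes>\<^bsub>G\<^esub> x)"] cl x fin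
      by auto
    finally show "(\<one>\<^bsub>group_algebra F G\<^esub> \<otimes>\<^bsub>group_algebra F G\<^esub> a) x = a x" .
  qed (use a one in \<open>auto intro: group_algebra_mult_closed\<close>)
  show "a \<otimes>\<^bsub>group_algebra F G\<^esub> \<one>\<^bsub>group_algebra F G\<^esub> = a"
  proof (rule group_algebra_eqI)
    fix x assume x: "x \<in> carrier G"
    have *: "inv\<^bsub>G\<^esub> y \<otimes>\<^bsub>G\<^esub> x = \<one>\<^bsub>G\<^esub> \<longleftrightarrow> x = y" if "y \<in> carrier G" for y
      using that x G.inv_solve_left'[of "\<one>\<^bsub>G\<^esub>" y x] by auto
    have "(a \<otimes>\<^bsub>group_algebra F G\<^esub> \<one>\<^bsub>group_algebra F G\<^esub>) x =
        (\<Oplus>y\<in>carrier G. if x = y then a y else \<zero>)"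
      unfolding group_algebra_mult_apply[OF x]
      by (rule F.finsum_cong') (use cl x in \<open>auto simp: one_apply *\<close>)
    also have "\<dots> = a x"
      using F.finsum_singleton[of x "carrier G" a] cl x fin by auto
    finally show "(a \<otimes>\<^bsub>group_algebra F G\<^esub> \<one>\<^bsub>group_algebra F G\<^esub>) x = a x" .
  qed (use a one in \<open>auto intro: group_algebra_mult_closed\<close>)
qed

lemma group_algebra_ring: "ring (group_algebra F G)"
proof (rule ringI[OF group_algebra_abelian_group])
  have "\<one>\<^bsub>group_algebra F G\<^esub> \<in> carrier (group_algebra F G)"
    by (auto simp: group_algebra_def)
  then show "monoid (group_algebra F G)"
    by (intro monoidI)
      (simp_all add: group_algebra_mult_closed group_algebra_mult_assoc group_algebra_one)
next
  interpret A: abelian_group "group_algebra F G" by (rule group_algebra_abelian_group)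
  fix a b c assume abc: "a \<in> carrier (group_algebra F G)" "b \<in> carrier (group_algebra F G)"
    "c \<in> carrier (group_algebra F G)"
  note cl = abc[THEN group_algebra_apply_closed]
  have add_apply: "(u \<oplus>\<^bsub>group_algebra F G\<^esub> v) x = u x \<oplus> v x" if "x \<in> carrier G" for u v x
    using that by (simp add: group_algebra_def)
  show "(a \<oplus>\<^bsub>group_algebra F G\<^esub> b) \<otimes>\<^bsub>group_algebra F G\<^esub> c =
      a \<otimes>\<^bsub>group_algebra F G\<^esub> c \<oplus>\<^bsub>group_algebra F G\<^esub> b \<otimes>\<^bsub>group_algebra F G\<^esub> c"
  proof (rule group_algebra_eqI)
    fix x assume x: "x \<in> carrier G"
    have "((a \<oplus>\<^bsub>group_algebra F G\<^esub> b) \<otimes>\<^bsub>group_algebra F G\<^esub> c) x =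
        (\<Oplus>y\<in>carrier G. a y \<otimes> c (inv\<^bsub>G\<^esub> y \<otimes>\<^bsub>G\<^esub> x) \<oplus> b y \<otimes> c (inv\<^bsub>G\<^esub> y \<otimes>\<^bsub>G\<^esub> x))"
      unfolding group_algebra_mult_apply[OF x]
      by (rule F.finsum_cong') (use cl x in \<open>auto simp: add_apply F.l_distr\<close>)
    also have "\<dots> = (a \<otimes>\<^bsub>group_algebra F G\<^esub> c \<oplus>\<^bsub>group_algebra F G\<^esub> b \<otimes>\<^bsub>group_algebra F G\<^esub> c) x"
      unfolding add_apply[OF x] group_algebra_mult_apply[OF x]
      by (rule F.finsum_addf) (use cl x in auto)
    finally show "((a \<oplus>\<^bsub>group_algebra F G\<^esub> b) \<otimes>\<^bsub>group_algebra F G\<^esub> c) x =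
        (a \<otimes>\<^bsub>group_algebra F G\<^esub> c \<oplus>\<^bsub>group_algebra F G\<^esub> b \<otimes>\<^bsub>group_algebra F G\<^esub> c) x" .
  qed (use abc in \<open>auto intro!: group_algebra_mult_closed A.a_closed\<close>)
  show "c \<otimes>\<^bsub>group_algebra F G\<^esub> (a \<oplus>\<^bsub>group_algebra F G\<^esub> b) =
      c \<otimes>\<^bsub>group_algebra F G\<^esub> a \<oplus>\<^bsub>group_algebra F G\<^esub> c \<otimes>\<^bsub>group_algebra F G\<^esub> b"
  proof (rule group_algebra_eqI)
    fix x assume x: "x \<in> carrier G"
    have "(c \<otimes>\<^bsub>group_algebra F G\<^esub> (a \<oplus>\<^bsub>group_algebra F G\<^esub> b)) x =
        (\<Oplus>y\<in>carrier G. c y \<otimes> a (inv\<^bsub>G\<^esub> y \<otimes>\<^bsub>G\<^esub> x) \<oplus> c y \<otimes> b (inv\<^bsub>G\<^esub> y \<otimes>\<^bsub>G\<^esub> x))"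
      unfolding group_algebra_mult_apply[OF x]
      by (rule F.finsum_cong') (use cl x in \<open>auto simp: add_apply F.r_distr\<close>)
    also have "\<dots> = (c \<otimes>\<^bsub>group_algebra F G\<^esub> a \<oplus>\<^bsub>group_algebra F G\<^esub> c \<otimes>\<^bsub>group_algebra F G\<^esub> b) x"
      unfolding add_apply[OF x] group_algebra_mult_apply[OF x]
      by (rule F.finsum_addf) (use cl x in auto)
    finally show "(c \<otimes>\<^bsub>group_algebra F G\<^esub> (a \<oplus>\<^bsub>group_algebra F G\<^esub> b)) x =
        (c \<otimes>\<^bsub>group_algebra F G\<^esub> a \<oplus>\<^bsub>group_algebra F G\<^esub> c \<otimes>\<^bsub>group_algebra F G\<^esub> b) x" .
  qed (use abc in \<open>auto intro!: group_algebra_mult_closed A.a_closed\<close>)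
qed

lemma group_algebra_smult_mult:
  assumes c: "c \<in> carrier F" and a: "a \<in> carrier (group_algebra F G)"
    and b: "b \<in> carrier (group_algebra F G)"
  shows "(c \<odot>\<^bsub>group_algebra F G\<^esub> a) \<otimes>\<^bsub>group_algebra F G\<^esub> b =
      c \<odot>\<^bsub>group_algebra F G\<^esub> (a \<otimes>\<^bsub>group_algebra F G\<^esub> b)"
    and "a \<otimes>\<^bsub>group_algebra F G\<^esub> (c \<odot>\<^bsub>group_algebra F G\<^esub> b) =
      c \<odot>\<^bsub>group_algebra F G\<^esub> (a \<otimes>\<^bsub>group_algebra F G\<^esub> b)"
proof -
  interpret A: module F "group_algebra F G" by (rule group_algebra_module)
  note cl = a[THEN group_algebra_apply_closed] b[THEN group_algebra_apply_closed]
  have smult_apply: "(c \<odot>\<^bsub>group_algebra F G\<^esub> u) x = c \<otimes> u x" if "x \<in> carrier G" for u x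
    using that by (simp add: group_algebra_def)
  have distr: "(c \<odot>\<^bsub>group_algebra F G\<^esub> (a \<otimes>\<^bsub>group_algebra F G\<^esub> b)) x =
      (\<Oplus>y\<in>carrier G. c \<otimes> (a y \<otimes> b (inv\<^bsub>G\<^esub> y \<otimes>\<^bsub>G\<^esub> x)))" if x: "x \<in> carrier G" for x
    unfolding smult_apply[OF x] group_algebra_mult_apply[OF x]
    by (rule F.finsum_rdistr) (use cl c x fin in auto)
  show "(c \<odot>\<^bsub>group_algebra F G\<^esub> a) \<otimes>\<^bsub>group_algebra F G\<^esub> b =
      c \<odot>\<^bsub>group_algebra F G\<^esub> (a \<otimes>\<^bsub>group_algebra F G\<^esub> b)"
  proof (rule group_algebra_eqI)
    fix x assume x: "x \<in> carrier G"
    show "((c \<odot>\<^bsub>group_algebra F G\<^esub> a) \<otimes>\<^bsub>group_algebra F G\<^esub> b) x =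
        (c \<odot>\<^bsub>group_algebra F G\<^esub> (a \<otimes>\<^bsub>group_algebra F G\<^esub> b)) x"
      unfolding distr[OF x] group_algebra_mult_apply[OF x]
      by (rule F.finsum_cong') (use cl c x in \<open>auto simp: smult_apply F.m_assoc\<close>)
  qed (use a b c in \<open>auto intro!: group_algebra_mult_closed A.smult_closed\<close>)
  show "a \<otimes>\<^bsub>group_algebra F G\<^esub> (c \<odot>\<^bsub>group_algebra F G\<^esub> b) =
      c \<odot>\<^bsub>group_algebra F G\<^esub> (a \<otimes>\<^bsub>group_algebra F G\<^esub> b)"
  proof (rule group_algebra_eqI)
    fix x assume x: "x \<in> carrier G"
    show "(a \<otimes>\<^bsub>group_algebra F G\<^esub> (c \<odot>\<^bsub>group_algebra F G\<^esub> b)) x =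
        (c \<odot>\<^bsub>group_algebra F G\<^esub> (a \<otimes>\<^bsub>group_algebra F G\<^esub> b)) x"
      unfolding distr[OF x] group_algebra_mult_apply[OF x]
      by (rule F.finsum_cong') (use cl c x in \<open>auto simp: smult_apply F.m_lcomm\<close>)
  qed (use a b c in \<open>auto intro!: group_algebra_mult_closed A.smult_closed\<close>)
qed

end

end

theory Submission
  imports
    Defs
    "HOL-Algebra.Group_Action"
    "HOL-Algebra.Weak_Morphisms"
    "HOL-Algebra.Zassenhaus"
begin

text \<open>
Since a dihedral group has even order, \<open>p = 2\<close>.  Let \<open>z\<close> generate the centre of \<open>G\<close>, with order
\<open>2^c\<close>, and let the central quotient have order \<open>2^(m + 1)\<close>.  Lifts \<open>x\<close> and \<open>y\<close> of the two
involutions have their squares in the centre.  Central factors change these squares by even powers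
of \<open>z\<close>, so one may take \<open>x^2 = z^q\<close> and \<open>y^2 = z^q'\<close> with exponents 0 or 1.  Then
\<open>a = x y z^(- q q')\<close> satisfies \<open>x a = a^(-1) z^s x\<close> with \<open>s = q + q' - 2 q q'\<close>, and
\<open>a^(2^m) = z^(s 2^(m - 1) + 2^(c - 1))\<close> is forced, because otherwise the centre would be larger
(\<open>dihedral_ext_of_pair\<close>).  Hence \<open>m\<close>, \<open>c\<close> and the pair \<open>(s, q)\<close>, one of \<open>(0, 0)\<close>, \<open>(1, 0)\<close>
and \<open>(0, 1)\<close>, determine \<open>G\<close> up to isomorphism (\<open>dihedral_ext_iso\<close>).  For \<open>c = 1\<close> and \<open>m \<ge> 2\<close>
the three families are the dihedral, semidihedral and generalised quaternion groups.

The group algebra shows first that \<open>H\<close> is again such a group, with the same \<open>m\<close> and \<open>c\<close>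
(\<open>dihedral_ext_transfer\<close>).  The order, the order of the centre and the index of the subgroup
generated by centre and commutators are ranks of pairings between elements and functionals of the
algebra: all elements and all functionals; central elements and traces; all elements and the
functionals that kill commutators and reduce central elements to their augmentation.  An invertible
pairing for \<open>G\<close> turns, for \<open>H\<close>, into a factorisation of the identity matrix through the
corresponding set for \<open>H\<close> (\<open>card_le_if_factors\<close>); this uses that a class function on a 2-group has
the same sum over the group and over its centre (\<open>class_function_sum\<close>).  Squaring central elements
repeatedly detects the exponent of the centre, so the centre of \<open>H\<close> is cyclic (\<open>center_exponent\<close>).
The central quotient of \<open>H\<close> has abelianisation of order four, hence a cyclic subgroup of index two
by Taussky's theorem (\<open>cyclic_index_two\<close>).  The preimage of that subgroup is abelian, so the square
of an element outside is central (\<open>pair_of_index_four\<close>).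

It remains to read off \<open>(s, q)\<close>.  The augmentation of the group algebra is its only algebra
homomorphism to the field, so the derivations into the field, which correspond to the homomorphisms
from the group to the additive group of the field, are preserved by isomorphisms.  Three properties
separate the families: whether some derivation is nonzero on a central element, whether some
derivation is nonzero on a square-zero element, and whether only the zero derivation kills all
square-zero elements.  Involutions \<open>x\<close> yield square-zero elements \<open>x + 1\<close>; the work is in the
opposite direction.  If \<open>w^2 = 0\<close>, then the coefficients of \<open>w\<close> sum to zero over the square roots
of any conjugation-invariant set (\<open>square_zero_roots\<close>); unless they sum to zero outside an abelian
subgroup of index two, they are invariant under conjugation on that subgroup
(\<open>square_zero_invariant\<close>); and the sums over the two classes of reflections \<open>a^i z^j x\<close>, with \<open>i\<close>
even and with \<open>i\<close> odd, have product zero (\<open>reflection_sums_product\<close>).  Two coincidences between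
the families occur: \<open>(0, 0)\<close> and \<open>(1, 0)\<close> describe the same group for \<open>m = c = 1\<close>, and so do
\<open>(1, 0)\<close> and \<open>(0, 1)\<close> for \<open>m = 1\<close> and \<open>c \<ge> 2\<close>.
\<close>

section \<open>Sums in a field of characteristic two\<close>

locale char2_field = field F for F (structure) +
  assumes one_add_one: "\<one> \<oplus> \<one> = \<zero>"
begin

lemma add_self [simp]:
  assumes "x \<in> carrier F" shows "x \<oplus> x = \<zero>"
proof -
  have "x \<oplus> x = x \<otimes> (\<one> \<oplus> \<one>)"
    using assms by (simp only: r_distr one_closed r_one)
  then show ?thesis using assms one_add_one by simp
qed

lemma add_eq_zero_iff:
  assumes "x \<in> carrier F" "y \<in> carrier F" shows "x \<oplus> y = \<zero> \<longleftrightarrow> x = y"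
proof
  assume "x \<oplus> y = \<zero>"
  then have "x \<oplus> y \<oplus> y = y" using assms by simp
  then show "x = y" using assms by (simp add: a_assoc)
qed (use assms in auto)

lemma square_add:
  assumes "x \<in> carrier F" "y \<in> carrier F"
  shows "(x \<oplus> y) \<otimes> (x \<oplus> y) = x \<otimes> x \<oplus> y \<otimes> y"
proof -
  have "(x \<oplus> y) \<otimes> (x \<oplus> y) = x \<otimes> x \<oplus> y \<otimes> y \<oplus> (x \<otimes> y \<oplus> x \<otimes> y)"
    using assms by algebra
  then show ?thesis using assms by simp
qed

lemma square_eq_zero_iff:
  "x \<in> carrier F \<Longrightarrow> x \<otimes> x = \<zero> \<longleftrightarrow> x = \<zero>"
  using integral_iff by auto

lemma finsum_square:
  assumes "finite S" "f \<in> S \<rightarrow> carrier F"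
  shows "finsum F f S \<otimes> finsum F f S = (\<Oplus>s\<in>S. f s \<otimes> f s)"
  using assms
proof (induction S rule: finite_induct)
  case (insert a S)
  then have "f a \<in> carrier F" "f \<in> S \<rightarrow> carrier F" by auto
  with insert show ?case
    by (auto simp: finsum_insert square_add Pi_iff)
qed auto

lemma finsum_split:
  assumes "finite S" "f \<in> S \<rightarrow> carrier F"
  shows "finsum F f S = finsum F f {s \<in> S. P s} \<oplus> finsum F f {s \<in> S. \<not> P s}"
proof -
  have "finsum F f ({s \<in> S. P s} \<union> {s \<in> S. \<not> P s})
      = finsum F f {s \<in> S. P s} \<oplus> finsum F f {s \<in> S. \<not> P s}"
    using assms by (intro finsum_Un_disjoint) auto
  moreover have "{s \<in> S. P s} \<union> {s \<in> S. \<not> P s} = S" by auto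
  ultimately show ?thesis by simp
qed

text \<open>A two-element orbit of the involution contributes \<open>f s + f s = 0\<close>.\<close>

lemma finsum_involution:
  assumes "finite S" "f \<in> S \<rightarrow> carrier F" "\<And>s. s \<in> S \<Longrightarrow> i s \<in> S"
    and "\<And>s. s \<in> S \<Longrightarrow> i (i s) = s" "\<And>s. s \<in> S \<Longrightarrow> f (i s) = f s"
  shows "finsum F f S = finsum F f {s \<in> S. i s = s}"
  using assms
proof (induction "card S" arbitrary: S rule: less_induct)
  case less
  show ?case
  proof (cases "\<exists>s\<in>S. i s \<noteq> s")
    case False
    then have "{s \<in> S. i s = s} = S" by auto
    then show ?thesis by simp
  next
    case True
    then obtain s where s: "s \<in> S" "i s \<noteq> s" by auto
    define T where "T = S - {s, i s}"
    have T: "finite T" "T \<subseteq> S" "s \<notin> T" "i s \<notin> T" "S = insert s (insert (i s) T)"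
      using less.prems s by (auto simp: T_def)
    have fc: "f s \<in> carrier F" "f (i s) \<in> carrier F" "f \<in> T \<rightarrow> carrier F"
      using less.prems s T by auto
    have "card T < card S"
      using T s less.prems(1) by (metis psubset_card_mono psubsetI)
    moreover have iT: "i t \<in> T" if "t \<in> T" for t
      using that less.prems(3,4) s unfolding T_def by (metis Diff_iff insert_iff empty_iff)
    ultimately have IH: "finsum F f T = finsum F f {t \<in> T. i t = t}"
    proof (intro less.hyps)
      show "finite T" by (rule T(1))
      show "f \<in> T \<rightarrow> carrier F" by (rule fc(3))
    qed (use T(2) less.prems(4,5) in \<open>auto\<close>)
    have "finsum F f S = f s \<oplus> (f (i s) \<oplus> finsum F f T)"
      using T(1,3,4) fc s(2)
      by (subst T(5)) (auto simp: finsum_insert Pi_iff)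
    also have "\<dots> = finsum F f T"
      using fc less.prems(5)[OF s(1)]
      by (metis a_assoc add_self finsum_closed l_zero)
    also have "{t \<in> T. i t = t} = {t \<in> S. i t = t}"
      using s less.prems(4)[OF s(1)] unfolding T_def by auto
    ultimately show ?thesis using IH by simp
  qed
qed

lemma finsum_const_even:
  assumes "finite S" "even (card S)" "a \<in> carrier F"
  shows "(\<Oplus>s\<in>S. a) = \<zero>"
proof -
  obtain k where k: "card S = k + k" using assms(2) by (metis evenE mult_2)
  have "(\<Oplus>s\<in>S. a) = add_pow F (card S) a"
    using add.finprod_const[of a S] assms by (simp add: finsum_def add_pow_def)
  also have "\<dots> = add_pow F k a \<oplus> add_pow F k a"
    unfolding k using assms(3) add.nat_pow_mult[of a k k] by (simp add: add_pow_def)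
  also have "\<dots> = \<zero>"
    using assms(3) add.nat_pow_closed[of a k] by (simp add: add_pow_def)
  finally show ?thesis .
qed

end

section \<open>A rank inequality\<close>

text \<open>Gaussian elimination, one column at a time: a row with a nonzero entry in the new column clears
  that column from the other rows, and a relation between the new rows extends to it.\<close>

lemma (in field) exists_relation:
  assumes "finite J"
  shows "finite I \<Longrightarrow> card J < card I \<Longrightarrow> (\<And>i j. i \<in> I \<Longrightarrow> j \<in> J \<Longrightarrow> P i j \<in> carrier R) \<Longrightarrow>
    \<exists>v. v \<in> I \<rightarrow> carrier R \<and> (\<exists>i\<in>I. v i \<noteq> \<zero>) \<and> (\<forall>j\<in>J. (\<Oplus>i\<in>I. v i \<otimes> P i j) = \<zero>)"
  using assms
proof (induction J arbitrary: I P rule: finite_induct)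
  case empty
  then obtain i where "i \<in> I" by fastforce
  then show ?case by (intro exI[of _ "\<lambda>_. \<one>"]) auto
next
  case (insert k J)
  show ?case
  proof (cases "\<exists>i\<in>I. P i k \<noteq> \<zero>")
    case False
    have "\<exists>v. v \<in> I \<rightarrow> carrier R \<and> (\<exists>i\<in>I. v i \<noteq> \<zero>) \<and> (\<forall>j\<in>J. (\<Oplus>i\<in>I. v i \<otimes> P i j) = \<zero>)"
      using insert by (intro insert.IH) auto
    then obtain v where v: "v \<in> I \<rightarrow> carrier R" "\<exists>i\<in>I. v i \<noteq> \<zero>"
      "\<forall>j\<in>J. (\<Oplus>i\<in>I. v i \<otimes> P i j) = \<zero>" by auto
    have "(\<Oplus>i\<in>I. v i \<otimes> P i k) = (\<Oplus>i\<in>I. \<zero>)"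
      using False v(1) by (intro finsum_cong') (auto simp: Pi_iff)
    then show ?thesis using v by (intro exI[of _ v]) auto
  next
    case True
    then obtain i0 where i0: "i0 \<in> I" "P i0 k \<noteq> \<zero>" by auto
    \<comment> \<open>row \<open>i0\<close> serves as the pivot row for column \<open>k\<close>\<close>
    define I' where "I' = I - {i0}"
    have I': "finite I'" "i0 \<notin> I'" "I = insert i0 I'" "card J < card I'"
      using insert i0 by (auto simp: I'_def)
    define p where "p = P i0 k"
    have p: "p \<in> carrier R" "p \<noteq> \<zero>" "inv p \<in> carrier R" "p \<otimes> inv p = \<one>" "inv p \<otimes> p = \<one>"
      using insert.prems(3)[of i0 k] i0 field_Units unfolding p_def by auto
    have Pc: "P i j \<in> carrier R" if "i \<in> I" "j \<in> insert k J" for i j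
      using insert.prems(3) that by auto
    define Q where "Q i j = P i j \<ominus> P i k \<otimes> inv p \<otimes> P i0 j" for i j
    have Qc: "Q i j \<in> carrier R" if "i \<in> I" "j \<in> insert k J" for i j
      using that Pc i0 p unfolding Q_def by auto
    have "\<exists>v. v \<in> I' \<rightarrow> carrier R \<and> (\<exists>i\<in>I'. v i \<noteq> \<zero>) \<and> (\<forall>j\<in>J. (\<Oplus>i\<in>I'. v i \<otimes> Q i j) = \<zero>)"
      using Qc I' by (intro insert.IH) auto
    then obtain v where v: "v \<in> I' \<rightarrow> carrier R" "\<exists>i\<in>I'. v i \<noteq> \<zero>"
      "\<And>j. j \<in> J \<Longrightarrow> (\<Oplus>i\<in>I'. v i \<otimes> Q i j) = \<zero>" by auto
    define s where "s = (\<Oplus>i\<in>I'. v i \<otimes> P i k)"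
    have s: "s \<in> carrier R" using v(1) Pc I' unfolding s_def by (auto intro!: finsum_closed)
    define w where "w i = (if i = i0 then \<ominus> (s \<otimes> inv p) else v i)" for i
    have wc: "w \<in> I \<rightarrow> carrier R" using v(1) s p I' unfolding w_def by auto
    have sum: "(\<Oplus>i\<in>I. w i \<otimes> P i j) = (\<Oplus>i\<in>I'. v i \<otimes> P i j) \<ominus> s \<otimes> inv p \<otimes> P i0 j"
      if j: "j \<in> insert k J" for j
    proof -
      have "(\<Oplus>i\<in>I. w i \<otimes> P i j) = w i0 \<otimes> P i0 j \<oplus> (\<Oplus>i\<in>I'. w i \<otimes> P i j)"
        unfolding I'(3) using I' wc Pc j by (intro finsum_insert) auto
      also have "(\<Oplus>i\<in>I'. w i \<otimes> P i j) = (\<Oplus>i\<in>I'. v i \<otimes> P i j)"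
        using I' v(1) Pc j by (intro finsum_cong') (auto simp: w_def)
      also have "w i0 \<otimes> P i0 j = \<ominus> (s \<otimes> inv p \<otimes> P i0 j)"
        using s p Pc[OF i0(1) j] by (simp add: w_def l_minus)
      finally show ?thesis
        using s p Pc[OF i0(1) j] v(1) Pc j I'
        by (simp add: a_minus_def a_comm finsum_closed Pi_iff)
    qed
    have "(\<Oplus>i\<in>I. w i \<otimes> P i j) = \<zero>" if j: "j \<in> insert k J" for j
    proof (cases "j = k")
      case True
      have "s \<otimes> inv p \<otimes> P i0 k = s" using s p by (simp add: p_def m_assoc)
      then show ?thesis
        unfolding True sum[OF insertI1] s_def[symmetric] using s by (simp add: a_minus_def r_neg)
    next
      case False
      then have jJ: "j \<in> J" using j by auto
      have "s \<otimes> inv p \<otimes> P i0 j = (\<Oplus>i\<in>I'. v i \<otimes> P i k) \<otimes> (inv p \<otimes> P i0 j)"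
        using s p Pc[OF i0(1) j] by (simp add: s_def m_assoc)
      also have "\<dots> = (\<Oplus>i\<in>I'. v i \<otimes> P i k \<otimes> (inv p \<otimes> P i0 j))"
        using v(1) Pc I' p i0 j by (intro finsum_ldistr) auto
      finally have e1: "s \<otimes> inv p \<otimes> P i0 j = (\<Oplus>i\<in>I'. v i \<otimes> P i k \<otimes> (inv p \<otimes> P i0 j))" .
      have "(\<Oplus>i\<in>I'. v i \<otimes> P i j) = (\<Oplus>i\<in>I'. v i \<otimes> Q i j \<oplus> v i \<otimes> P i k \<otimes> (inv p \<otimes> P i0 j))"
      proof (rule finsum_cong')
        fix i assume i: "i \<in> I'"
        have c: "v i \<in> carrier R" "P i j \<in> carrier R" "P i k \<in> carrier R" "P i0 j \<in> carrier R"
          using v(1) Pc i i0 I' j by auto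
        show "v i \<otimes> P i j = v i \<otimes> Q i j \<oplus> v i \<otimes> P i k \<otimes> (inv p \<otimes> P i0 j)"
          unfolding Q_def using c p(3) by algebra
      qed (use v(1) Qc Pc I' p i0 j in \<open>auto simp: Pi_iff\<close>)
      also have "\<dots> = (\<Oplus>i\<in>I'. v i \<otimes> Q i j) \<oplus> (\<Oplus>i\<in>I'. v i \<otimes> P i k \<otimes> (inv p \<otimes> P i0 j))"
        using v(1) Qc Pc I' p i0 j by (intro finsum_addf) (auto simp: Pi_iff)
      finally have "(\<Oplus>i\<in>I'. v i \<otimes> P i j) = s \<otimes> inv p \<otimes> P i0 j"
        using v(3)[OF jJ] s p Pc[OF i0(1) j] e1 by (metis l_zero m_closed)
      then show ?thesis
        unfolding sum[OF j] using s p Pc[OF i0(1) j] by (simp add: a_minus_def r_neg)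
    qed
    moreover have "\<exists>i\<in>I. w i \<noteq> \<zero>"
      using v(2) I'(2,3) unfolding w_def by auto
    ultimately show ?thesis using wc by blast
  qed
qed

text \<open>A nontrivial relation \<open>v P = 0\<close>, which exists if \<open>I\<close> is larger than \<open>J\<close>, would give
  \<open>v = v P Q = 0\<close>.\<close>

lemma (in field) card_le_if_factors:
  assumes "finite I" "finite J"
    and P: "\<And>i j. i \<in> I \<Longrightarrow> j \<in> J \<Longrightarrow> P i j \<in> carrier R"
    and Q: "\<And>i j. i \<in> I \<Longrightarrow> j \<in> J \<Longrightarrow> Q j i \<in> carrier R"
    and PQ: "\<And>i i'. i \<in> I \<Longrightarrow> i' \<in> I \<Longrightarrow> (\<Oplus>j\<in>J. P i j \<otimes> Q j i') = (if i = i' then \<one> else \<zero>)"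
  shows "card I \<le> card J"
proof (rule ccontr)
  assume "\<not> card I \<le> card J"
  then have "\<exists>v. v \<in> I \<rightarrow> carrier R \<and> (\<exists>i\<in>I. v i \<noteq> \<zero>) \<and> (\<forall>j\<in>J. (\<Oplus>i\<in>I. v i \<otimes> P i j) = \<zero>)"
    using assms(1,2) P by (intro exists_relation) auto
  then obtain v i' where v: "v \<in> I \<rightarrow> carrier R" "i' \<in> I" "v i' \<noteq> \<zero>"
    and z: "\<And>j. j \<in> J \<Longrightarrow> (\<Oplus>i\<in>I. v i \<otimes> P i j) = \<zero>" by auto
  have vc: "\<And>i. i \<in> I \<Longrightarrow> v i \<in> carrier R" using v by auto
  have "v i' = (\<Oplus>i\<in>I. if i' = i then v i else \<zero>)"
    using finsum_singleton[OF v(2) assms(1), of v] vc by auto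
  also have "\<dots> = (\<Oplus>i\<in>I. v i \<otimes> (\<Oplus>j\<in>J. P i j \<otimes> Q j i'))"
    using vc v(2) PQ by (intro finsum_cong') auto
  also have "\<dots> = (\<Oplus>i\<in>I. \<Oplus>j\<in>J. v i \<otimes> (P i j \<otimes> Q j i'))"
    using vc P Q v(2) assms by (intro finsum_cong' finsum_rdistr) (auto intro!: finsum_closed)
  also have "\<dots> = (\<Oplus>j\<in>J. \<Oplus>i\<in>I. v i \<otimes> (P i j \<otimes> Q j i'))"
    using vc P Q v(2) assms by (intro finsum_swap[OF is_cring singleton_group[of undefined]]) (auto simp: singleton_group_def)
  also have "\<dots> = (\<Oplus>j\<in>J. \<zero>)"
  proof (rule finsum_cong')
    fix j assume j: "j \<in> J"
    have "(\<Oplus>i\<in>I. v i \<otimes> (P i j \<otimes> Q j i')) = (\<Oplus>i\<in>I. (v i \<otimes> P i j) \<otimes> Q j i')"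
      using vc P Q v(2) j by (intro finsum_cong') (auto simp: m_assoc)
    also have "\<dots> = (\<Oplus>i\<in>I. v i \<otimes> P i j) \<otimes> Q j i'"
      using vc P Q v(2) j assms by (intro finsum_ldistr[symmetric]) auto
    finally show "(\<Oplus>i\<in>I. v i \<otimes> (P i j \<otimes> Q j i')) = \<zero>" using z[OF j] Q v(2) j by simp
  qed auto
  finally show False using v(3) by simp
qed

section \<open>Class functions on a 2-group\<close>

definition conj_class :: "('a, 'm) monoid_scheme \<Rightarrow> 'a \<Rightarrow> 'a set" where
  "conj_class G g = (\<lambda>h. h \<otimes>\<^bsub>G\<^esub> g \<otimes>\<^bsub>G\<^esub> inv\<^bsub>G\<^esub> h) ` carrier G"

definition conj_invariant :: "('a, 'm) monoid_scheme \<Rightarrow> 'a set \<Rightarrow> bool" where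
  "conj_invariant G S \<longleftrightarrow> S \<subseteq> carrier G \<and>
    (\<forall>g\<in>S. \<forall>h\<in>carrier G. h \<otimes>\<^bsub>G\<^esub> g \<otimes>\<^bsub>G\<^esub> inv\<^bsub>G\<^esub> h \<in> S)"

locale two_group = group G for G (structure) +
  assumes fin: "finite (carrier G)" and order_pow: "\<exists>n. order G = 2 ^ n"
begin

lemma dvd_order_imp_pow: "k dvd order G \<Longrightarrow> \<exists>n. k = 2 ^ n"
  using order_pow divides_primepow_nat[OF two_is_prime_nat] by auto

lemma mem_center_iff: "g \<in> carrier G \<Longrightarrow> g \<in> center G \<longleftrightarrow> (\<forall>h\<in>carrier G. h \<otimes> g \<otimes> inv h = g)"
  by (auto simp: center_def inv_solve_right')

text \<open>The size of a class is the index of a centraliser, a power of two, and it is 1 only for central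
  elements.\<close>

lemma even_card_conj_class:
  assumes "g \<in> carrier G" "g \<notin> center G"
  shows "even (card (conj_class G g))"
proof -
  have orb: "orbit G (\<lambda>g. (\<lambda>h \<in> carrier G. g \<otimes> h \<otimes> (inv g))) g = conj_class G g"
    unfolding orbit_def conj_class_def image_def restrict_apply'[OF assms(1)] by blast
  interpret act: group_action G "carrier G" "\<lambda>g. (\<lambda>h \<in> carrier G. g \<otimes> h \<otimes> (inv g))"
    by (rule action_by_conjugation)
  have "card (conj_class G g) dvd order G"
    by (rule dvdI) (rule act.orbit_stabilizer_theorem[OF assms(1), unfolded orb, symmetric])
  then obtain n where n: "card (conj_class G g) = 2 ^ n"
    using dvd_order_imp_pow by blast
  have "n \<noteq> 0"
  proof
    assume "n = 0"
    then obtain c where c: "conj_class G g = {c}" using n card_1_singletonE by force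
    have "g \<in> conj_class G g" using assms by (auto simp: conj_class_def image_iff intro!: bexI[of _ \<one>])
    then have "h \<otimes> g \<otimes> inv h = g" if "h \<in> carrier G" for h
      using that c unfolding conj_class_def by auto
    then show False using assms mem_center_iff by auto
  qed
  then show ?thesis using n by simp
qed

lemma conj_class_self: "g \<in> carrier G \<Longrightarrow> g \<in> conj_class G g"
  by (auto simp: conj_class_def image_iff intro!: bexI[of _ \<one>])

lemma conj_conj:
  assumes "g \<in> carrier G" "h \<in> carrier G" "k \<in> carrier G"
  shows "h \<otimes> (k \<otimes> g \<otimes> inv k) \<otimes> inv h = (h \<otimes> k) \<otimes> g \<otimes> inv (h \<otimes> k)"
  using assms by (simp add: m_assoc inv_mult_group)

lemma conj_inv_conj:
  assumes "g \<in> carrier G" "h \<in> carrier G"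
  shows "inv h \<otimes> (h \<otimes> g \<otimes> inv h) \<otimes> h = g"
  using assms by (simp add: m_assoc) (simp add: m_assoc[symmetric])

text \<open>A conjugation-invariant set without central elements is a disjoint union of classes of even
  size.\<close>

lemma conj_invariant_induct [consumes 2, case_names empty insert]:
  assumes "conj_invariant G S" "S \<inter> center G = {}"
    and "P {}"
    and "\<And>S g. conj_invariant G S \<Longrightarrow> g \<in> carrier G \<Longrightarrow> g \<notin> center G \<Longrightarrow> conj_class G g \<inter> S = {}
      \<Longrightarrow> P S \<Longrightarrow> P (conj_class G g \<union> S)"
  shows "P S"
  using assms(1,2)
proof (induction "card S" arbitrary: S rule: less_induct)
  case less
  have S: "finite S" "S \<subseteq> carrier G"
    using less.prems(1) fin finite_subset by (auto simp: conj_invariant_def)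
  show ?case
  proof (cases "S = {}")
    case False
    then obtain g where g: "g \<in> S" by auto
    then have gG: "g \<in> carrier G" "g \<notin> center G" using S less.prems by auto
    let ?C = "conj_class G g"
    have C: "?C \<subseteq> S" "g \<in> ?C"
      using less.prems(1) g conj_class_self[OF gG(1)] by (auto simp: conj_invariant_def conj_class_def)
    have inv: "conj_invariant G (S - ?C)"
      unfolding conj_invariant_def
    proof (intro conjI ballI)
      fix s h assume s: "s \<in> S - ?C" and h: "h \<in> carrier G"
      have sG: "s \<in> carrier G" using s S by auto
      have "h \<otimes> s \<otimes> inv h \<notin> ?C"
      proof
        assume "h \<otimes> s \<otimes> inv h \<in> ?C"
        then obtain k where k: "k \<in> carrier G" "h \<otimes> s \<otimes> inv h = k \<otimes> g \<otimes> inv k"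
          by (auto simp: conj_class_def)
        have "s = inv h \<otimes> (k \<otimes> g \<otimes> inv k) \<otimes> inv (inv h)"
          using conj_inv_conj[OF sG h] k h by simp
        also have "\<dots> = (inv h \<otimes> k) \<otimes> g \<otimes> inv (inv h \<otimes> k)"
          using h k gG by (intro conj_conj) auto
        finally show False using s h k by (auto simp: conj_class_def)
      qed
      then show "h \<otimes> s \<otimes> inv h \<in> S - ?C"
        using s h less.prems(1) by (auto simp: conj_invariant_def)
    qed (use S in auto)
    have "card (S - ?C) < card S"
      using C S by (intro psubset_card_mono) auto
    then have "P (S - ?C)" using less.hyps inv less.prems(2) by blast
    then have "P (?C \<union> (S - ?C))" using assms(4)[OF inv gG] by blast
    moreover have "?C \<union> (S - ?C) = S" using C by auto
    ultimately show ?thesis by simp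
  qed (use assms(3) in simp)
qed

lemma finite_conj_class [simp]: "finite (conj_class G g)"
  using fin by (simp add: conj_class_def)

lemma conj_invariant_minus_center:
  "conj_invariant G S \<Longrightarrow> conj_invariant G (S - center G)"
  unfolding conj_invariant_def
proof (intro conjI ballI; elim conjE)
  fix g h assume *: "S \<subseteq> carrier G" "\<forall>g\<in>S. \<forall>h\<in>carrier G. h \<otimes> g \<otimes> inv h \<in> S"
    and g: "g \<in> S - center G" and h: "h \<in> carrier G"
  have gG: "g \<in> carrier G" using * g by auto
  have "h \<otimes> g \<otimes> inv h \<notin> center G"
  proof
    assume c: "h \<otimes> g \<otimes> inv h \<in> center G"
    have "inv h \<otimes> (h \<otimes> g \<otimes> inv h) \<otimes> h = h \<otimes> g \<otimes> inv h"
      using c h mem_center_iff[of "h \<otimes> g \<otimes> inv h"] gG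
      by (metis inv_closed inv_inv m_closed)
    then have "g = h \<otimes> g \<otimes> inv h" using conj_inv_conj[OF gG h] by simp
    then show False using c g by simp
  qed
  then show "h \<otimes> g \<otimes> inv h \<in> S - center G" using * g h by auto
qed auto

lemma even_card_noncentral:
  assumes "conj_invariant G S"
  shows "even (card (S - center G))"
proof -
  have "even (card T)" if "conj_invariant G T" "T \<inter> center G = {}" for T
    using that
  proof (induction rule: conj_invariant_induct)
    case (insert S g)
    then have "finite S" using fin finite_subset by (auto simp: conj_invariant_def)
    then show ?case using insert even_card_conj_class by (simp add: card_Un_disjoint)
  qed auto
  then show ?thesis using conj_invariant_minus_center[OF assms] by blast
qed

end

locale char2_group_algebra = char2_field F + G: two_group G
  for F :: "('f, 'r) ring_scheme" (structure) and G :: "('g, 'm) monoid_scheme" (structure)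
begin

abbreviation FG where "FG \<equiv> group_algebra F G"

text \<open>A noncentral class has even size, so it contributes an even multiple of one value.\<close>

lemma class_function_sum:
  assumes S: "conj_invariant G S" and f: "f \<in> carrier G \<rightarrow> carrier F"
    and cf: "\<And>g h. g \<in> S \<Longrightarrow> h \<in> carrier G \<Longrightarrow> f (h \<otimes>\<^bsub>G\<^esub> g \<otimes>\<^bsub>G\<^esub> inv\<^bsub>G\<^esub> h) = f g"
  shows "finsum F f S = finsum F f (S \<inter> center G)"
proof -
  have fs: "finite S" "S \<subseteq> carrier G"
    using S G.fin finite_subset by (auto simp: conj_invariant_def)
  have "T \<subseteq> S \<Longrightarrow> finsum F f T = \<zero>" if "conj_invariant G T" "T \<inter> center G = {}" for T
    using that
  proof (induction rule: G.conj_invariant_induct)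
    case (insert T g)
    have gS: "g \<in> S" using insert.prems G.conj_class_self[OF insert.hyps(2)] by auto
    have T: "T \<subseteq> S" "finite T" "conj_class G g \<subseteq> S" using insert.prems fs finite_subset by auto
    have "finsum F f (conj_class G g \<union> T) = finsum F f (conj_class G g) \<oplus> finsum F f T"
      using T f fs insert.hyps by (intro finsum_Un_disjoint) auto
    also have "finsum F f (conj_class G g) = (\<Oplus>h\<in>conj_class G g. f g)"
      using f insert.hyps(2) cf[OF gS] by (intro finsum_cong') (auto simp: conj_class_def)
    also have "\<dots> = \<zero>"
      using f insert.hyps(2,3) G.even_card_conj_class by (intro finsum_const_even) auto
    also have "finsum F f T = \<zero>" using insert T by blast
    finally show ?case by simp
  qed auto
  moreover have "conj_invariant G (S - center G)" using G.conj_invariant_minus_center[OF S] .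
  ultimately have z: "finsum F f (S - center G) = \<zero>" by blast
  have "finsum F f ((S \<inter> center G) \<union> (S - center G)) = finsum F f (S \<inter> center G) \<oplus> finsum F f (S - center G)"
    using fs f by (intro finsum_Un_disjoint) auto
  moreover have "(S \<inter> center G) \<union> (S - center G) = S" by auto
  moreover have "finsum F f (S \<inter> center G) \<in> carrier F" using fs f by (intro finsum_closed) auto
  ultimately show ?thesis using z by simp
qed

section \<open>Functionals on the group algebra\<close>

lemmas FG_ring = group_algebra_ring[OF is_cring G.is_group G.fin]
lemmas FG_module = group_algebra_module[OF is_cring G.is_group G.fin]
lemmas FG_mult_apply = group_algebra_mult_apply[OF is_cring G.is_group G.fin]
lemmas FG_mult_closed = group_algebra_mult_closed[OF is_cring G.is_group G.fin]
lemmas FG_apply_closed = group_algebra_apply_closed[OF is_cring G.is_group G.fin]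
lemmas FG_eqI = group_algebra_eqI[OF is_cring G.is_group G.fin]

lemma FG_closed_apply [intro, simp]:
  "w \<in> carrier FG \<Longrightarrow> x \<in> carrier G \<Longrightarrow> w x \<in> carrier F"
  by (rule FG_apply_closed)

text \<open>The group element \<open>g\<close> as an element of the algebra.\<close>

definition single :: "'g \<Rightarrow> 'g \<Rightarrow> 'f" where
  "single g = (\<lambda>x \<in> carrier G. if x = g then \<one> else \<zero>)"

text \<open>The linear extension of \<open>f\<close> from the group to the algebra.\<close>

definition pairing :: "('g \<Rightarrow> 'f) \<Rightarrow> ('g \<Rightarrow> 'f) \<Rightarrow> 'f" where
  "pairing f w = (\<Oplus>g\<in>carrier G. w g \<otimes> f g)"

lemma single_closed [simp]: "single g \<in> carrier FG"
  by (auto simp: single_def group_algebra_def)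

lemma single_apply: "x \<in> carrier G \<Longrightarrow> single g x = (if x = g then \<one> else \<zero>)"
  by (simp add: single_def)

lemma one_eq_single: "\<one>\<^bsub>FG\<^esub> = single \<one>\<^bsub>G\<^esub>"
  by (simp add: single_def group_algebra_def)

lemma FG_add_apply: "x \<in> carrier G \<Longrightarrow> (u \<oplus>\<^bsub>FG\<^esub> v) x = u x \<oplus> v x"
  by (simp add: group_algebra_def)

lemma FG_smult_apply: "x \<in> carrier G \<Longrightarrow> (c \<odot>\<^bsub>FG\<^esub> v) x = c \<otimes> v x"
  by (simp add: group_algebra_def)

lemma pairing_closed:
  "f \<in> carrier G \<rightarrow> carrier F \<Longrightarrow> w \<in> carrier FG \<Longrightarrow> pairing f w \<in> carrier F"
  unfolding pairing_def by (intro finsum_closed) auto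

lemma sum_delta:
  assumes "g \<in> carrier G" "f \<in> carrier G \<rightarrow> carrier F"
  shows "(\<Oplus>x\<in>carrier G. (if x = g then \<one> else \<zero>) \<otimes> f x) = f g"
proof -
  have "(\<Oplus>x\<in>carrier G. (if x = g then \<one> else \<zero>) \<otimes> f x) = (\<Oplus>x\<in>carrier G. if g = x then f x else \<zero>)"
    using assms by (intro finsum_cong') (auto simp: Pi_iff)
  also have "\<dots> = f g" using finsum_singleton[OF assms(1) G.fin, of f] assms(2) by auto
  finally show ?thesis .
qed

lemma pairing_single:
  assumes "g \<in> carrier G" "f \<in> carrier G \<rightarrow> carrier F"
  shows "pairing f (single g) = f g"
proof -
  have "pairing f (single g) = (\<Oplus>x\<in>carrier G. (if x = g then \<one> else \<zero>) \<otimes> f x)"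
    unfolding pairing_def using assms by (intro finsum_cong') (auto simp: single_apply Pi_iff)
  then show ?thesis using sum_delta[OF assms] by simp
qed

lemma single_mult_apply:
  assumes "g \<in> carrier G" "w \<in> carrier FG" "x \<in> carrier G"
  shows "(single g \<otimes>\<^bsub>FG\<^esub> w) x = w (inv\<^bsub>G\<^esub> g \<otimes>\<^bsub>G\<^esub> x)"
proof -
  have "(single g \<otimes>\<^bsub>FG\<^esub> w) x =
      (\<Oplus>y\<in>carrier G. (if y = g then \<one> else \<zero>) \<otimes> w (inv\<^bsub>G\<^esub> y \<otimes>\<^bsub>G\<^esub> x))"
    unfolding FG_mult_apply[OF assms(3)] using assms
    by (intro finsum_cong') (auto simp: single_apply)
  also have "\<dots> = w (inv\<^bsub>G\<^esub> g \<otimes>\<^bsub>G\<^esub> x)"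
    using assms by (intro sum_delta) auto
  finally show ?thesis .
qed

lemma single_mult_single:
  assumes "g \<in> carrier G" "h \<in> carrier G"
  shows "single g \<otimes>\<^bsub>FG\<^esub> single h = single (g \<otimes>\<^bsub>G\<^esub> h)"
proof (rule FG_eqI)
  fix x assume x: "x \<in> carrier G"
  have "inv\<^bsub>G\<^esub> g \<otimes>\<^bsub>G\<^esub> x = h \<longleftrightarrow> x = g \<otimes>\<^bsub>G\<^esub> h"
    using x assms G.inv_solve_left'[of h g x] by auto
  then show "(single g \<otimes>\<^bsub>FG\<^esub> single h) x = single (g \<otimes>\<^bsub>G\<^esub> h) x"
    using x assms by (simp add: single_mult_apply single_apply)
qed (auto intro!: FG_mult_closed)

lemma mult_single_apply:
  assumes "g \<in> carrier G" "w \<in> carrier FG" "x \<in> carrier G"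
  shows "(w \<otimes>\<^bsub>FG\<^esub> single g) x = w (x \<otimes>\<^bsub>G\<^esub> inv\<^bsub>G\<^esub> g)"
proof -
  have *: "inv\<^bsub>G\<^esub> y \<otimes>\<^bsub>G\<^esub> x = g \<longleftrightarrow> y = x \<otimes>\<^bsub>G\<^esub> inv\<^bsub>G\<^esub> g" if "y \<in> carrier G" for y
    using that assms G.inv_solve_left'[of g y x] G.inv_solve_right'[of y x g] by (metis G.inv_solve_right)
  have "(w \<otimes>\<^bsub>FG\<^esub> single g) x =
      (\<Oplus>y\<in>carrier G. (if y = x \<otimes>\<^bsub>G\<^esub> inv\<^bsub>G\<^esub> g then \<one> else \<zero>) \<otimes> w y)"
    unfolding FG_mult_apply[OF assms(3)] using assms *
    by (intro finsum_cong') (auto simp: single_apply)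
  also have "\<dots> = w (x \<otimes>\<^bsub>G\<^esub> inv\<^bsub>G\<^esub> g)"
    using assms by (intro sum_delta) auto
  finally show ?thesis .
qed

lemma pairing_mult:
  assumes f: "f \<in> carrier G \<rightarrow> carrier F" and u: "u \<in> carrier FG" and v: "v \<in> carrier FG"
  shows "pairing f (u \<otimes>\<^bsub>FG\<^esub> v) =
    (\<Oplus>y\<in>carrier G. \<Oplus>k\<in>carrier G. u y \<otimes> v k \<otimes> f (y \<otimes>\<^bsub>G\<^esub> k))"
proof -
  have fc: "f g \<in> carrier F" if "g \<in> carrier G" for g using f that by auto
  note cl = fc FG_closed_apply[OF u] FG_closed_apply[OF v]
  have "pairing f (u \<otimes>\<^bsub>FG\<^esub> v) =
      (\<Oplus>x\<in>carrier G. \<Oplus>y\<in>carrier G. u y \<otimes> v (inv\<^bsub>G\<^esub> y \<otimes>\<^bsub>G\<^esub> x) \<otimes> f x)"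
    unfolding pairing_def
  proof (rule finsum_cong')
    fix x assume x: "x \<in> carrier G"
    show "(u \<otimes>\<^bsub>FG\<^esub> v) x \<otimes> f x = (\<Oplus>y\<in>carrier G. u y \<otimes> v (inv\<^bsub>G\<^esub> y \<otimes>\<^bsub>G\<^esub> x) \<otimes> f x)"
      unfolding FG_mult_apply[OF x] using cl x G.fin by (intro finsum_ldistr) auto
  qed (use cl in \<open>auto intro!: finsum_closed\<close>)
  also have "\<dots> = (\<Oplus>y\<in>carrier G. \<Oplus>x\<in>carrier G. u y \<otimes> v (inv\<^bsub>G\<^esub> y \<otimes>\<^bsub>G\<^esub> x) \<otimes> f x)"
    using cl G.fin by (intro finsum_swap[OF is_cring G.is_group]) auto
  also have "\<dots> = (\<Oplus>y\<in>carrier G. \<Oplus>k\<in>carrier G. u y \<otimes> v k \<otimes> f (y \<otimes>\<^bsub>G\<^esub> k))"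
  proof (rule finsum_cong')
    fix y assume y: "y \<in> carrier G"
    have "(\<Oplus>k\<in>carrier G. u y \<otimes> v k \<otimes> f (y \<otimes>\<^bsub>G\<^esub> k)) =
       (\<Oplus>x\<in>carrier G. u y \<otimes> v (inv\<^bsub>G\<^esub> y \<otimes>\<^bsub>G\<^esub> x) \<otimes> f (y \<otimes>\<^bsub>G\<^esub> (inv\<^bsub>G\<^esub> y \<otimes>\<^bsub>G\<^esub> x)))"
      using cl y by (intro finsum_translate[OF is_cring G.is_group G.fin]) auto
    also have "\<dots> = (\<Oplus>x\<in>carrier G. u y \<otimes> v (inv\<^bsub>G\<^esub> y \<otimes>\<^bsub>G\<^esub> x) \<otimes> f x)"
      using cl y by (intro finsum_cong') (auto simp: G.m_assoc[symmetric])
    finally show "(\<Oplus>x\<in>carrier G. u y \<otimes> v (inv\<^bsub>G\<^esub> y \<otimes>\<^bsub>G\<^esub> x) \<otimes> f x) =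
      (\<Oplus>k\<in>carrier G. u y \<otimes> v k \<otimes> f (y \<otimes>\<^bsub>G\<^esub> k))" by simp
  qed (use cl in \<open>auto intro!: finsum_closed\<close>)
  finally show ?thesis .
qed

lemma double_sum_times:
  assumes "finite S" "finite T" "u \<in> S \<rightarrow> carrier F" "v \<in> T \<rightarrow> carrier F"
  shows "(\<Oplus>y\<in>S. \<Oplus>k\<in>T. u y \<otimes> v k) = finsum F u S \<otimes> finsum F v T"
proof -
  have "(\<Oplus>y\<in>S. \<Oplus>k\<in>T. u y \<otimes> v k) = (\<Oplus>y\<in>S. u y \<otimes> finsum F v T)"
    using assms by (intro finsum_cong' finsum_rdistr[symmetric]) (auto intro!: finsum_closed)
  also have "\<dots> = finsum F u S \<otimes> finsum F v T"
    using assms by (intro finsum_ldistr[symmetric]) (auto intro!: finsum_closed)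
  finally show ?thesis .
qed

end

section \<open>Augmentations, derivations and traces\<close>

definition linear_functional ::
  "('f, 'r) ring_scheme \<Rightarrow> ('f, 'a, 'm) module_scheme \<Rightarrow> ('a \<Rightarrow> 'f) \<Rightarrow> bool" where
  "linear_functional F A L \<longleftrightarrow> L \<in> carrier A \<rightarrow> carrier F \<and>
    (\<forall>u\<in>carrier A. \<forall>v\<in>carrier A. L (u \<oplus>\<^bsub>A\<^esub> v) = L u \<oplus>\<^bsub>F\<^esub> L v) \<and>
    (\<forall>c\<in>carrier F. \<forall>u\<in>carrier A. L (c \<odot>\<^bsub>A\<^esub> u) = c \<otimes>\<^bsub>F\<^esub> L u)"

definition augmentation ::
  "('f, 'r) ring_scheme \<Rightarrow> ('f, 'a, 'm) module_scheme \<Rightarrow> ('a \<Rightarrow> 'f) \<Rightarrow> bool" where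
  "augmentation F A e \<longleftrightarrow> linear_functional F A e \<and> e \<one>\<^bsub>A\<^esub> = \<one>\<^bsub>F\<^esub> \<and>
    (\<forall>u\<in>carrier A. \<forall>v\<in>carrier A. e (u \<otimes>\<^bsub>A\<^esub> v) = e u \<otimes>\<^bsub>F\<^esub> e v)"

text \<open>The field is here the bimodule on which the algebra acts through \<open>e\<close>.  On a group algebra these
  derivations are the linear extensions of the homomorphisms from the group to the additive group
  of the field.\<close>

definition derivation ::
  "('f, 'r) ring_scheme \<Rightarrow> ('f, 'a, 'm) module_scheme \<Rightarrow> ('a \<Rightarrow> 'f) \<Rightarrow> ('a \<Rightarrow> 'f) \<Rightarrow> bool" where
  "derivation F A e d \<longleftrightarrow> linear_functional F A d \<and>
    (\<forall>u\<in>carrier A. \<forall>v\<in>carrier A.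
      d (u \<otimes>\<^bsub>A\<^esub> v) = e u \<otimes>\<^bsub>F\<^esub> d v \<oplus>\<^bsub>F\<^esub> d u \<otimes>\<^bsub>F\<^esub> e v)"

definition trace_functional ::
  "('f, 'r) ring_scheme \<Rightarrow> ('f, 'a, 'm) module_scheme \<Rightarrow> ('a \<Rightarrow> 'f) \<Rightarrow> bool" where
  "trace_functional F A t \<longleftrightarrow> linear_functional F A t \<and>
    (\<forall>u\<in>carrier A. \<forall>v\<in>carrier A. t (u \<otimes>\<^bsub>A\<^esub> v) = t (v \<otimes>\<^bsub>A\<^esub> u))"

text \<open>The functionals that factor through the group algebra of the largest abelian quotient in which
  the centre becomes trivial.\<close>

definition central_abelian_functional ::
  "('f, 'r) ring_scheme \<Rightarrow> ('f, 'a, 'm) module_scheme \<Rightarrow> ('a \<Rightarrow> 'f) \<Rightarrow> ('a \<Rightarrow> 'f) \<Rightarrow> bool" where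
  "central_abelian_functional F A e f \<longleftrightarrow> linear_functional F A f \<and>
    (\<forall>u\<in>carrier A. \<forall>v\<in>carrier A. \<forall>w\<in>carrier A.
      f (u \<otimes>\<^bsub>A\<^esub> (v \<otimes>\<^bsub>A\<^esub> w)) = f (u \<otimes>\<^bsub>A\<^esub> (w \<otimes>\<^bsub>A\<^esub> v))) \<and>
    (\<forall>u\<in>carrier A. \<forall>z\<in>center A. f (u \<otimes>\<^bsub>A\<^esub> z) = f u \<otimes>\<^bsub>F\<^esub> e z)"

definition iter_square :: "('a, 'm) monoid_scheme \<Rightarrow> nat \<Rightarrow> 'a \<Rightarrow> 'a" where
  "iter_square A k = (\<lambda>u. u \<otimes>\<^bsub>A\<^esub> u) ^^ k"

lemma iter_square_0 [simp]: "iter_square A 0 w = w"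
  by (simp add: iter_square_def)

lemma iter_square_Suc: "iter_square A (Suc k) w = iter_square A k (w \<otimes>\<^bsub>A\<^esub> w)"
  by (simp only: iter_square_def funpow_Suc_right o_apply)

definition center_derived :: "('a, 'm) monoid_scheme \<Rightarrow> 'a set" where
  "center_derived G = generate G (center G \<union> derived_set G (carrier G))"

lemma centerD:
  "z \<in> center G \<Longrightarrow> z \<in> carrier G"
  "z \<in> center G \<Longrightarrow> g \<in> carrier G \<Longrightarrow> z \<otimes>\<^bsub>G\<^esub> g = g \<otimes>\<^bsub>G\<^esub> z"
  by (auto simp: center_def)

lemma centerI:
  "z \<in> carrier G \<Longrightarrow> (\<And>g. g \<in> carrier G \<Longrightarrow> z \<otimes>\<^bsub>G\<^esub> g = g \<otimes>\<^bsub>G\<^esub> z) \<Longrightarrow> z \<in> center G"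
  by (auto simp: center_def)

context group
begin

lemma center_subset: "center G \<subseteq> carrier G"
  by (auto simp: center_def)

lemma center_subgroup: "subgroup (center G) G"
  using center_normal normal_imp_subgroup by blast

lemma center_conj:
  assumes "z \<in> center G" "g \<in> carrier G" shows "g \<otimes> z \<otimes> inv g = z"
  using centerD(1)[OF assms(1)] assms(2)
  by (simp add: centerD(2)[OF assms, symmetric] m_assoc)

lemma center_pow_closed: "z \<in> center G \<Longrightarrow> z [^] (n::nat) \<in> center G"
  by (induction n) (auto intro: subgroup.one_closed[OF center_subgroup]
      subgroup.m_closed[OF center_subgroup])

lemma square_pow:
  assumes "y \<in> carrier G"
  shows "(y \<otimes> y) [^] ((2::nat) ^ k) = y [^] ((2::nat) ^ Suc k)"
proof -
  have "y \<otimes> y = y [^] (2::nat)" using assms by (simp add: numeral_2_eq_2)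
  then show ?thesis using nat_pow_pow[OF assms, of 2 "2 ^ k"] by simp
qed

lemma derived_set_subset: "derived_set G (carrier G) \<subseteq> carrier G"
  by auto

lemma center_derived_subgroup: "subgroup (center_derived G) G"
  unfolding center_derived_def
  by (intro generate_is_subgroup) (use center_subset derived_set_subset in blast)

lemma commutator_in_center_derived:
  "g \<in> carrier G \<Longrightarrow> h \<in> carrier G \<Longrightarrow> g \<otimes> h \<otimes> inv g \<otimes> inv h \<in> center_derived G"
  unfolding center_derived_def by (intro generate.incl) auto

lemma center_in_center_derived: "center G \<subseteq> center_derived G"
  unfolding center_derived_def by (auto intro: generate.incl)

lemma center_derived_minimal:
  assumes "subgroup U G" "center G \<subseteq> U"
    "\<And>g h. g \<in> carrier G \<Longrightarrow> h \<in> carrier G \<Longrightarrow> g \<otimes> h \<otimes> inv g \<otimes> inv h \<in> U"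
  shows "center_derived G \<subseteq> U"
  unfolding center_derived_def
  by (intro generate_subgroup_incl) (use assms in auto)

lemma center_derived_normal: "center_derived G \<lhd> G"
proof -
  interpret N: subgroup "center_derived G" G by (rule center_derived_subgroup)
  have "g \<otimes> n \<otimes> inv g \<in> center_derived G" if "g \<in> carrier G" "n \<in> center_derived G" for g n
  proof -
    have n: "n \<in> carrier G" using that by simp
    have "g \<otimes> n \<otimes> inv g = (g \<otimes> n \<otimes> inv g \<otimes> inv n) \<otimes> n"
      using that n by (simp add: m_assoc)
    then show ?thesis
      using N.m_closed[OF commutator_in_center_derived[OF that(1) n] that(2)] by metis
  qed
  then show ?thesis by (simp add: normal_inv_iff center_derived_subgroup)
qed

end

context char2_group_algebra
begin

lemma pairing_linear:
  assumes f: "f \<in> carrier G \<rightarrow> carrier F"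
  shows "linear_functional F FG (pairing f)"
  unfolding linear_functional_def
proof (intro conjI ballI)
  show "pairing f \<in> carrier FG \<rightarrow> carrier F" using pairing_closed[OF f] by auto
next
  fix u v assume uv: "u \<in> carrier FG" "v \<in> carrier FG"
  have "pairing f (u \<oplus>\<^bsub>FG\<^esub> v) = (\<Oplus>g\<in>carrier G. u g \<otimes> f g \<oplus> v g \<otimes> f g)"
    unfolding pairing_def using f uv by (intro finsum_cong') (auto simp: FG_add_apply l_distr Pi_iff)
  also have "\<dots> = pairing f u \<oplus> pairing f v"
    unfolding pairing_def using f uv by (intro finsum_addf) auto
  finally show "pairing f (u \<oplus>\<^bsub>FG\<^esub> v) = pairing f u \<oplus> pairing f v" .
next
  fix c u assume cu: "c \<in> carrier F" "u \<in> carrier FG"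
  have "pairing f (c \<odot>\<^bsub>FG\<^esub> u) = (\<Oplus>g\<in>carrier G. c \<otimes> (u g \<otimes> f g))"
    unfolding pairing_def using f cu
    by (intro finsum_cong') (auto simp: FG_smult_apply m_assoc Pi_iff)
  also have "\<dots> = c \<otimes> pairing f u"
    unfolding pairing_def using f cu G.fin by (intro finsum_rdistr[symmetric]) auto
  finally show "pairing f (c \<odot>\<^bsub>FG\<^esub> u) = c \<otimes> pairing f u" .
qed

lemma linear_functional_expand:
  assumes L: "linear_functional F FG L" and w: "w \<in> carrier FG"
  shows "L w = pairing (\<lambda>g. L (single g)) w"
proof -
  interpret FG: ring FG by (rule FG_ring)
  interpret FGm: module F FG by (rule FG_module)
  \<comment> \<open>the coefficients of \<open>w\<close> in \<open>S\<close>, to add the group elements one by one\<close>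
  define tr where "tr S = (\<lambda>x\<in>carrier G. if x \<in> S then w x else \<zero>)" for S
  have trc: "tr S \<in> carrier FG" for S
    using w by (auto simp: tr_def group_algebra_def)
  have Lc: "u \<in> carrier FG \<Longrightarrow> L u \<in> carrier F" for u
    using L by (auto simp: linear_functional_def)
  have "L (tr S) = (\<Oplus>g\<in>S. w g \<otimes> L (single g))" if "finite S" "S \<subseteq> carrier G" for S
    using that
  proof (induction S rule: finite_induct)
    case empty
    have "\<zero> \<odot>\<^bsub>FG\<^esub> tr {} = tr {}"
      by (rule FG_eqI[OF FGm.smult_closed[OF zero_closed trc] trc])
        (auto simp: FG_smult_apply tr_def)
    moreover have "L (\<zero> \<odot>\<^bsub>FG\<^esub> tr {}) = \<zero> \<otimes> L (tr {})"
      using L trc zero_closed unfolding linear_functional_def by blast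
    ultimately show ?case using Lc trc by simp
  next
    case (insert g S)
    have g: "g \<in> carrier G" "w g \<in> carrier F" using insert w by auto
    have "tr (insert g S) = (w g \<odot>\<^bsub>FG\<^esub> single g) \<oplus>\<^bsub>FG\<^esub> tr S"
    proof (rule FG_eqI)
      fix x assume x: "x \<in> carrier G"
      then have "w x \<in> carrier F" using w by auto
      then show "tr (insert g S) x = ((w g \<odot>\<^bsub>FG\<^esub> single g) \<oplus>\<^bsub>FG\<^esub> tr S) x"
        using x insert g by (auto simp: FG_add_apply FG_smult_apply single_apply tr_def)
    qed (use trc g in \<open>auto intro!: FG.a_closed FGm.smult_closed\<close>)
    then have "L (tr (insert g S)) = L (w g \<odot>\<^bsub>FG\<^esub> single g) \<oplus> L (tr S)"
      using L trc g FGm.smult_closed single_closed unfolding linear_functional_def by metis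
    also have "L (w g \<odot>\<^bsub>FG\<^esub> single g) = w g \<otimes> L (single g)"
      using L g single_closed unfolding linear_functional_def by blast
    finally show ?case
      using insert g Lc w by (subst finsum_insert) auto
  qed
  from this[OF G.fin subset_refl] have "L (tr (carrier G)) = pairing (\<lambda>g. L (single g)) w"
    by (simp add: pairing_def)
  moreover have "tr (carrier G) = w"
    by (rule FG_eqI) (use trc w in \<open>auto simp: tr_def\<close>)
  ultimately show ?thesis by simp
qed

lemma linear_functional_closed:
  "linear_functional F FG L \<Longrightarrow> w \<in> carrier FG \<Longrightarrow> L w \<in> carrier F"
  by (auto simp: linear_functional_def)

definition aug where "aug = pairing (\<lambda>_. \<one>)"

lemma aug_eq: "w \<in> carrier FG \<Longrightarrow> aug w = finsum F w (carrier G)"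
  unfolding aug_def pairing_def by (intro finsum_cong') auto

lemma aug_closed [simp]: "w \<in> carrier FG \<Longrightarrow> aug w \<in> carrier F"
  unfolding aug_def by (intro pairing_closed) auto

lemma aug_single: "g \<in> carrier G \<Longrightarrow> aug (single g) = \<one>"
  unfolding aug_def by (subst pairing_single) auto

lemma aug_mult:
  assumes "u \<in> carrier FG" "v \<in> carrier FG"
  shows "aug (u \<otimes>\<^bsub>FG\<^esub> v) = aug u \<otimes> aug v"
proof -
  have "aug (u \<otimes>\<^bsub>FG\<^esub> v) = (\<Oplus>y\<in>carrier G. \<Oplus>k\<in>carrier G. u y \<otimes> v k)"
    unfolding aug_def using assms
    by (subst pairing_mult) (auto intro!: finsum_cong' finsum_closed)
  also have "\<dots> = aug u \<otimes> aug v"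
    using assms G.fin by (subst double_sum_times) (auto simp: aug_eq)
  finally show ?thesis .
qed

lemma aug_augmentation: "augmentation F FG aug"
  unfolding augmentation_def using aug_mult aug_single[of "\<one>\<^bsub>G\<^esub>"] pairing_linear[of "\<lambda>_. \<one>"]
  by (auto simp: one_eq_single aug_def)

lemma square_eq_one:
  assumes "x \<in> carrier F" "x \<otimes> x = \<one>" shows "x = \<one>"
proof -
  have "(x \<oplus> \<one>) \<otimes> (x \<oplus> \<one>) = \<zero>"
    using assms by (simp add: square_add one_add_one)
  then have "x \<oplus> \<one> = \<zero>" using assms by (simp add: square_eq_zero_iff)
  then show ?thesis using assms by (simp add: add_eq_zero_iff)
qed

text \<open>In characteristic two, 1 is the only element of the field whose multiplicative order is a power
  of two.  So the augmentation is intrinsic to the algebra.\<close>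

lemma augmentation_single:
  assumes e: "augmentation F FG e" and g: "g \<in> carrier G"
  shows "e (single g) = \<one>"
proof -
  have sq: "e (single (h \<otimes>\<^bsub>G\<^esub> h)) = e (single h) \<otimes> e (single h)"
    if "h \<in> carrier G" for h
    using e that single_mult_single[OF that that] unfolding augmentation_def
    by (metis single_closed)
  have cl: "e (single h) \<in> carrier F" for h
    using e by (auto simp: augmentation_def linear_functional_def)
  have "\<forall>h\<in>carrier G. h [^]\<^bsub>G\<^esub> ((2::nat) ^ n) = \<one>\<^bsub>G\<^esub> \<longrightarrow> e (single h) = \<one>" for n
  proof (induction n)
    case 0
    then show ?case using e by (auto simp: augmentation_def one_eq_single)
  next
    case (Suc n)
    show ?case
    proof (intro ballI impI)
      fix h assume h: "h \<in> carrier G" "h [^]\<^bsub>G\<^esub> ((2::nat) ^ Suc n) = \<one>\<^bsub>G\<^esub>"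
      have "(h \<otimes>\<^bsub>G\<^esub> h) [^]\<^bsub>G\<^esub> ((2::nat) ^ n) = \<one>\<^bsub>G\<^esub>"
        using h by (simp only: G.square_pow)
      then have "e (single (h \<otimes>\<^bsub>G\<^esub> h)) = \<one>" using Suc h by auto
      then show "e (single h) = \<one>" using sq[OF h(1)] square_eq_one[OF cl] by simp
    qed
  qed
  moreover obtain n where "order G = 2 ^ n" using G.order_pow by auto
  ultimately show ?thesis using g G.pow_order_eq_1[OF g] by metis
qed

lemma augmentation_unique:
  assumes e: "augmentation F FG e" and w: "w \<in> carrier FG"
  shows "e w = aug w"
proof -
  have "e w = pairing (\<lambda>g. e (single g)) w"
    using e w linear_functional_expand by (auto simp: augmentation_def)
  also have "\<dots> = aug w"
    unfolding aug_def pairing_def using w augmentation_single[OF e]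
    by (intro finsum_cong') auto
  finally show ?thesis .
qed

lemma derivation_single:
  assumes e: "augmentation F FG e" and d: "derivation F FG e d"
    and g: "g \<in> carrier G" and h: "h \<in> carrier G"
  shows "d (single (g \<otimes>\<^bsub>G\<^esub> h)) = d (single g) \<oplus> d (single h)"
proof -
  have c: "d (single g) \<in> carrier F" "d (single h) \<in> carrier F"
    using d by (auto simp: derivation_def linear_functional_def)
  have "d (single g \<otimes>\<^bsub>FG\<^esub> single h) =
      e (single g) \<otimes> d (single h) \<oplus> d (single g) \<otimes> e (single h)"
    using d single_closed unfolding derivation_def by blast
  then show ?thesis
    using g h c augmentation_single[OF e] by (simp add: single_mult_single a_comm)
qed

lemma derivation_of_hom:
  assumes f: "f \<in> carrier G \<rightarrow> carrier F"
    and hom: "\<And>g h. g \<in> carrier G \<Longrightarrow> h \<in> carrier G \<Longrightarrow> f (g \<otimes>\<^bsub>G\<^esub> h) = f g \<oplus> f h"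
  shows "derivation F FG aug (pairing f)"
  unfolding derivation_def
proof (intro conjI ballI)
  fix u v assume u: "u \<in> carrier FG" and v: "v \<in> carrier FG"
  have fc: "f g \<in> carrier F" if "g \<in> carrier G" for g using f that by auto
  note cl = fc FG_closed_apply[OF u] FG_closed_apply[OF v]
  have "pairing f (u \<otimes>\<^bsub>FG\<^esub> v) =
      (\<Oplus>y\<in>carrier G. \<Oplus>k\<in>carrier G. u y \<otimes> v k \<otimes> f (y \<otimes>\<^bsub>G\<^esub> k))"
    by (rule pairing_mult[OF f u v])
  also have "\<dots> = (\<Oplus>y\<in>carrier G. (\<Oplus>k\<in>carrier G. u y \<otimes> (v k \<otimes> f k)) \<oplus>
      (\<Oplus>k\<in>carrier G. (u y \<otimes> f y) \<otimes> v k))"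
  proof (rule finsum_cong')
    fix y assume y: "y \<in> carrier G"
    have "(\<Oplus>k\<in>carrier G. u y \<otimes> v k \<otimes> f (y \<otimes>\<^bsub>G\<^esub> k)) =
        (\<Oplus>k\<in>carrier G. u y \<otimes> (v k \<otimes> f k) \<oplus> (u y \<otimes> f y) \<otimes> v k)"
    proof (rule finsum_cong')
      fix k assume k: "k \<in> carrier G"
      have c: "u y \<in> carrier F" "v k \<in> carrier F" "f y \<in> carrier F" "f k \<in> carrier F"
        using cl y k by auto
      show "u y \<otimes> v k \<otimes> f (y \<otimes>\<^bsub>G\<^esub> k) = u y \<otimes> (v k \<otimes> f k) \<oplus> (u y \<otimes> f y) \<otimes> v k"
        unfolding hom[OF y k] using c by algebra
    qed (use cl y in auto)
    also have "\<dots> = (\<Oplus>k\<in>carrier G. u y \<otimes> (v k \<otimes> f k)) \<oplus> (\<Oplus>k\<in>carrier G. (u y \<otimes> f y) \<otimes> v k)"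
      using cl y by (intro finsum_addf) auto
    finally show "(\<Oplus>k\<in>carrier G. u y \<otimes> v k \<otimes> f (y \<otimes>\<^bsub>G\<^esub> k)) = \<dots>" .
  qed (use cl in \<open>auto intro!: finsum_closed\<close>)
  also have "\<dots> = (\<Oplus>y\<in>carrier G. \<Oplus>k\<in>carrier G. u y \<otimes> (v k \<otimes> f k)) \<oplus>
      (\<Oplus>y\<in>carrier G. \<Oplus>k\<in>carrier G. (u y \<otimes> f y) \<otimes> v k)"
    using cl by (intro finsum_addf) (auto intro!: finsum_closed)
  also have "\<dots> = aug u \<otimes> pairing f v \<oplus> pairing f u \<otimes> aug v"
    using cl G.fin u v by (simp add: double_sum_times Pi_iff aug_eq pairing_def)
  finally show "pairing f (u \<otimes>\<^bsub>FG\<^esub> v) = aug u \<otimes> pairing f v \<oplus> pairing f u \<otimes> aug v" .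
qed (rule pairing_linear[OF f])

lemma trace_of_class_function:
  assumes f: "f \<in> carrier G \<rightarrow> carrier F"
    and cf: "\<And>g h. g \<in> carrier G \<Longrightarrow> h \<in> carrier G \<Longrightarrow> f (g \<otimes>\<^bsub>G\<^esub> h) = f (h \<otimes>\<^bsub>G\<^esub> g)"
  shows "trace_functional F FG (pairing f)"
  unfolding trace_functional_def
proof (intro conjI ballI)
  fix u v assume u: "u \<in> carrier FG" and v: "v \<in> carrier FG"
  have fc: "f g \<in> carrier F" if "g \<in> carrier G" for g using f that by auto
  note cl = fc FG_closed_apply[OF u] FG_closed_apply[OF v]
  have "pairing f (u \<otimes>\<^bsub>FG\<^esub> v) =
      (\<Oplus>y\<in>carrier G. \<Oplus>k\<in>carrier G. u y \<otimes> v k \<otimes> f (y \<otimes>\<^bsub>G\<^esub> k))"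
    by (rule pairing_mult[OF f u v])
  also have "\<dots> = (\<Oplus>k\<in>carrier G. \<Oplus>y\<in>carrier G. u y \<otimes> v k \<otimes> f (y \<otimes>\<^bsub>G\<^esub> k))"
    using cl G.fin by (intro finsum_swap[OF is_cring G.is_group]) auto
  also have "\<dots> = (\<Oplus>k\<in>carrier G. \<Oplus>y\<in>carrier G. v k \<otimes> u y \<otimes> f (k \<otimes>\<^bsub>G\<^esub> y))"
    using cl by (intro finsum_cong') (auto intro!: finsum_cong' finsum_closed simp: cf m_comm)
  also have "\<dots> = pairing f (v \<otimes>\<^bsub>FG\<^esub> u)"
    by (rule pairing_mult[OF f v u, symmetric])
  finally show "pairing f (u \<otimes>\<^bsub>FG\<^esub> v) = pairing f (v \<otimes>\<^bsub>FG\<^esub> u)" .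
qed (rule pairing_linear[OF f])

lemma center_FG_closed: "w \<in> center FG \<Longrightarrow> w \<in> carrier FG"
  by (simp add: center_def)

lemma center_FG_apply:
  assumes w: "w \<in> center FG" and g: "g \<in> carrier G" and h: "h \<in> carrier G"
  shows "w (h \<otimes>\<^bsub>G\<^esub> g \<otimes>\<^bsub>G\<^esub> inv\<^bsub>G\<^esub> h) = w g"
proof -
  have wc: "w \<in> carrier FG" using w by (simp add: center_def)
  have "(w \<otimes>\<^bsub>FG\<^esub> single h) (h \<otimes>\<^bsub>G\<^esub> g) = (single h \<otimes>\<^bsub>FG\<^esub> w) (h \<otimes>\<^bsub>G\<^esub> g)"
    using w single_closed unfolding center_def by auto
  then show ?thesis
    using g h wc by (simp add: single_mult_apply mult_single_apply G.m_assoc[symmetric])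
qed

lemma single_in_center:
  assumes "z \<in> center G" shows "single z \<in> center FG"
  unfolding center_def
proof (intro CollectI conjI ballI)
  fix w assume w: "w \<in> carrier FG"
  have z: "z \<in> carrier G" using assms by (simp add: center_def)
  have "inv\<^bsub>G\<^esub> z \<otimes>\<^bsub>G\<^esub> x = x \<otimes>\<^bsub>G\<^esub> inv\<^bsub>G\<^esub> z" if "x \<in> carrier G" for x
    using subgroup.m_inv_closed[OF G.center_subgroup assms] that by (simp add: center_def)
  then show "single z \<otimes>\<^bsub>FG\<^esub> w = w \<otimes>\<^bsub>FG\<^esub> single z"
    using w z by (intro FG_eqI) (auto simp: single_mult_apply mult_single_apply intro!: FG_mult_closed)
qed auto

lemma conj_invariant_carrier: "conj_invariant G (carrier G)"
  by (auto simp: conj_invariant_def)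

text \<open>The coefficients of \<open>w\<close> and the values of \<open>t\<close> on group elements are class functions.\<close>

lemma trace_on_center:
  assumes t: "trace_functional F FG t" and w: "w \<in> center FG"
  shows "t w = (\<Oplus>h\<in>center G. w h \<otimes> t (single h))"
proof -
  have wc: "w \<in> carrier FG" using w by (rule center_FG_closed)
  have tl: "linear_functional F FG t" using t by (simp add: trace_functional_def)
  have tc: "t (single g) \<in> carrier F" for g
    using linear_functional_closed[OF tl] by simp
  have conj: "t (single (h \<otimes>\<^bsub>G\<^esub> g \<otimes>\<^bsub>G\<^esub> inv\<^bsub>G\<^esub> h)) = t (single g)"
    if g: "g \<in> carrier G" and h: "h \<in> carrier G" for g h
  proof -
    have "t (single (h \<otimes>\<^bsub>G\<^esub> g) \<otimes>\<^bsub>FG\<^esub> single (inv\<^bsub>G\<^esub> h)) =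
        t (single (inv\<^bsub>G\<^esub> h) \<otimes>\<^bsub>FG\<^esub> single (h \<otimes>\<^bsub>G\<^esub> g))"
      using t single_closed unfolding trace_functional_def by blast
    then show ?thesis
      using g h by (simp add: single_mult_single G.m_assoc[symmetric])
  qed
  have "t w = finsum F (\<lambda>g. w g \<otimes> t (single g)) (carrier G)"
    using linear_functional_expand[OF tl wc] by (simp add: pairing_def)
  also have "\<dots> = finsum F (\<lambda>g. w g \<otimes> t (single g)) (carrier G \<inter> center G)"
    using wc tc by (intro class_function_sum[OF conj_invariant_carrier])
      (auto simp: conj center_FG_apply[OF w])
  also have "carrier G \<inter> center G = center G" using G.center_subset by auto
  finally show ?thesis .
qed

subsection \<open>Squaring in the centre\<close>

lemma center_FG_mult:
  assumes "u \<in> center FG" "v \<in> center FG" shows "u \<otimes>\<^bsub>FG\<^esub> v \<in> center FG"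
proof -
  interpret FG: ring FG by (rule FG_ring)
  have c: "u \<in> carrier FG" "v \<in> carrier FG" using assms by (auto simp: center_def)
  have "u \<otimes>\<^bsub>FG\<^esub> v \<otimes>\<^bsub>FG\<^esub> x = x \<otimes>\<^bsub>FG\<^esub> (u \<otimes>\<^bsub>FG\<^esub> v)" if x: "x \<in> carrier FG" for x
  proof -
    have "u \<otimes>\<^bsub>FG\<^esub> v \<otimes>\<^bsub>FG\<^esub> x = u \<otimes>\<^bsub>FG\<^esub> (v \<otimes>\<^bsub>FG\<^esub> x)"
      using c x by (rule FG.m_assoc)
    also have "\<dots> = u \<otimes>\<^bsub>FG\<^esub> (x \<otimes>\<^bsub>FG\<^esub> v)"
      by (simp only: centerD(2)[OF assms(2) x])
    also have "\<dots> = (u \<otimes>\<^bsub>FG\<^esub> x) \<otimes>\<^bsub>FG\<^esub> v"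
      using c x by (simp only: FG.m_assoc)
    also have "\<dots> = (x \<otimes>\<^bsub>FG\<^esub> u) \<otimes>\<^bsub>FG\<^esub> v"
      by (simp only: centerD(2)[OF assms(1) x])
    finally show ?thesis using c x by (simp only: FG.m_assoc)
  qed
  then show ?thesis using c by (intro centerI) (auto intro!: FG.m_closed)
qed

text \<open>The summands \<open>w y w (y^(-1) h)\<close> of the coefficient at \<open>h\<close> form a class function of \<open>y\<close>, so only
  central \<open>y\<close> matter; among these the involution \<open>y \<mapsto> y^(-1) h\<close> leaves the square roots of
  \<open>h\<close>.\<close>

lemma square_on_center:
  assumes w: "w \<in> center FG" and h: "h \<in> center G"
  shows "(w \<otimes>\<^bsub>FG\<^esub> w) h = (\<Oplus>y\<in>{y \<in> center G. y \<otimes>\<^bsub>G\<^esub> y = h}. w y \<otimes> w y)"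
proof -
  have wc: "w \<in> carrier FG" using w by (rule center_FG_closed)
  have hc: "h \<in> carrier G" using h by (simp add: center_def)
  let ?f = "\<lambda>y. w y \<otimes> w (inv\<^bsub>G\<^esub> y \<otimes>\<^bsub>G\<^esub> h)"
  have "(w \<otimes>\<^bsub>FG\<^esub> w) h = finsum F ?f (carrier G)"
    by (rule FG_mult_apply[OF hc])
  also have "\<dots> = finsum F ?f (carrier G \<inter> center G)"
  proof (rule class_function_sum[OF conj_invariant_carrier])
    fix g k assume g: "g \<in> carrier G" and k: "k \<in> carrier G"
    have "inv\<^bsub>G\<^esub> (k \<otimes>\<^bsub>G\<^esub> g \<otimes>\<^bsub>G\<^esub> inv\<^bsub>G\<^esub> k) \<otimes>\<^bsub>G\<^esub> h
        = k \<otimes>\<^bsub>G\<^esub> inv\<^bsub>G\<^esub> g \<otimes>\<^bsub>G\<^esub> (inv\<^bsub>G\<^esub> k \<otimes>\<^bsub>G\<^esub> h)"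
      using g k hc by (simp add: G.inv_mult_group G.m_assoc)
    also have "inv\<^bsub>G\<^esub> k \<otimes>\<^bsub>G\<^esub> h = h \<otimes>\<^bsub>G\<^esub> inv\<^bsub>G\<^esub> k"
      using h k by (simp add: center_def)
    also have "k \<otimes>\<^bsub>G\<^esub> inv\<^bsub>G\<^esub> g \<otimes>\<^bsub>G\<^esub> (h \<otimes>\<^bsub>G\<^esub> inv\<^bsub>G\<^esub> k) =
        k \<otimes>\<^bsub>G\<^esub> (inv\<^bsub>G\<^esub> g \<otimes>\<^bsub>G\<^esub> h) \<otimes>\<^bsub>G\<^esub> inv\<^bsub>G\<^esub> k"
      using g k hc by (simp add: G.m_assoc)
    finally show "?f (k \<otimes>\<^bsub>G\<^esub> g \<otimes>\<^bsub>G\<^esub> inv\<^bsub>G\<^esub> k) = ?f g"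
      using g k hc by (simp add: center_FG_apply[OF w])
  qed (use wc hc in auto)
  also have "carrier G \<inter> center G = center G" using G.center_subset by auto
  also have "finsum F ?f (center G) = finsum F ?f {y \<in> center G. inv\<^bsub>G\<^esub> y \<otimes>\<^bsub>G\<^esub> h = y}"
  proof (rule finsum_involution)
    show "finite (center G)" using G.fin G.center_subset finite_subset by blast
    fix y assume y: "y \<in> center G"
    then have yc: "y \<in> carrier G" by (simp add: center_def)
    show "inv\<^bsub>G\<^esub> y \<otimes>\<^bsub>G\<^esub> h \<in> center G"
      using y h G.center_subgroup by (simp add: subgroup.m_closed subgroup.m_inv_closed)
    have "inv\<^bsub>G\<^esub> h \<otimes>\<^bsub>G\<^esub> y \<otimes>\<^bsub>G\<^esub> h = y"
      using y hc yc by (simp add: center_def G.m_assoc) (simp add: G.m_assoc[symmetric])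
    then show *: "inv\<^bsub>G\<^esub> (inv\<^bsub>G\<^esub> y \<otimes>\<^bsub>G\<^esub> h) \<otimes>\<^bsub>G\<^esub> h = y"
      using hc yc by (simp add: G.inv_mult_group)
    show "?f (inv\<^bsub>G\<^esub> y \<otimes>\<^bsub>G\<^esub> h) = ?f y"
      unfolding * using hc yc wc by (intro m_comm) auto
  qed (use G.center_subset wc hc in auto)
  also have "\<dots> = (\<Oplus>y\<in>{y \<in> center G. y \<otimes>\<^bsub>G\<^esub> y = h}. w y \<otimes> w y)"
  proof (rule finsum_cong')
    have "inv\<^bsub>G\<^esub> y \<otimes>\<^bsub>G\<^esub> h = y \<longleftrightarrow> y \<otimes>\<^bsub>G\<^esub> y = h" if "y \<in> center G" for y
      using centerD(1)[OF that] hc G.inv_solve_left'[of y y h] by auto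
    then show "{y \<in> center G. inv\<^bsub>G\<^esub> y \<otimes>\<^bsub>G\<^esub> h = y} = {y \<in> center G. y \<otimes>\<^bsub>G\<^esub> y = h}" by auto
  qed (use G.center_subset wc in \<open>auto simp: G.m_assoc[symmetric]\<close>)
  finally show ?thesis .
qed

lemma aug_center:
  assumes w: "w \<in> center FG" shows "aug w = finsum F w (center G)"
proof -
  have wc: "w \<in> carrier FG" using w by (rule center_FG_closed)
  have "aug w = finsum F w (carrier G \<inter> center G)"
    unfolding aug_eq[OF wc] using wc
    by (intro class_function_sum[OF conj_invariant_carrier]) (auto simp: center_FG_apply[OF w])
  also have "carrier G \<inter> center G = center G" using G.center_subset by auto
  finally show ?thesis .
qed

text \<open>By \<open>square_on_center\<close>, squaring moves the support inside the centre along the squaring map of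
  the group.  After \<open>k\<close> steps only the coefficient at 1 is left, and it equals the augmentation.\<close>

lemma iter_square_vanishes:
  assumes "w \<in> center FG" "aug w = \<zero>"
    and "\<And>h. h \<in> center G \<Longrightarrow> w h \<noteq> \<zero> \<Longrightarrow> h [^]\<^bsub>G\<^esub> ((2::nat) ^ k) = \<one>\<^bsub>G\<^esub>"
  shows "iter_square FG k w \<in> center FG \<and> (\<forall>h\<in>center G. iter_square FG k w h = \<zero>)"
  using assms
proof (induction k arbitrary: w)
  case 0
  have wc: "w \<in> carrier FG" using 0 by (simp add: center_FG_closed)
  have w0: "w h = \<zero>" if "h \<in> center G" "h \<noteq> \<one>\<^bsub>G\<^esub>" for h
    using 0(3)[of h] that centerD(1)[of h G] by auto
  have one: "\<one>\<^bsub>G\<^esub> \<in> center G" using G.center_subgroup by (rule subgroup.one_closed)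
  have finc: "finite (center G)" using G.fin G.center_subset finite_subset by blast
  have "aug w = (\<Oplus>h\<in>center G. if \<one>\<^bsub>G\<^esub> = h then w h else \<zero>)"
    unfolding aug_center[OF 0(1)] using w0 wc G.center_subset by (intro finsum_cong') auto
  also have "\<dots> = w \<one>\<^bsub>G\<^esub>"
    using finsum_singleton[OF one finc, of w] wc G.center_subset by auto
  finally show ?case using 0 w0 by auto
next
  case (Suc k)
  let ?v = "w \<otimes>\<^bsub>FG\<^esub> w"
  have wc: "w \<in> carrier FG" using Suc by (simp add: center_FG_closed)
  have "iter_square FG k ?v \<in> center FG \<and> (\<forall>h\<in>center G. iter_square FG k ?v h = \<zero>)"
  proof (rule Suc.IH)
    show "?v \<in> center FG" using center_FG_mult Suc by blast
    show "aug ?v = \<zero>" using aug_mult[OF wc wc] Suc by simp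
    fix h assume h: "h \<in> center G" "?v h \<noteq> \<zero>"
    have "\<exists>y\<in>center G. y \<otimes>\<^bsub>G\<^esub> y = h \<and> w y \<noteq> \<zero>"
    proof (rule ccontr)
      assume no: "\<not> ?thesis"
      have "(\<Oplus>y\<in>{y \<in> center G. y \<otimes>\<^bsub>G\<^esub> y = h}. w y \<otimes> w y) =
          (\<Oplus>y\<in>{y \<in> center G. y \<otimes>\<^bsub>G\<^esub> y = h}. \<zero>)"
        by (rule finsum_cong') (use no in auto)
      then show False using h square_on_center[OF Suc.prems(1) h(1)] by simp
    qed
    then obtain y where y: "y \<in> center G" "y \<otimes>\<^bsub>G\<^esub> y = h" "w y \<noteq> \<zero>" by auto
    have yc: "y \<in> carrier G" using y(1) by (rule centerD(1))
    have "y [^]\<^bsub>G\<^esub> ((2::nat) ^ Suc k) = \<one>\<^bsub>G\<^esub>" using Suc.prems(3) y by blast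
    then show "h [^]\<^bsub>G\<^esub> ((2::nat) ^ k) = \<one>\<^bsub>G\<^esub>"
      unfolding y(2)[symmetric] by (simp only: G.square_pow[OF yc])
  qed
  then show ?case by (simp add: iter_square_Suc)
qed

end

section \<open>2-groups with abelianisation of order four\<close>

context two_group
begin

lemma index_two_mult:
  assumes L: "subgroup L G" "2 * card L = order G"
    and x: "x \<in> carrier G" "x \<notin> L" and g: "g \<in> carrier G" "g \<notin> L"
  shows "x \<otimes> g \<in> L"
proof (rule ccontr)
  interpret L: subgroup L G by fact
  assume n: "x \<otimes> g \<notin> L"
  let ?M = "(\<lambda>l. x \<otimes> l) ` L"
  have fL: "finite L" using fin L.subset finite_subset by blast
  have "card ?M = card L"
    using x L.subset by (intro card_image) (auto simp: inj_on_def subset_iff)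
  moreover have "L \<inter> ?M = {}"
  proof (rule ccontr)
    assume "L \<inter> ?M \<noteq> {}"
    then obtain l where l: "l \<in> L" "x \<otimes> l \<in> L" by auto
    have "x = (x \<otimes> l) \<otimes> inv l" using l x by (simp add: m_assoc)
    then show False using l x L.m_closed L.m_inv_closed by metis
  qed
  ultimately have "card (L \<union> ?M) = order G"
    using fL L(2) by (simp add: card_Un_disjoint)
  moreover have "L \<union> ?M \<subseteq> carrier G" using x L.subset by auto
  ultimately have "L \<union> ?M = carrier G"
    using fin card_subset_eq unfolding order_def by blast
  then have "x \<otimes> g \<in> ?M" using n x g by blast
  then obtain l where "l \<in> L" "x \<otimes> g = x \<otimes> l" by auto
  then show False using x g by auto
qed

lemma exists_not_mem_index_two:
  assumes "subgroup L G" "2 * card L = order G"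
  shows "\<exists>x\<in>carrier G. x \<notin> L"
proof (rule ccontr)
  assume "\<not> ?thesis"
  then have "L = carrier G" using subgroup.subset[OF assms(1)] by auto
  then have "order G = 0" using assms(2) by (simp add: order_def)
  then show False using order_gt_0_iff_finite fin by simp
qed

lemma card_generate_order_four:
  assumes b: "b \<in> carrier G" and t: "b \<otimes> b \<noteq> \<one>" "(b \<otimes> b) \<otimes> (b \<otimes> b) = \<one>"
  shows "card (generate G {b}) = 4"
proof -
  have "b [^] (4::nat) = (b \<otimes> b) \<otimes> (b \<otimes> b)"
    using b by (simp add: numeral_eq_Suc m_assoc)
  then have "ord b dvd 2 ^ 2" using t b pow_eq_id[of b 4] by simp
  then obtain k where k: "k \<le> 2" "ord b = 2 ^ k"
    using divides_primepow_nat[OF two_is_prime_nat] by blast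
  have "\<not> ord b dvd 2" using t b pow_eq_id[of b 2] by (simp add: numeral_2_eq_2)
  moreover have "k = 0 \<or> k = 1 \<or> k = 2" using k(1) by linarith
  ultimately have "k = 2" using k(2) by auto
  then show ?thesis using k generate_pow_card[OF b] by simp
qed

lemma odd_pow_eq_one:
  fixes i j :: int
  assumes a: "a \<in> carrier G" and e: "a [^] (i * j) = \<one>" and j: "odd j"
  shows "a [^] i = \<one>"
proof -
  obtain n where n: "ord a = 2 ^ n" using dvd_order_imp_pow ord_dvd_group_order[OF a] by blast
  have "int (ord a) dvd i * j" using e a int_pow_eq_id by blast
  moreover have "coprime (int (ord a)) j" using j n by simp
  ultimately have "int (ord a) dvd i" by (simp add: coprime_dvd_mult_left_iff)
  then show ?thesis using a int_pow_eq_id by blast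
qed

lemma involution_int_pow:
  assumes "t \<in> carrier G" "t \<otimes> t = \<one>"
  shows "t [^] (j::int) = (if even j then \<one> else t)"
proof -
  have "t [^] (2::nat) = \<one>" using assms by (simp add: numeral_2_eq_2)
  then have d: "int (ord t) dvd 2"
    using pow_eq_id[OF assms(1), of 2] by (simp flip: int_dvd_int_iff)
  show ?thesis
  proof (cases "even j")
    case True
    then have "int (ord t) dvd j" using d by (rule dvd_trans[rotated])
    then show ?thesis using True int_pow_eq_id[OF assms(1)] by simp
  next
    case False
    then have "2 dvd 1 - j" by presburger
    then have "int (ord t) dvd 1 - j" using d by (rule dvd_trans[rotated])
    then have "t [^] j = t [^] (1::int)" using int_pow_eq[OF assms(1), of j 1] by blast
    then show ?thesis using False assms by simp
  qed
qed

text \<open>The inductive step for \<open>cyclic_index_two\<close>.  The subgroup \<open>L\<close> generated by \<open>a\<close> and \<open>t\<close> is abelian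
  of index two.  With \<open>x\<close> outside \<open>L\<close> and \<open>v\<close> the commutator of \<open>x\<close> and \<open>a\<close>, conjugation by \<open>x\<close>
  inverts \<open>v\<close>, and every commutator is a power of \<open>v\<close>; in particular \<open>t\<close> is.  If \<open>t\<close> is not a
  power of \<open>a\<close>, this leaves only \<open>v = t\<close>.  Then the derived subgroup has order two and the group
  has order eight, where \<open>x\<close> or \<open>x a\<close> has order four.\<close>

lemma lift_cyclic_index_two:
  assumes tZ: "t \<in> center G" and t1: "t \<noteq> \<one>" and tt: "t \<otimes> t = \<one>"
    and tD: "t \<in> derived G (carrier G)"
    and oD: "order G = 4 * card (derived G (carrier G))"
    and a: "a \<in> carrier G" and oL: "2 * card ({\<one>, t} <#> generate G {a}) = order G"
  shows "\<exists>b\<in>carrier G. 2 * card (generate G {b}) = order G"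
proof (cases "t \<in> generate G {a}")
  case True
  have sA: "subgroup (generate G {a}) G" using a by (intro generate_is_subgroup) auto
  have "{\<one>, t} <#> generate G {a} = generate G {a}"
  proof
    show "{\<one>, t} <#> generate G {a} \<subseteq> generate G {a}"
      unfolding set_mult_def using True subgroup.m_closed[OF sA] subgroup.mem_carrier[OF sA] by auto
    show "generate G {a} \<subseteq> {\<one>, t} <#> generate G {a}"
      unfolding set_mult_def using subgroup.mem_carrier[OF sA] by force
  qed
  then show ?thesis using oL a by auto
next
  case False
  define A where "A = generate G {a}"
  define L where "L = {\<one>, t} <#> A"
  have tc: "t \<in> carrier G" using tZ by (rule centerD(1))
  have invt: "inv t = t" using tt tc by (simp add: inv_equality)
  have sA: "subgroup A G" unfolding A_def using a by (intro generate_is_subgroup) auto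
  have Ac: "\<And>y. y \<in> A \<Longrightarrow> y \<in> carrier G" using subgroup.mem_carrier[OF sA] .
  have Apow: "A = {a [^] (k::int) | k. k \<in> UNIV}" unfolding A_def by (rule generate_pow[OF a])
  have sT: "subgroup {\<one>, t} G"
    by (rule subgroupI) (use tt tc invt in auto)
  have "{\<one>, t} \<lhd> G"
    unfolding normal_inv_iff using sT center_conj[OF tZ] by auto
  then have sL: "subgroup L G" unfolding L_def by (rule mult_norm_subgroup[OF _ sA])
  interpret L: subgroup L G by (rule sL)
  have oL': "2 * card L = order G" using oL by (simp add: L_def A_def)
  have LE: "\<exists>k::int. \<exists>e. (e = \<one> \<or> e = t) \<and> l = e \<otimes> a [^] k" if "l \<in> L" for l
    using that unfolding L_def set_mult_def Apow by auto
  have aL: "a \<in> L" and tL: "t \<in> L"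
  proof -
    have "a \<in> A" "\<one> \<in> A" using a subgroup.one_closed[OF sA] by (auto simp: A_def intro: generate.incl)
    then show "a \<in> L" "t \<in> L" unfolding L_def set_mult_def using a tc by force+
  qed
  have powcomm: "a [^] (i::int) \<otimes> a [^] (j::int) = a [^] j \<otimes> a [^] i" for i j
    using a by (simp add: int_pow_mult add.commute flip: int_pow_mult)
  have Lcomm: "l \<otimes> m = m \<otimes> l" if l: "l \<in> L" and m: "m \<in> L" for l m
  proof -
    obtain i e where i: "e = \<one> \<or> e = t" "l = e \<otimes> a [^] (i::int)" using LE[OF l] by blast
    obtain j f where j: "f = \<one> \<or> f = t" "m = f \<otimes> a [^] (j::int)" using LE[OF m] by blast
    have ef: "e \<in> carrier G" "f \<in> carrier G" using i j tc by auto
    have ec: "e \<otimes> y = y \<otimes> e" "f \<otimes> y = y \<otimes> f" if "y \<in> carrier G" for y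
      using i j that centerD(2)[OF tZ that] by auto
    have "l \<otimes> m = e \<otimes> (a [^] i \<otimes> f) \<otimes> a [^] j" using i j ef a by (simp add: m_assoc)
    also have "\<dots> = e \<otimes> f \<otimes> (a [^] i \<otimes> a [^] j)"
      using ef a by (simp only: ec(2)[OF int_pow_closed[OF a], symmetric] m_assoc m_closed int_pow_closed)
    also have "\<dots> = f \<otimes> e \<otimes> (a [^] j \<otimes> a [^] i)"
      using ec(1)[OF ef(2)] powcomm by simp
    also have "\<dots> = f \<otimes> (e \<otimes> a [^] j) \<otimes> a [^] i" using ef a by (simp add: m_assoc)
    also have "\<dots> = f \<otimes> (a [^] j \<otimes> e) \<otimes> a [^] i" using ec(1)[of "a [^] j"] a by simp
    also have "\<dots> = m \<otimes> l" using i j ef a by (simp add: m_assoc)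
    finally show ?thesis .
  qed
  obtain x where x: "x \<in> carrier G" "x \<notin> L" using exists_not_mem_index_two[OF sL oL'] by auto
  have ix: "inv x \<in> carrier G" "inv x \<notin> L" using x L.m_inv_closed inv_inv by (auto, metis)
  have xxL: "x \<otimes> x \<in> L" using index_two_mult[OF sL oL' x x] .
  have conjL: "x \<otimes> l \<otimes> inv x \<in> L" if l: "l \<in> L" for l
  proof -
    have "x \<otimes> l \<notin> L"
    proof
      assume "x \<otimes> l \<in> L"
      then have "x \<otimes> l \<otimes> inv l \<in> L" using l by simp
      then show False using x l by (simp add: m_assoc)
    qed
    then show ?thesis using index_two_mult[OF sL oL' _ _ ix] x l by auto
  qed
  have xcase: "g \<in> L \<or> (\<exists>l\<in>L. g = x \<otimes> l)" if g: "g \<in> carrier G" for g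
  proof (cases "g \<in> L")
    case False
    have "inv x \<otimes> g \<in> L" using index_two_mult[OF sL oL' ix g False] .
    moreover have "g = x \<otimes> (inv x \<otimes> g)" using x g by (simp add: m_assoc[symmetric])
    ultimately show ?thesis by blast
  qed auto
  have conjm: "x \<otimes> (l \<otimes> m) \<otimes> inv x = (x \<otimes> l \<otimes> inv x) \<otimes> (x \<otimes> m \<otimes> inv x)"
    if "l \<in> carrier G" "m \<in> carrier G" for l m
  proof -
    have "(x \<otimes> l \<otimes> inv x) \<otimes> (x \<otimes> m \<otimes> inv x) = x \<otimes> l \<otimes> (inv x \<otimes> x) \<otimes> m \<otimes> inv x"
      using x that by (simp only: m_assoc m_closed inv_closed)
    then show ?thesis using x that by (simp add: m_assoc)
  qed
  have conjhom: "(\<lambda>l. x \<otimes> l \<otimes> inv x) \<in> hom G G"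
    using x conjm by (auto simp: hom_def)
  interpret cx: group_hom G G "\<lambda>l. x \<otimes> l \<otimes> inv x"
    using conjhom by unfold_locales
  define c where "c = x \<otimes> a \<otimes> inv x"
  have cL: "c \<in> L" unfolding c_def using conjL aL .
  have cc: "c \<in> carrier G" using cL by simp
  define v where "v = c \<otimes> inv a"
  have vL: "v \<in> L" unfolding v_def using cL aL by simp
  have vc: "v \<in> carrier G" using vL by simp
  have cpow: "x \<otimes> a [^] (i::int) \<otimes> inv x = c [^] i" for i
    unfolding c_def using cx.hom_int_pow[OF a] by simp
  \<comment> \<open>\<open>x^2\<close> lies in the abelian group \<open>L\<close>, so conjugating twice by \<open>x\<close> is trivial on \<open>L\<close>\<close>
  have xcx: "x \<otimes> c \<otimes> inv x = a"
  proof -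
    have "x \<otimes> c \<otimes> inv x = (x \<otimes> x) \<otimes> a \<otimes> inv (x \<otimes> x)"
      using x a by (simp add: c_def m_assoc inv_mult_group)
    also have "\<dots> = a" using Lcomm[OF xxL aL] x a by (simp add: m_assoc)
    finally show ?thesis .
  qed
  have xvx: "x \<otimes> v \<otimes> inv x = inv v"
  proof -
    have "x \<otimes> v \<otimes> inv x = (x \<otimes> c \<otimes> inv x) \<otimes> (x \<otimes> inv a \<otimes> inv x)"
      unfolding v_def using cc a by (intro conjm) auto
    also have "x \<otimes> inv a \<otimes> inv x = inv c"
      unfolding c_def using cx.hom_inv[OF a] by simp
    finally show ?thesis using xcx cc a by (simp add: v_def inv_mult_group)
  qed
  define V where "V = generate G {v}"
  have sV: "subgroup V G" unfolding V_def using vc by (intro generate_is_subgroup) auto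
  interpret V: subgroup V G by (rule sV)
  have Vpow: "V = {v [^] (k::int) | k. k \<in> UNIV}" unfolding V_def by (rule generate_pow[OF vc])
  have xV: "x \<otimes> y \<otimes> inv x \<in> V" if y: "y \<in> V" for y
  proof -
    obtain k where k: "y = v [^] (k::int)" using y Vpow by auto
    have "x \<otimes> y \<otimes> inv x = inv v [^] k"
      unfolding k using cx.hom_int_pow[OF vc] xvx by simp
    also have "inv v \<in> V" unfolding V_def using vc by (intro generate.inv) auto
    then have "inv v [^] k \<in> V" by (rule subgroup_int_pow_closed[OF sV])
    finally show ?thesis .
  qed
  have CL: "x \<otimes> l \<otimes> inv x \<otimes> inv l \<in> V" if l: "l \<in> L" for l
  proof -
    obtain i e where i: "e = \<one> \<or> e = t" "l = e \<otimes> a [^] (i::int)" using LE[OF l] by blast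
    have e: "e \<in> carrier G" using i tc by auto
    have ec: "e \<otimes> y = y \<otimes> e" if "y \<in> carrier G" for y
      using i that centerD(2)[OF tZ that] by auto
    have "x \<otimes> e \<otimes> inv x = e" using ec[OF x(1)] x e by (metis inv_solve_right' m_closed)
    then have xl: "x \<otimes> l \<otimes> inv x = e \<otimes> c [^] i"
      unfolding i(2) using conjm[OF e, of "a [^] i"] cpow a by simp
    have "x \<otimes> l \<otimes> inv x \<otimes> inv l = e \<otimes> c [^] i \<otimes> (inv (a [^] i) \<otimes> inv e)"
      unfolding xl using i(2) e a by (simp add: inv_mult_group)
    also have "\<dots> = e \<otimes> (c [^] i \<otimes> inv (a [^] i)) \<otimes> inv e"
      using e a cc by (simp add: m_assoc)
    also have "\<dots> = c [^] i \<otimes> inv (a [^] i)"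
      using e a cc ec[of "c [^] i \<otimes> inv (a [^] i)"] by (simp add: m_assoc)
    also have "\<dots> = c [^] i \<otimes> (inv a) [^] i"
      using a by (simp add: int_pow_inv)
    also have "\<dots> = v [^] i"
      unfolding v_def using cc a Lcomm[OF cL L.m_inv_closed[OF aL]]
      by (intro int_pow_mult_distrib[symmetric]) auto
    finally show ?thesis using Vpow by auto
  qed
  have comm: "g \<otimes> h \<otimes> inv g \<otimes> inv h \<in> V" if g: "g \<in> carrier G" and h: "h \<in> carrier G" for g h
  proof -
    consider "g \<in> L" "h \<in> L" | l where "l \<in> L" "g = x \<otimes> l" "h \<in> L"
      | m where "m \<in> L" "h = x \<otimes> m" "g \<in> L"
      | l m where "l \<in> L" "g = x \<otimes> l" "m \<in> L" "h = x \<otimes> m"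
      using xcase[OF g] xcase[OF h] by blast
    then show ?thesis
    proof cases
      case 1
      then have "g \<otimes> h \<otimes> inv g \<otimes> inv h = \<one>"
        using Lcomm[OF 1] g h by (simp add: m_assoc)
      then show ?thesis by simp
    next
      case 2
      have l: "l \<in> carrier G" using 2 by simp
      have "g \<otimes> h \<otimes> inv g \<otimes> inv h = x \<otimes> ((l \<otimes> h) \<otimes> inv l) \<otimes> inv x \<otimes> inv h"
        using 2 x l h by (simp add: m_assoc inv_mult_group)
      also have "(l \<otimes> h) \<otimes> inv l = h" using Lcomm[OF 2(1,3)] l h by (simp add: m_assoc)
      finally show ?thesis using CL[OF 2(3)] by simp
    next
      case 3
      have m: "m \<in> carrier G" using 3 by simp
      have "g \<otimes> h \<otimes> inv g \<otimes> inv h = g \<otimes> x \<otimes> (m \<otimes> inv g \<otimes> inv m) \<otimes> inv x"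
        using 3 x m g by (simp add: m_assoc inv_mult_group)
      also have "m \<otimes> inv g \<otimes> inv m = inv g"
        using Lcomm[OF 3(1) L.m_inv_closed[OF 3(3)]] m g by (simp add: m_assoc)
      also have "g \<otimes> x \<otimes> inv g \<otimes> inv x = inv (x \<otimes> g \<otimes> inv x \<otimes> inv g)"
        using x g by (simp add: m_assoc inv_mult_group)
      finally show ?thesis using CL[OF 3(3)] by simp
    next
      case 4
      have lm: "l \<in> carrier G" "m \<in> carrier G" using 4 by auto
      have k: "m \<otimes> inv l \<in> L" using 4 by simp
      have "g \<otimes> h \<otimes> inv g \<otimes> inv h =
          x \<otimes> (l \<otimes> (x \<otimes> (m \<otimes> inv l) \<otimes> inv x) \<otimes> inv m) \<otimes> inv x"
        using 4 x lm by (simp add: m_assoc inv_mult_group)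
      also have "l \<otimes> (x \<otimes> (m \<otimes> inv l) \<otimes> inv x) = (x \<otimes> (m \<otimes> inv l) \<otimes> inv x) \<otimes> l"
        by (rule Lcomm[OF 4(1) conjL[OF k]])
      also have "(x \<otimes> (m \<otimes> inv l) \<otimes> inv x) \<otimes> l \<otimes> inv m =
          x \<otimes> (m \<otimes> inv l) \<otimes> inv x \<otimes> inv (m \<otimes> inv l)"
        using x lm by (simp add: m_assoc inv_mult_group)
      finally show ?thesis using xV[OF CL[OF k]] by simp
    qed
  qed
  have DV: "derived G (carrier G) \<subseteq> V"
    unfolding derived_def using sV comm by (intro generate_subgroup_incl) auto
  then have tV: "t \<in> V" using tD by auto
  have tA: "t \<notin> A" using False by (simp add: A_def)
  obtain i e where i: "e = \<one> \<or> e = t" "v = e \<otimes> a [^] (i::int)" using LE[OF vL] by blast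
  obtain j where j: "t = v [^] (j::int)" using tV Vpow by auto
  \<comment> \<open>\<open>v\<close> has the form \<open>e a^i\<close> with \<open>e\<close> in \<open>{1, t}\<close>, and \<open>t\<close> is a power of \<open>v\<close> but not of \<open>a\<close>\<close>
  have vt: "v = t"
  proof -
    have "e \<noteq> \<one>"
    proof
      assume "e = \<one>"
      then have "v \<in> A" using i Apow a by auto
      then have "t \<in> A" unfolding j by (rule subgroup_int_pow_closed[OF sA])
      then show False using tA by simp
    qed
    then have v: "v = t \<otimes> a [^] i" using i by simp
    have tj: "t = t [^] j \<otimes> a [^] (i * j)"
    proof -
      have "v [^] j = t [^] j \<otimes> (a [^] i) [^] j"
        unfolding v using tc a centerD(2)[OF tZ] by (intro int_pow_mult_distrib) auto
      then show ?thesis using a j by (simp add: int_pow_pow)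
    qed
    have "odd j"
    proof
      assume "even j"
      then have "t = a [^] (i * j)" using tj involution_int_pow[OF tc tt, of j] a by simp
      then show False using tA Apow by auto
    qed
    then have "t \<otimes> a [^] (i * j) = t" using tj involution_int_pow[OF tc tt, of j] by simp
    then have "a [^] (i * j) = \<one>" using tc a by (simp add: r_cancel_one)
    then have "a [^] i = \<one>" using odd_pow_eq_one[OF a _ \<open>odd j\<close>] by blast
    then show ?thesis using v tc by simp
  qed
  have V2: "V = {\<one>, t}"
    unfolding Vpow vt using involution_int_pow[OF tc tt] by (auto intro: exI[of _ 0] exI[of _ 1])
  have D2: "derived G (carrier G) = {\<one>, t}"
  proof
    show "derived G (carrier G) \<subseteq> {\<one>, t}" using DV unfolding V2 .
    have "\<one> \<in> derived G (carrier G)"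
      by (rule subgroup.one_closed[OF derived_is_subgroup[OF subset_refl]])
    then show "{\<one>, t} \<subseteq> derived G (carrier G)" using tD by simp
  qed
  have o8: "order G = 8" using oD t1 by (simp add: D2)
  have fA: "finite A" by (rule finite_subset[OF subgroup.subset[OF sA] fin])
  have Lun: "L = A \<union> (\<lambda>y. t \<otimes> y) ` A"
    unfolding L_def set_mult_def using Ac by force
  have disj: "A \<inter> (\<lambda>y. t \<otimes> y) ` A = {}"
  proof (rule ccontr)
    assume "A \<inter> (\<lambda>y. t \<otimes> y) ` A \<noteq> {}"
    then obtain y where y: "y \<in> A" "t \<otimes> y \<in> A" by auto
    have "t = (t \<otimes> y) \<otimes> inv y" using y Ac tc by (simp add: m_assoc)
    then show False using tA y subgroup.m_closed[OF sA] subgroup.m_inv_closed[OF sA] by metis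
  qed
  have "card ((\<lambda>y. t \<otimes> y) ` A) = card A"
    using tc Ac by (intro card_image) (auto simp: inj_on_def)
  then have "card L = 2 * card A" unfolding Lun using disj fA by (simp add: card_Un_disjoint)
  then have "ord a = 2" using o8 oL' generate_pow_card[OF a] by (simp add: A_def)
  then have aa: "a \<otimes> a = \<one>" using a pow_ord_eq_1[OF a] by (simp add: numeral_2_eq_2)
  have a1: "a \<noteq> \<one>" using \<open>ord a = 2\<close> ord_id by auto
  have xa: "x \<otimes> a = t \<otimes> a \<otimes> x"
  proof -
    have "c \<otimes> inv a = t" using vt v_def by simp
    then have "x \<otimes> a \<otimes> inv x = t \<otimes> a"
      using inv_solve_right'[OF tc cc a] by (simp add: c_def)
    then show ?thesis using inv_solve_right'[of "t \<otimes> a" "x \<otimes> a" x] x a tc by simp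
  qed
  have xa_ne: "x \<otimes> a \<noteq> a \<otimes> x"
  proof
    assume "x \<otimes> a = a \<otimes> x"
    then have "t \<otimes> (a \<otimes> x) = a \<otimes> x" using xa x a tc by (simp add: m_assoc)
    then show False using t1 x a tc by (simp add: l_cancel_one)
  qed
  \<comment> \<open>\<open>x^2\<close> lies in \<open>L = {1, t, a, t a}\<close>, and it commutes with \<open>x\<close>, unlike \<open>a\<close> and \<open>t a\<close>\<close>
  have xx: "x \<otimes> x = \<one> \<or> x \<otimes> x = t"
  proof -
    obtain k f where k: "f = \<one> \<or> f = t" "x \<otimes> x = f \<otimes> a [^] (k::int)" using LE[OF xxL] by blast
    have "even k"
    proof (rule ccontr)
      assume "odd k"
      then have ak: "x \<otimes> x = f \<otimes> a" using k involution_int_pow[OF a aa, of k] by simp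
      have f: "f \<in> carrier G" "f \<otimes> x = x \<otimes> f" using k centerD(2)[OF tZ x(1)] tc x by auto
      have "f \<otimes> (x \<otimes> a) = x \<otimes> (f \<otimes> a)" using f x a by (simp add: m_assoc[symmetric])
      also have "\<dots> = (f \<otimes> a) \<otimes> x" unfolding ak[symmetric] using x by (simp add: m_assoc)
      also have "\<dots> = f \<otimes> (a \<otimes> x)" using f x a by (simp add: m_assoc)
      finally show False using xa_ne f x a by simp
    qed
    then show ?thesis using k involution_int_pow[OF a aa, of k] tc by auto
  qed
  show ?thesis
  proof (cases "x \<otimes> x = t")
    case True
    then have "card (generate G {x}) = 4" using x t1 tt by (intro card_generate_order_four) auto
    then show ?thesis using x o8 by auto
  next
    case False
    then have x1: "x \<otimes> x = \<one>" using xx by simp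
    have "(x \<otimes> a) \<otimes> (x \<otimes> a) = (t \<otimes> a \<otimes> x) \<otimes> (x \<otimes> a)" using xa by simp
    also have "\<dots> = t \<otimes> (a \<otimes> ((x \<otimes> x) \<otimes> a))" using x a tc by (simp only: m_assoc m_closed)
    also have "\<dots> = t" using x1 a aa tc by simp
    finally have "card (generate G {x \<otimes> a}) = 4"
      using x a t1 tt by (intro card_generate_order_four) auto
    then show ?thesis using x a o8 by (intro bexI[of _ "x \<otimes> a"]) auto
  qed
qed


text \<open>Outside the centre the derived subgroup has an even number of elements, and so has the whole
  derived subgroup, if it is not trivial; hence it contains a central element other than 1.\<close>

lemma exists_central_involution_in_derived:
  assumes "derived G (carrier G) \<noteq> {\<one>}"
  shows "\<exists>t\<in>center G. t \<in> derived G (carrier G) \<and> t \<noteq> \<one> \<and> t \<otimes> t = \<one>"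
proof -
  let ?D = "derived G (carrier G)"
  have nD: "?D \<lhd> G" by (rule derived_self_is_normal)
  have sD: "subgroup ?D G" by (rule derived_is_subgroup[OF subset_refl])
  interpret D: subgroup ?D G by (rule sD)
  have fD: "finite ?D" using fin D.subset finite_subset by blast
  have "card ?D dvd order G" using lagrange[OF sD] by (metis dvd_triv_right)
  then obtain n where n: "card ?D = 2 ^ n" using dvd_order_imp_pow by blast
  have "n \<noteq> 0"
  proof
    assume "n = 0"
    then obtain d where "?D = {d}" using n card_1_singletonE by force
    then show False using assms D.one_closed by auto
  qed
  then have "even (card ?D)" using n by simp
  moreover have "conj_invariant G ?D"
    using nD D.subset unfolding conj_invariant_def normal_inv_iff by blast
  then have "even (card (?D - center G))" by (rule even_card_noncentral)
  moreover have "card ?D = card (?D \<inter> center G) + card (?D - center G)"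
    using card_Un_disjoint[of "?D \<inter> center G" "?D - center G"] fD by (simp add: Int_Diff_Un Int_Diff_disjoint)
  ultimately have ev: "even (card (?D \<inter> center G))" by simp
  have "\<one> \<in> ?D \<inter> center G" using subgroup.one_closed[OF center_subgroup] by simp
  then have "?D \<inter> center G \<noteq> {\<one>}" using ev by (metis card.empty card_insert_if empty_iff finite.emptyI odd_one One_nat_def)
  then obtain s where s: "s \<in> ?D" "s \<in> center G" "s \<noteq> \<one>"
    using \<open>\<one> \<in> ?D \<inter> center G\<close> by blast
  have sc: "s \<in> carrier G" using s(1) by simp
  obtain k where k: "ord s = 2 ^ k" using dvd_order_imp_pow ord_dvd_group_order[OF sc] by blast
  have "k \<noteq> 0" using k s(3) ord_eq_1[OF sc] by auto
  then obtain l where l: "k = Suc l" using not0_implies_Suc by blast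
  define t where "t = s [^] ((2::nat) ^ l)"
  have tc: "t \<in> carrier G" using sc by (simp add: t_def)
  have "\<not> ord s dvd 2 ^ l" unfolding k l by (simp add: dvd_power_iff_le)
  then have "t \<noteq> \<one>" unfolding t_def using pow_eq_id[OF sc, of "2 ^ l"] by simp
  moreover have "t \<otimes> t = \<one>"
  proof -
    have "t \<otimes> t = s [^] ((2::nat) ^ l + 2 ^ l)" unfolding t_def using nat_pow_mult[OF sc] by simp
    also have "(2::nat) ^ l + 2 ^ l = ord s" unfolding k l by simp
    finally show ?thesis using pow_ord_eq_1[OF sc] by simp
  qed
  moreover have "t \<in> center G" unfolding t_def by (rule center_pow_closed[OF s(2)])
  moreover have "t \<in> ?D"
    unfolding t_def using subgroup_int_pow_closed[OF sD s(1), of "int (2 ^ l)"] by (simp only: int_pow_int)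
  ultimately show ?thesis by blast
qed

end

lemma card_subgroup_image:
  assumes "group_hom G K h" and "finite (carrier G)" and S: "subgroup S G" "kernel G K h \<subseteq> S"
  shows "card S = card (kernel G K h) * card (h ` S)"
proof -
  interpret group_hom G K h by fact
  interpret S: subgroup S G by fact
  let ?k = "kernel G K h"
  have fS: "finite S" using assms(2) S.subset finite_subset by blast
  have sk: "subgroup ?k G" by (rule subgroup_kernel)
  have "card {x \<in> S. h x = y} = card ?k" if y: "y \<in> h ` S" for y
  proof -
    obtain s where s: "s \<in> S" "y = h s" using y by auto
    have sc: "s \<in> carrier G" using s by simp
    have "{x \<in> S. h x = y} = (\<lambda>u. s \<otimes>\<^bsub>G\<^esub> u) ` ?k"
    proof
      show "{x \<in> S. h x = y} \<subseteq> (\<lambda>u. s \<otimes>\<^bsub>G\<^esub> u) ` ?k"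
      proof
        fix x assume x: "x \<in> {x \<in> S. h x = y}"
        have "inv\<^bsub>G\<^esub> s \<otimes>\<^bsub>G\<^esub> x \<in> ?k" using x s sc by (auto simp: kernel_def)
        moreover have "x = s \<otimes>\<^bsub>G\<^esub> (inv\<^bsub>G\<^esub> s \<otimes>\<^bsub>G\<^esub> x)"
          using x sc S.subset by (auto simp: G.m_assoc[symmetric])
        ultimately show "x \<in> (\<lambda>u. s \<otimes>\<^bsub>G\<^esub> u) ` ?k" by blast
      qed
      show "(\<lambda>u. s \<otimes>\<^bsub>G\<^esub> u) ` ?k \<subseteq> {x \<in> S. h x = y}"
        using s S(2) sc by (auto simp: kernel_def)
    qed
    moreover have "card ((\<lambda>u. s \<otimes>\<^bsub>G\<^esub> u) ` ?k) = card ?k"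
      using sc by (intro card_image) (auto simp: inj_on_def kernel_def)
    ultimately show ?thesis by simp
  qed
  then have "(\<Sum>y\<in>h ` S. card {x \<in> S. h x = y}) = card ?k * card (h ` S)" by simp
  moreover have "(\<Sum>y\<in>h ` S. card {x \<in> S. h x = y}) = card S"
    using sum.group[OF fS finite_imageI[OF fS] subset_refl, where g = h and h = "\<lambda>_. 1::nat"] by simp
  ultimately show ?thesis by simp
qed

text \<open>Passing to a quotient changes the type of the group elements.  An induction over quotients can
  be carried out on groups of natural numbers.\<close>

lemma finite_group_iso_nat:
  assumes "group G" "finite (carrier G)"
  obtains K :: "nat monoid" and f where "group K" "f \<in> iso G K"
proof -
  interpret group G by fact
  obtain f :: "'a \<Rightarrow> nat" where inj: "inj_on f (carrier G)"
    using finite_imp_inj_to_nat_seg[OF assms(2)] by metis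
  have iso: "f \<in> iso G (image_group f G)" by (rule inj_imp_image_group_iso[OF inj])
  have "group (image_group f G \<lparr>one := f \<one>\<^bsub>G\<^esub>\<rparr>)" by (rule iso_imp_img_group[OF iso])
  moreover have "image_group f G \<lparr>one := f \<one>\<^bsub>G\<^esub>\<rparr> = image_group f G" by (simp add: image_group_def)
  ultimately show ?thesis using that iso by simp
qed

lemma generate_singleton_image:
  assumes "group_hom G K h" "a \<in> carrier G"
  shows "generate K {h a} = h ` generate G {a}"
proof -
  interpret group_hom G K h by fact
  show ?thesis using generate_img[of "{a}"] assms(2) by simp
qed

lemma cyclic_index_two_nat:
  fixes K :: "nat monoid"
  assumes "two_group K" "order K = 4 * card (derived K (carrier K))"
  shows "\<exists>b\<in>carrier K. 2 * card (generate K {b}) = order K"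
  using assms
proof (induction "order K" arbitrary: K rule: less_induct)
  case less
  interpret K: two_group K by (rule less.prems)
  let ?D = "derived K (carrier K)"
  have sD: "subgroup ?D K" by (rule K.derived_is_subgroup[OF subset_refl])
  show ?case
  proof (cases "?D = {\<one>\<^bsub>K\<^esub>}")
    case True
    then have o4: "order K = 4" using less.prems(2) by simp
    have "\<exists>g\<in>carrier K. g \<noteq> \<one>\<^bsub>K\<^esub>"
    proof (rule ccontr)
      assume "\<not> ?thesis"
      then have "carrier K = {\<one>\<^bsub>K\<^esub>}" by auto
      then show False using o4 by (simp add: order_def)
    qed
    then obtain g where g: "g \<in> carrier K" "g \<noteq> \<one>\<^bsub>K\<^esub>" by auto
    have "K.ord g dvd 2 ^ 2" using K.ord_dvd_group_order[OF g(1)] o4 by simp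
    then obtain k where k: "k \<le> 2" "K.ord g = 2 ^ k"
      using divides_primepow_nat[OF two_is_prime_nat] by blast
    have "k \<noteq> 0" using k g K.ord_eq_1[OF g(1)] by auto
    then have "k = 1 \<or> k = 2" using k(1) by linarith
    then obtain b where "b \<in> carrier K" "K.ord b = 2"
    proof
      assume "k = 1" then show ?thesis using that[of g] g k by simp
    next
      assume "k = 2"
      then have "K.ord (g [^]\<^bsub>K\<^esub> (2::nat)) = 2" using K.ord_pow[OF g(1), of 2] k by simp
      then show ?thesis using that[of "g [^]\<^bsub>K\<^esub> (2::nat)"] g by simp
    qed
    then show ?thesis using K.generate_pow_card o4 by (intro bexI[of _ b]) auto
  next
    case False
    obtain t where t: "t \<in> center K" "t \<in> ?D" "t \<noteq> \<one>\<^bsub>K\<^esub>" "t \<otimes>\<^bsub>K\<^esub> t = \<one>\<^bsub>K\<^esub>"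
      using K.exists_central_involution_in_derived[OF False] by blast
    have tc: "t \<in> carrier K" using t(1) by (rule centerD(1))
    let ?T = "{\<one>\<^bsub>K\<^esub>, t}"
    have invt: "inv\<^bsub>K\<^esub> t = t" using t(4) tc by (simp add: K.inv_equality)
    have sT: "subgroup ?T K" by (rule K.subgroupI) (use t tc invt in auto)
    have nT: "?T \<lhd> K"
      unfolding K.normal_inv_iff using sT K.center_conj[OF t(1)] by auto
    interpret T: normal ?T K by (rule nT)
    have gQ: "group (K Mod ?T)" by (rule T.factorgroup_is_group)
    have hQ: "(\<lambda>g. ?T #>\<^bsub>K\<^esub> g) \<in> hom K (K Mod ?T)" by (rule T.r_coset_hom_Mod)
    have cQ: "carrier (K Mod ?T) = (\<lambda>g. ?T #>\<^bsub>K\<^esub> g) ` carrier K" by (rule carrier_FactGroup)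
    then have fQ: "finite (carrier (K Mod ?T))" using K.fin by simp
    obtain K' :: "nat monoid" and f where K': "group K'" and f: "f \<in> iso (K Mod ?T) K'"
      by (rule finite_group_iso_nat[OF gQ fQ])
    define h where "h g = f (?T #>\<^bsub>K\<^esub> g)" for g
    have hh: "h \<in> hom K K'"
      using hom_compose[OF hQ, of f K'] f by (simp add: iso_def h_def[abs_def] comp_def)
    interpret h: group_hom K K' h
      using hh K' by (simp add: group_hom_def group_hom_axioms_def K.is_group)
    have surj: "h ` carrier K = carrier K'"
      using f unfolding iso_def bij_betw_def h_def[abs_def] cQ by (auto simp: image_image)
    have ker: "kernel K K' h = ?T"
    proof -
      have e1: "h g = \<one>\<^bsub>K'\<^esub> \<longleftrightarrow> ?T #>\<^bsub>K\<^esub> g = ?T" if g: "g \<in> carrier K" for g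
      proof -
        have "h g = h \<one>\<^bsub>K\<^esub> \<longleftrightarrow> ?T #>\<^bsub>K\<^esub> g = ?T #>\<^bsub>K\<^esub> \<one>\<^bsub>K\<^esub>"
          unfolding h_def
        proof (rule inj_on_eq_iff)
          show "inj_on f (carrier (K Mod ?T))" using f by (simp add: iso_def bij_betw_def)
          show "?T #>\<^bsub>K\<^esub> g \<in> carrier (K Mod ?T)" unfolding cQ by (rule imageI[OF g])
          show "?T #>\<^bsub>K\<^esub> \<one>\<^bsub>K\<^esub> \<in> carrier (K Mod ?T)" unfolding cQ by (rule imageI[OF K.one_closed])
        qed
        then show ?thesis using h.hom_one K.coset_mult_one[OF T.subset] by simp
      qed
      have e2: "?T #>\<^bsub>K\<^esub> g = ?T \<longleftrightarrow> g \<in> ?T" if g: "g \<in> carrier K" for g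
        by (rule iffI[OF K.coset_join1[OF _ g sT] K.coset_join2[OF g sT]])
      show ?thesis
      proof (rule Set.set_eqI)
        fix g
        show "g \<in> kernel K K' h \<longleftrightarrow> g \<in> ?T"
        proof (cases "g \<in> carrier K")
          case True
          then show ?thesis unfolding kernel_def mem_Collect_eq e1[OF True] e2[OF True] by (simp only: simp_thms)
        next
          case False
          then have "g \<notin> ?T" using T.subset by blast
          then show ?thesis using False unfolding kernel_def mem_Collect_eq by (simp only: simp_thms)
        qed
      qed
    qed
    have cT: "card ?T = 2" using t by simp
    have oK: "order K = 2 * order K'"
      using card_subgroup_image[OF h.group_hom_axioms K.fin K.subgroup_self] ker T.subset surj cT
      by (simp add: order_def)
    have fK': "finite (carrier K')" using K.fin surj by (metis finite_imageI)
    obtain n where n: "order K = 2 ^ n" using K.order_pow by auto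
    have "n \<noteq> 0" using n oK by (metis power_0 odd_one even_mult_iff even_numeral)
    then have "order K' = 2 ^ (n - 1)" using n oK by (cases n) auto
    then have tw: "two_group K'"
      using K' fK' by (auto simp: two_group_def two_group_axioms_def)
    have Dim: "derived K' (carrier K') = h ` ?D"
      using h.derived_img[OF subset_refl] surj by simp
    have "card ?D = 2 * card (derived K' (carrier K'))"
      using card_subgroup_image[OF h.group_hom_axioms K.fin sD] ker cT t(2)
        subgroup.one_closed[OF sD] unfolding Dim by auto
    then have "order K' = 4 * card (derived K' (carrier K'))"
      using oK less.prems(2) by simp
    moreover have "order K' < order K" using oK K.order_gt_0_iff_finite K.fin by simp
    ultimately obtain b where b: "b \<in> carrier K'" "2 * card (generate K' {b}) = order K'"
      using less.hyps tw by blast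
    then obtain a where a: "a \<in> carrier K" "b = h a" using surj by auto
    let ?L = "?T <#>\<^bsub>K\<^esub> generate K {a}"
    have sA: "subgroup (generate K {a}) K" using a by (intro K.generate_is_subgroup) auto
    have sL: "subgroup ?L K" by (rule K.mult_norm_subgroup[OF nT sA])
    have TL: "?T \<subseteq> ?L"
      unfolding set_mult_def using subgroup.one_closed[OF sA] tc by force
    have "h ` ?L = generate K' {b}"
    proof -
      have "h ` ?L = h ` generate K {a}"
      proof
        show "h ` ?L \<subseteq> h ` generate K {a}"
        proof
          fix y assume "y \<in> h ` ?L"
          then obtain e g where e: "e \<in> ?T" "g \<in> generate K {a}" "y = h (e \<otimes>\<^bsub>K\<^esub> g)"
            unfolding set_mult_def by blast
          have "e \<in> carrier K" "g \<in> carrier K" "h e = \<one>\<^bsub>K'\<^esub>"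
            using e ker subgroup.mem_carrier[OF sA] T.subset by (auto simp: kernel_def)
          then show "y \<in> h ` generate K {a}" using e by auto
        qed
        show "h ` generate K {a} \<subseteq> h ` ?L"
        proof (rule image_mono, rule subsetI)
          fix g assume g: "g \<in> generate K {a}"
          then have "g = \<one>\<^bsub>K\<^esub> \<otimes>\<^bsub>K\<^esub> g" using subgroup.mem_carrier[OF sA] by simp
          then show "g \<in> ?L" unfolding set_mult_def using g by blast
        qed
      qed
      then show ?thesis using generate_singleton_image[OF h.group_hom_axioms a(1)] a(2) by simp
    qed
    then have "card ?L = 2 * card (generate K' {b})"
      using card_subgroup_image[OF h.group_hom_axioms K.fin sL] ker cT TL by simp
    then have "2 * card ?L = order K" using b oK by simp
    then show ?thesis
      using K.lift_cyclic_index_two[OF t(1,3,4,2) less.prems(2) a(1)] by blast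
  qed
qed

text \<open>Taussky's theorem.  Factoring out a central involution that lies in the derived subgroup
  preserves the index of the derived subgroup, and a cyclic subgroup of index two in the quotient
  is lifted by \<open>lift_cyclic_index_two\<close>.\<close>

theorem (in two_group) cyclic_index_two:
  assumes "order G = 4 * card (derived G (carrier G))"
  shows "\<exists>b\<in>carrier G. 2 * card (generate G {b}) = order G"
proof -
  obtain K :: "nat monoid" and f where K: "group K" and f: "f \<in> iso G K"
    by (rule finite_group_iso_nat[OF is_group fin])
  interpret f: group_hom G K f
    using K f by (simp add: group_hom_def group_hom_axioms_def is_group iso_def)
  have inj: "inj_on f (carrier G)" and surj: "f ` carrier G = carrier K"
    using f by (auto simp: iso_def bij_betw_def)
  have o: "order K = order G" unfolding order_def surj[symmetric] by (rule card_image[OF inj])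
  have "finite (carrier K)" using fin surj by (metis finite_imageI)
  then have tw: "two_group K" using K order_pow o by (auto simp: two_group_def two_group_axioms_def)
  have "derived K (carrier K) = f ` derived G (carrier G)"
    using f.derived_img[OF subset_refl] surj by simp
  then have "card (derived K (carrier K)) = card (derived G (carrier G))"
    using card_image inj_on_subset[OF inj derived_in_carrier[OF subset_refl]] by metis
  then obtain b where b: "b \<in> carrier K" "2 * card (generate K {b}) = order K"
    using cyclic_index_two_nat[OF tw] assms o by auto
  obtain a where a: "a \<in> carrier G" "b = f a" using b surj by auto
  have "generate G {a} \<subseteq> carrier G" using generate_incl a by auto
  then have "card (generate K {b}) = card (generate G {a})"
    unfolding a(2) generate_singleton_image[OF f.group_hom_axioms a(1)]
    by (intro card_image inj_on_subset[OF inj])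
  then show ?thesis using a b o by auto
qed

section \<open>Groups with cyclic centre and dihedral central quotient\<close>

locale dihedral_rel = two_group G for G (structure) +
  fixes a x z :: 'a and s q :: int
  assumes a_closed [simp]: "a \<in> carrier G" and x_closed [simp]: "x \<in> carrier G"
    and z_center: "z \<in> center G"
    and x_a: "x \<otimes> a = inv a \<otimes> z [^] s \<otimes> x" and x_x: "x \<otimes> x = z [^] q"
begin

lemma z_closed [simp]: "z \<in> carrier G" using z_center by (rule centerD(1))

lemma zpow_center: "z [^] (j::int) \<in> center G"
  by (rule subgroup_int_pow_closed[OF center_subgroup z_center])

lemma zpow_comm: "g \<in> carrier G \<Longrightarrow> z [^] (j::int) \<otimes> g = g \<otimes> z [^] j"
  by (rule centerD(2)[OF zpow_center])

text \<open>The normal form \<open>a^i z^j x^e\<close> with \<open>e\<close> read as 0 or 1.\<close>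

definition el :: "int \<Rightarrow> int \<Rightarrow> bool \<Rightarrow> 'a" where
  "el i j e = a [^] i \<otimes> z [^] j \<otimes> (if e then x else \<one>)"

lemma el_closed [simp]: "el i j e \<in> carrier G"
  by (simp add: el_def)

lemma x_apow: "x \<otimes> a [^] (i::int) = a [^] (- i) \<otimes> z [^] (s * i) \<otimes> x"
proof -
  have "(\<lambda>l. x \<otimes> l \<otimes> inv x) \<in> hom G G"
  proof (rule homI)
    fix l n assume "l \<in> carrier G" "n \<in> carrier G"
    moreover have "(x \<otimes> l \<otimes> inv x) \<otimes> (x \<otimes> n \<otimes> inv x) = x \<otimes> l \<otimes> (inv x \<otimes> x) \<otimes> n \<otimes> inv x"
      using calculation by (simp only: m_assoc m_closed inv_closed x_closed)
    ultimately show "x \<otimes> (l \<otimes> n) \<otimes> inv x = (x \<otimes> l \<otimes> inv x) \<otimes> (x \<otimes> n \<otimes> inv x)"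
      by (simp add: m_assoc)
  qed auto
  then interpret cx: group_hom G G "\<lambda>l. x \<otimes> l \<otimes> inv x" by unfold_locales
  have "x \<otimes> a \<otimes> inv x = inv a \<otimes> z [^] s"
    using x_a by (simp add: m_assoc)
  then have "x \<otimes> a [^] i \<otimes> inv x = (inv a \<otimes> z [^] s) [^] i"
    using cx.hom_int_pow[OF a_closed, of i] by simp
  also have "\<dots> = (inv a) [^] i \<otimes> (z [^] s) [^] i"
    by (intro int_pow_mult_distrib) (simp_all add: zpow_comm)
  also have "\<dots> = a [^] (- i) \<otimes> z [^] (s * i)"
    by (simp add: int_pow_inv int_pow_neg int_pow_pow)
  finally have "x \<otimes> a [^] i \<otimes> inv x = a [^] (- i) \<otimes> z [^] (s * i)" .
  then have "x \<otimes> a [^] i \<otimes> inv x \<otimes> x = a [^] (- i) \<otimes> z [^] (s * i) \<otimes> x" by simp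
  then show ?thesis by (simp add: m_assoc)
qed

lemma apow_zpow_mult:
  "g \<in> carrier G \<Longrightarrow> a [^] (i::int) \<otimes> z [^] (j::int) \<otimes> (a [^] (k::int) \<otimes> z [^] (l::int) \<otimes> g) =
    a [^] (i + k) \<otimes> z [^] (j + l) \<otimes> g"
proof -
  assume g: "g \<in> carrier G"
  have "a [^] i \<otimes> z [^] j \<otimes> (a [^] k \<otimes> z [^] l \<otimes> g) =
      a [^] i \<otimes> (z [^] j \<otimes> a [^] k) \<otimes> z [^] l \<otimes> g"
    using g by (simp only: m_assoc m_closed int_pow_closed a_closed z_closed)
  also have "z [^] j \<otimes> a [^] k = a [^] k \<otimes> z [^] j" by (simp add: zpow_comm)
  also have "a [^] i \<otimes> (a [^] k \<otimes> z [^] j) \<otimes> z [^] l \<otimes> g =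
      (a [^] i \<otimes> a [^] k) \<otimes> (z [^] j \<otimes> z [^] l) \<otimes> g"
    using g by (simp only: m_assoc m_closed int_pow_closed a_closed z_closed)
  finally show ?thesis by (simp add: int_pow_mult)
qed

lemma el_mult:
  "el i j False \<otimes> el k l e = el (i + k) (j + l) e"
  "el i j True \<otimes> el k l False = el (i - k) (j + l + s * k) True"
  "el i j True \<otimes> el k l True = el (i - k) (j + l + s * k + q) False"
proof -
  show "el i j False \<otimes> el k l e = el (i + k) (j + l) e"
    unfolding el_def using apow_zpow_mult by simp
  have *: "el i j True \<otimes> (a [^] k \<otimes> z [^] l \<otimes> g) = a [^] (i - k) \<otimes> z [^] (j + l + s * k) \<otimes> (x \<otimes> g)"
    if g: "g \<in> carrier G" for g
  proof -
    have "el i j True \<otimes> (a [^] k \<otimes> z [^] l \<otimes> g) = a [^] i \<otimes> z [^] j \<otimes> ((x \<otimes> a [^] k) \<otimes> (z [^] l \<otimes> g))"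
      unfolding el_def using g by (simp add: m_assoc)
    also have "\<dots> = a [^] i \<otimes> z [^] j \<otimes> (a [^] (- k) \<otimes> z [^] (s * k) \<otimes> ((x \<otimes> z [^] l) \<otimes> g))"
      unfolding x_apow using g by (simp add: m_assoc)
    also have "x \<otimes> z [^] l = z [^] l \<otimes> x" by (simp add: zpow_comm)
    also have "a [^] (- k) \<otimes> z [^] (s * k) \<otimes> ((z [^] l \<otimes> x) \<otimes> g) =
        a [^] (- k) \<otimes> z [^] (s * k + l) \<otimes> (x \<otimes> g)"
      using g by (simp add: m_assoc int_pow_mult)
    also have "a [^] i \<otimes> z [^] j \<otimes> \<dots> = a [^] (i + (- k)) \<otimes> z [^] (j + (s * k + l)) \<otimes> (x \<otimes> g)"
      using g by (intro apow_zpow_mult) simp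
    finally show ?thesis by (simp add: algebra_simps)
  qed
  show "el i j True \<otimes> el k l False = el (i - k) (j + l + s * k) True"
    using *[of \<one>] by (simp add: el_def)
  have "el i j True \<otimes> el k l True = a [^] (i - k) \<otimes> z [^] (j + l + s * k) \<otimes> z [^] q"
    using *[of x] by (simp add: el_def x_x)
  then show "el i j True \<otimes> el k l True = el (i - k) (j + l + s * k + q) False"
    by (simp add: el_def m_assoc int_pow_mult)
qed

lemma el_zero: "el 0 0 False = \<one>"
  by (simp add: el_def)

lemma el_inv:
  "inv (el i j False) = el (- i) (- j) False"
  "inv (el i j True) = el i (- j - s * i - q) True"
  by (rule inv_equality; simp add: el_mult el_zero)+

lemma el_gens: "el 1 0 False = a" "el 0 1 False = z" "el 0 0 True = x" "el 0 j False = z [^] j"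
  "el i 0 False = a [^] i"
  by (simp_all add: el_def)

lemma range_el_subgroup: "subgroup {g. \<exists>i j e. g = el i j e} G"
proof (rule subgroupI)
  show "{g. \<exists>i j e. g = el i j e} \<subseteq> carrier G" by auto
  show "{g. \<exists>i j e. g = el i j e} \<noteq> {}" by blast
  fix g h assume "g \<in> {g. \<exists>i j e. g = el i j e}" "h \<in> {g. \<exists>i j e. g = el i j e}"
  then obtain i j e k l f where g: "g = el i j e" and h: "h = el k l f" by blast
  show "inv g \<in> {g. \<exists>i j e. g = el i j e}"
    unfolding g by (cases e) (auto simp: el_inv)
  show "g \<otimes> h \<in> {g. \<exists>i j e. g = el i j e}"
    unfolding g h by (cases e; cases f) (auto simp: el_mult)
qed

end

text \<open>The rotation \<open>a\<close> has order \<open>2^m\<close> modulo the centre, \<open>z\<close> generates the centre and has order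
  \<open>2^c\<close>, and \<open>(s, q)\<close> names the family.\<close>

locale dihedral_ext = dihedral_rel +
  fixes m c :: nat
  assumes center_eq: "center G = range (\<lambda>j::int. z [^] j)"
    and elements: "g \<in> carrier G \<Longrightarrow> \<exists>i j e. g = el i j e"
    and apow_center: "a [^] (i::int) \<in> center G \<longleftrightarrow> 2 ^ m dvd i"
    and zpow_one: "z [^] (j::int) = \<one> \<longleftrightarrow> 2 ^ c dvd j"
    and m_pos: "1 \<le> m" and c_pos: "1 \<le> c"
    and x_notin: "x \<noteq> el i j False"
    and apow_eq: "a [^] ((2::int) ^ m) = z [^] (s * 2 ^ (m - 1) + 2 ^ (c - 1))"
    and types: "(s, q) \<in> {(0, 0), (1, 0), (0, 1)}"
begin

definition r :: int where "r = s * 2 ^ (m - 1) + 2 ^ (c - 1)"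

lemma zpow_eq: "z [^] (j::int) = z [^] (l::int) \<longleftrightarrow> 2 ^ c dvd j - l"
proof -
  have "z [^] j = z [^] l \<longleftrightarrow> z [^] (j - l) = \<one>"
    by (simp add: int_pow_diff r_cancel_one' inv_solve_right')
  then show ?thesis by (simp add: zpow_one)
qed

lemma apow_mult: "a [^] (2 ^ m * t :: int) = z [^] (r * t)"
proof -
  have "a [^] (2 ^ m * t :: int) = (a [^] ((2::int) ^ m)) [^] t" by (simp add: int_pow_pow)
  then show ?thesis by (simp add: apow_eq int_pow_pow r_def)
qed

lemma el_eq_False:
  "el i j False = el k l False \<longleftrightarrow> 2 ^ m dvd i - k \<and> 2 ^ c dvd r * ((i - k) div 2 ^ m) + j - l"
proof -
  have "el i j False = el k l False \<longleftrightarrow> el (- k) (- j) False \<otimes> el i j False = el (- k) (- j) False \<otimes> el k l False"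
    by simp
  also have "\<dots> \<longleftrightarrow> a [^] (i - k) = z [^] (l - j)"
    by (simp add: el_mult el_gens)
  also have "\<dots> \<longleftrightarrow> 2 ^ m dvd i - k \<and> 2 ^ c dvd r * ((i - k) div 2 ^ m) + j - l"
  proof (cases "2 ^ m dvd i - k")
    case True
    then have "a [^] (i - k) = z [^] (r * ((i - k) div 2 ^ m))"
      using apow_mult[of "(i - k) div 2 ^ m"] by simp
    then show ?thesis using True by (simp add: zpow_eq algebra_simps)
  next
    case False
    then have "a [^] (i - k) \<notin> center G" by (simp add: apow_center)
    then show ?thesis using False zpow_center by metis
  qed
  finally show ?thesis .
qed

lemma el_True: "el i j True = el i j False \<otimes> x"
  by (simp add: el_def)

lemma el_False_neq_True: "el i j False \<noteq> el k l True"
proof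
  assume "el i j False = el k l True"
  then have "inv (el k l False) \<otimes> el i j False = inv (el k l False) \<otimes> (el k l False \<otimes> x)"
    by (simp add: el_True)
  then have "x = inv (el k l False) \<otimes> el i j False"
    by (simp add: m_assoc[symmetric])
  then have "x = el (- k + i) (- l + j) False" by (simp only: el_inv el_mult)
  then show False using x_notin by blast
qed

lemma el_eq:
  "el i j e = el k l f \<longleftrightarrow>
    e = f \<and> 2 ^ m dvd i - k \<and> 2 ^ c dvd r * ((i - k) div 2 ^ m) + j - l"
proof (cases e; cases f)
  assume "e" "f"
  then show ?thesis
    using el_eq_False[of i j k l] by (simp add: el_True)
next
  assume "\<not> e" "\<not> f"
  then show ?thesis using el_eq_False[of i j k l] by simp
next
  assume "e" "\<not> f"
  then show ?thesis using el_False_neq_True[of k l i j] by auto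
next
  assume "\<not> e" "f"
  then show ?thesis using el_False_neq_True[of i j k l] by auto
qed

lemma card_center: "card (center G) = 2 ^ c"
proof -
  have "center G = (\<lambda>j. z [^] j) ` {0..<(2::int) ^ c}"
  proof
    show "center G \<subseteq> (\<lambda>j. z [^] j) ` {0..<(2::int) ^ c}"
    proof
      fix g assume "g \<in> center G"
      then obtain j :: int where j: "g = z [^] j" using center_eq by auto
      have "g = z [^] (j mod 2 ^ c)" unfolding j zpow_eq by (simp add: minus_mod_eq_mult_div)
      then show "g \<in> (\<lambda>j. z [^] j) ` {0..<(2::int) ^ c}" by simp
    qed
  qed (auto simp: center_eq)
  moreover have "inj_on (\<lambda>j. z [^] j) {0..<(2::int) ^ c}"
  proof (rule inj_onI)
    fix j l :: int assume "j \<in> {0..<2 ^ c}" "l \<in> {0..<2 ^ c}" "z [^] j = z [^] l"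
    then have "2 ^ c dvd j - l" "0 \<le> j" "j < 2 ^ c" "0 \<le> l" "l < 2 ^ c" by (simp_all add: zpow_eq)
    then show "j = l" by (metis mod_eq_dvd_iff mod_pos_pos_trivial)
  qed
  ultimately show ?thesis by (simp add: card_image nat_power_eq)
qed

lemma el_reduce:
  "el i j e = el (i mod 2 ^ m) ((j + r * (i div 2 ^ m)) mod 2 ^ c) e"
proof -
  have "i - i mod 2 ^ m = 2 ^ m * (i div 2 ^ m)" by (simp add: minus_mod_eq_mult_div)
  then have "(i - i mod 2 ^ m) div 2 ^ m = i div 2 ^ m" by simp
  moreover have "2 ^ c dvd r * (i div 2 ^ m) + j - (j + r * (i div 2 ^ m)) mod 2 ^ c"
    by (simp add: add.commute minus_mod_eq_mult_div)
  ultimately show ?thesis unfolding el_eq by (simp add: minus_mod_eq_mult_div)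
qed

lemma order_eq: "order G = 2 ^ (m + c + 1)"
proof -
  let ?S = "{0..<(2::int) ^ m} \<times> {0..<(2::int) ^ c} \<times> (UNIV :: bool set)"
  let ?f = "\<lambda>(i, j, e). el i j e"
  have "carrier G = ?f ` ?S"
  proof
    show "carrier G \<subseteq> ?f ` ?S"
    proof
      fix g assume "g \<in> carrier G"
      then obtain i j e where "g = el i j e" using elements by blast
      then have "g = ?f (i mod 2 ^ m, (j + r * (i div 2 ^ m)) mod 2 ^ c, e)"
        using el_reduce by simp
      then show "g \<in> ?f ` ?S" by (rule image_eqI) simp
    qed
  qed auto
  moreover have "inj_on ?f ?S"
  proof (rule inj_onI)
    fix u v assume uv: "u \<in> ?S" "v \<in> ?S" "?f u = ?f v"
    obtain i j e k l f where u: "u = (i, j, e)" and v: "v = (k, l, f)" by (metis prod_cases3)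
    have b: "0 \<le> i" "i < 2 ^ m" "0 \<le> k" "k < 2 ^ m" "0 \<le> j" "j < 2 ^ c" "0 \<le> l" "l < 2 ^ c"
      using uv u v by auto
    have e: "e = f" "2 ^ m dvd i - k" "2 ^ c dvd r * ((i - k) div 2 ^ m) + j - l"
      using uv(3) by (simp_all add: u v el_eq)
    have ik: "i = k" using b e(2) by (metis mod_eq_dvd_iff mod_pos_pos_trivial)
    then have "2 ^ c dvd j - l" using e(3) by simp
    then have "j = l" using b by (metis mod_eq_dvd_iff mod_pos_pos_trivial)
    then show "u = v" using u v e ik by simp
  qed
  ultimately have "order G = card ?S" by (simp add: order_def card_image)
  also have "\<dots> = 2 ^ (m + c + 1)" by (simp add: card_cartesian_product nat_power_eq power_add)
  finally show ?thesis .
qed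

end

text \<open>The rules for multiplying and comparing normal forms mention only the parameters \<open>s\<close>, \<open>q\<close>, \<open>m\<close>
  and \<open>c\<close>.\<close>

theorem dihedral_ext_iso:
  assumes "dihedral_ext G a x z s q m c" and "dihedral_ext H a' x' z' s q m c"
  shows "G \<cong> H"
proof -
  interpret G: dihedral_ext G a x z s q m c by fact
  interpret H: dihedral_ext H a' x' z' s q m c by fact
  have same: "G.el i j e = G.el k l f \<longleftrightarrow> H.el i j e = H.el k l f" for i j e k l f
    by (simp only: G.el_eq H.el_eq)
  define h where "h g = (SOME y. \<exists>i j e. g = G.el i j e \<and> y = H.el i j e)" for g
  have h: "h (G.el i j e) = H.el i j e" for i j e
  proof -
    have "\<exists>k l f. G.el i j e = G.el k l f \<and> h (G.el i j e) = H.el k l f"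
      unfolding h_def by (rule someI_ex) blast
    then show ?thesis using same by metis
  qed
  have "h \<in> iso G H"
  proof (rule isoI)
    show "h \<in> hom G H"
    proof (rule homI)
      fix g assume "g \<in> carrier G"
      then obtain i j e where "g = G.el i j e" using G.elements by blast
      then show "h g \<in> carrier H" by (simp add: h)
    next
      fix g g' assume gg: "g \<in> carrier G" "g' \<in> carrier G"
      obtain i j e where g: "g = G.el i j e" using G.elements[OF gg(1)] by blast
      obtain k l f where g': "g' = G.el k l f" using G.elements[OF gg(2)] by blast
      show "h (g \<otimes>\<^bsub>G\<^esub> g') = h g \<otimes>\<^bsub>H\<^esub> h g'"
        unfolding g g' by (cases e; cases f) (simp_all add: G.el_mult H.el_mult h)
    qed
    show "bij_betw h (carrier G) (carrier H)"
      unfolding bij_betw_def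
    proof
      show "inj_on h (carrier G)"
      proof (rule inj_onI)
        fix g g' assume gg: "g \<in> carrier G" "g' \<in> carrier G" and eq: "h g = h g'"
        obtain i j e where g: "g = G.el i j e" using G.elements[OF gg(1)] by blast
        obtain k l f where g': "g' = G.el k l f" using G.elements[OF gg(2)] by blast
        show "g = g'" using eq unfolding g g' h same .
      qed
      show "h ` carrier G = carrier H"
      proof
        show "h ` carrier G \<subseteq> carrier H"
        proof
          fix y assume "y \<in> h ` carrier G"
          then obtain g where "g \<in> carrier G" "y = h g" by blast
          then show "y \<in> carrier H" using G.elements[of g] by (auto simp: h)
        qed
        show "carrier H \<subseteq> h ` carrier G"
        proof
          fix y assume "y \<in> carrier H"
          then obtain i j e where "y = H.el i j e" using H.elements by blast
          then have "y = h (G.el i j e)" by (simp add: h)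
          then show "y \<in> h ` carrier G" by (rule image_eqI) simp
        qed
      qed
    qed
  qed
  then show ?thesis by (auto simp: is_iso_def)
qed


context dihedral_rel
begin

text \<open>Conjugation by \<open>x\<close> inverts \<open>a\<close> only up to the factor \<open>z^s\<close>.  An even power of \<open>a\<close> can absorb
  half of this factor.\<close>

lemma apow_twisted_inverse:
  "x \<otimes> (a [^] (2 * i :: int) \<otimes> z [^] (- (s * i))) = inv (a [^] (2 * i) \<otimes> z [^] (- (s * i))) \<otimes> x"
proof -
  have "el 0 0 True \<otimes> el (2 * i) (- (s * i)) False = inv (el (2 * i) (- (s * i)) False) \<otimes> el 0 0 True"
    by (simp add: el_mult el_inv mult.commute)
  then show ?thesis by (simp add: el_def)
qed

lemma central_if_commutes:
  assumes el: "\<And>g. g \<in> carrier G \<Longrightarrow> \<exists>i j e. g = el i j e"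
    and g: "g \<in> carrier G" "a \<otimes> g = g \<otimes> a" "x \<otimes> g = g \<otimes> x"
  shows "g \<in> center G"
proof (rule centerI[OF g(1)])
  define U where "U = {h \<in> carrier G. g \<otimes> h = h \<otimes> g}"
  have U: "subgroup U G"
  proof (rule subgroupI)
    show "U \<noteq> {}" using g(1) by (auto simp: U_def)
    fix h assume h: "h \<in> U"
    then have hc: "h \<in> carrier G" "g \<otimes> h = h \<otimes> g" by (auto simp: U_def)
    have "h \<otimes> g \<otimes> inv h = g" using hc(1) g(1) by (simp add: hc(2)[symmetric] m_assoc)
    then have "inv h \<otimes> g = inv h \<otimes> (h \<otimes> g \<otimes> inv h)" by simp
    also have "\<dots> = g \<otimes> inv h" using hc(1) g(1) by (simp add: m_assoc[symmetric])
    finally have "g \<otimes> inv h = inv h \<otimes> g" by simp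
    then show "inv h \<in> U" using hc by (simp add: U_def)
    fix k assume "k \<in> U"
    then have kc: "k \<in> carrier G" "g \<otimes> k = k \<otimes> g" by (auto simp: U_def)
    have "g \<otimes> (h \<otimes> k) = h \<otimes> (g \<otimes> k)" using hc kc(1) g(1) by (simp add: m_assoc[symmetric])
    also have "\<dots> = h \<otimes> k \<otimes> g" using hc(1) kc g(1) by (simp add: m_assoc)
    finally show "h \<otimes> k \<in> U" using hc kc by (simp add: U_def)
  qed (auto simp: U_def)
  have aU: "a \<in> U" and xU: "x \<in> U" using g by (auto simp: U_def)
  have zU: "z [^] (j::int) \<in> U" for j using zpow_comm[OF g(1), of j] by (simp add: U_def)
  have elU: "el i j e \<in> U" for i j e
    unfolding el_def using subgroup_int_pow_closed[OF U aU] zU xU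
    by (auto intro!: subgroup.m_closed[OF U])
  fix h assume "h \<in> carrier G"
  then obtain i j e where "h = el i j e" using el by blast
  then show "g \<otimes> h = h \<otimes> g" using elU by (simp add: U_def)
qed

end

context two_group
begin

text \<open>The value of \<open>a^(2^m)\<close> is forced as follows.  Conjugation by \<open>x\<close> inverts
  \<open>w i = a^(2 i) z^(- s i)\<close>.  For \<open>i = 2^(m - 1)\<close> this element is central, so its square is 1.  It
  is not 1 itself, since then \<open>a^(2^(m - 1))\<close> would be central, against the choice of \<open>m\<close>.  The
  only involution in the centre is \<open>z^(2^(c - 1))\<close>.\<close>

lemma dihedral_ext_of_pair:
  assumes zc: "z \<in> carrier G" and center_eq: "center G = range (\<lambda>j::int. z [^] j)"
    and x: "x \<in> carrier G" and y: "y \<in> carrier G"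
    and xx: "x \<otimes> x = z [^] q" and yy: "y \<otimes> y = z [^] q'"
    and qq: "(q, q') \<in> {(0::int, 0::int), (0, 1), (1, 1)}"
    and gen: "\<And>U. subgroup U G \<Longrightarrow> x \<in> U \<Longrightarrow> y \<in> U \<Longrightarrow> center G \<subseteq> U \<Longrightarrow> U = carrier G"
    and nonab: "center G \<noteq> carrier G"
  shows "\<exists>a m c. dihedral_ext G a x z (q + q' - 2 * (q * q')) q m c"
proof -
  \<comment> \<open>the factor \<open>z^(- k)\<close> in \<open>a\<close> makes \<open>s\<close> vanish if both squares are \<open>z\<close>\<close>
  define k where "k = q * q'"
  define s where "s = q + q' - 2 * k"
  define a where "a = x \<otimes> y \<otimes> z [^] (- k)"
  have ac: "a \<in> carrier G" using x y zc by (simp add: a_def)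
  have zZ: "z \<in> center G" unfolding center_eq using zc by (metis int_pow_1 rangeI)
  have zcomm: "z [^] (j::int) \<otimes> g = g \<otimes> z [^] j" if "g \<in> carrier G" for g j
    by (rule centerD(2)[OF subgroup_int_pow_closed[OF center_subgroup zZ] that])
  have "a \<otimes> (x \<otimes> a) = z [^] s \<otimes> x"
  proof -
    have "a \<otimes> (x \<otimes> a) = x \<otimes> y \<otimes> (z [^] (- k) \<otimes> (x \<otimes> x)) \<otimes> y \<otimes> z [^] (- k)"
      using x y zc by (simp add: a_def m_assoc)
    also have "z [^] (- k) \<otimes> (x \<otimes> x) = z [^] (- k + q)"
      unfolding xx by (rule int_pow_mult[OF zc, symmetric])
    also have "x \<otimes> y \<otimes> z [^] (- k + q) \<otimes> y \<otimes> z [^] (- k) = x \<otimes> (y \<otimes> (z [^] (- k + q) \<otimes> y) \<otimes> z [^] (- k))"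
      using x y zc by (simp add: m_assoc)
    also have "z [^] (- k + q) \<otimes> y = y \<otimes> z [^] (- k + q)" by (rule zcomm[OF y])
    also have "y \<otimes> (y \<otimes> z [^] (- k + q)) \<otimes> z [^] (- k) = (y \<otimes> y) \<otimes> (z [^] (- k + q) \<otimes> z [^] (- k))"
      using y zc by (simp add: m_assoc)
    also have "\<dots> = z [^] (q' + (- k + q + - k))"
      unfolding yy by (simp only: int_pow_mult[OF zc, symmetric])
    also have "q' + (- k + q + - k) = s" by (simp add: s_def)
    finally show ?thesis using zcomm[OF x] by simp
  qed
  then have "x \<otimes> a = inv a \<otimes> (z [^] s \<otimes> x)"
    using inv_solve_left[of "x \<otimes> a" a "z [^] s \<otimes> x"] ac x zc by simp
  then have xa: "x \<otimes> a = inv a \<otimes> z [^] s \<otimes> x" using ac x zc by (simp add: m_assoc)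
  interpret D: dihedral_rel G a x z s q
    by unfold_locales (use ac x zZ xa xx in auto)
  let ?E = "{g. \<exists>i j e. g = D.el i j e}"
  have "?E = carrier G"
  proof (rule gen[OF D.range_el_subgroup])
    have elE: "D.el i j e \<in> ?E" for i j e by blast
    show xE: "x \<in> ?E" using elE[of 0 0 True] unfolding D.el_gens(3) .
    have aE: "a \<in> ?E" using elE[of 1 0 False] unfolding D.el_gens(1) .
    have zE: "z [^] (j::int) \<in> ?E" for j using elE[of 0 j False] unfolding D.el_gens(4) .
    then show "center G \<subseteq> ?E" unfolding center_eq by blast
    have "inv x \<otimes> a \<otimes> z [^] k = inv x \<otimes> x \<otimes> y \<otimes> (z [^] (- k) \<otimes> z [^] k)"
      using x y zc by (simp only: a_def m_assoc m_closed inv_closed int_pow_closed)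
    also have "z [^] (- k) \<otimes> z [^] k = \<one>" by (simp only: int_pow_mult[OF zc, symmetric]) simp
    also have "inv x \<otimes> x \<otimes> y \<otimes> \<one> = y" using x y by simp
    finally have ye: "inv x \<otimes> a \<otimes> z [^] k = y" .
    show "y \<in> ?E"
      using subgroup.m_closed[OF D.range_el_subgroup subgroup.m_closed[OF D.range_el_subgroup
            subgroup.m_inv_closed[OF D.range_el_subgroup xE] aE] zE[of k]] unfolding ye .
  qed
  then have elements: "\<exists>i j e. g = D.el i j e" if "g \<in> carrier G" for g using that by blast
  note central = D.central_if_commutes[OF elements]
  have a_notin: "a \<notin> center G"
  proof
    assume aZ: "a \<in> center G"
    have "x \<in> center G" using centerD(2)[OF aZ x] by (intro central) (auto simp: x)
    then have "D.el i j e \<in> center G" for i j e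
      unfolding D.el_def using subgroup_int_pow_closed[OF center_subgroup aZ] D.zpow_center
        subgroup.one_closed[OF center_subgroup]
      by (auto intro!: subgroup.m_closed[OF center_subgroup])
    then have "carrier G \<subseteq> center G" using elements by (metis subsetI)
    then show False using nonab center_subset by auto
  qed
  have acomm: "a \<otimes> (a [^] (i::int) \<otimes> z [^] (j::int)) = (a [^] i \<otimes> z [^] j) \<otimes> a" for i j
  proof -
    have "D.el 1 0 False \<otimes> D.el i j False = D.el i j False \<otimes> D.el 1 0 False"
      by (simp only: D.el_mult add.commute)
    then show ?thesis using ac zc by (simp add: D.el_def)
  qed
  obtain n0 where n0: "order G = 2 ^ n0" using order_pow by auto
  have "a [^] (2 ^ n0 :: nat) = \<one>" using pow_order_eq_1[OF ac] n0 by simp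
  then have ex: "a [^] (2 ^ n0 :: nat) \<in> center G" using subgroup.one_closed[OF center_subgroup] by simp
  \<comment> \<open>the order of \<open>a\<close> modulo the centre is \<open>2^m\<close>\<close>
  define m where "m = (LEAST n. a [^] (2 ^ n :: nat) \<in> center G)"
  have m: "a [^] (2 ^ m :: nat) \<in> center G" unfolding m_def by (rule LeastI[of _ n0]) (rule ex)
  have m_least: "m \<le> n" if "a [^] (2 ^ n :: nat) \<in> center G" for n
    unfolding m_def using that by (rule Least_le)
  have m_pos: "1 \<le> m"
  proof (rule ccontr)
    assume "\<not> 1 \<le> m"
    then have "m = 0" by simp
    then show False using m a_notin ac by simp
  qed
  have m': "a [^] ((2::int) ^ m) \<in> center G"
    using m by (simp add: int_pow_int[of G a "2 ^ m", symmetric])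
  have apow_center: "a [^] (i::int) \<in> center G \<longleftrightarrow> 2 ^ m dvd i" for i
  proof
    assume i: "a [^] i \<in> center G"
    let ?d = "gcd i (2 ^ m)"
    obtain u v where uv: "u * i + v * 2 ^ m = ?d" using bezout_int by blast
    have e: "a [^] (u * i + v * 2 ^ m) = (a [^] i) [^] u \<otimes> (a [^] ((2::int) ^ m)) [^] v"
      using ac by (simp add: int_pow_mult int_pow_pow mult.commute)
    have "a [^] (u * i + v * 2 ^ m) \<in> center G"
      unfolding e by (rule subgroup.m_closed[OF center_subgroup subgroup_int_pow_closed[OF center_subgroup i]
          subgroup_int_pow_closed[OF center_subgroup m']])
    then have dZ: "a [^] ?d \<in> center G" by (simp only: uv)
    have "nat ?d dvd 2 ^ m" by (simp add: nat_dvd_iff)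
    then obtain l where l: "l \<le> m" "nat ?d = 2 ^ l"
      using divides_primepow_nat[OF two_is_prime_nat] by blast
    have "?d = int (2 ^ l)" using l(2) by (metis gcd_ge_0_int int_nat_eq)
    then have "a [^] (2 ^ l :: nat) \<in> center G" using dZ by (simp only: int_pow_int)
    then have "m \<le> l" by (rule m_least)
    then have "?d = 2 ^ m" using l \<open>?d = int (2 ^ l)\<close> by simp
    then show "2 ^ m dvd i" by (metis gcd_dvd1)
  next
    assume "2 ^ m dvd i"
    then obtain t where "i = 2 ^ m * t" by auto
    then have "a [^] i = (a [^] ((2::int) ^ m)) [^] t" using ac by (simp add: int_pow_pow)
    then show "a [^] i \<in> center G" using subgroup_int_pow_closed[OF center_subgroup m'] by simp
  qed
  have x_notin: "x \<noteq> D.el i j False" for i j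
  proof
    assume xe: "x = D.el i j False"
    have "a \<otimes> D.el i j False = D.el i j False \<otimes> a" using acomm ac zc by (simp add: D.el_def)
    then have "a \<otimes> x = x \<otimes> a" by (simp only: xe[symmetric])
    then have "a \<in> center G" using ac by (intro central) auto
    then show False using a_notin by simp
  qed
  obtain c where c: "ord z = 2 ^ c" using dvd_order_imp_pow ord_dvd_group_order[OF zc] by blast
  have zpow_one: "z [^] (j::int) = \<one> \<longleftrightarrow> 2 ^ c dvd j" for j
    using int_pow_eq_id[OF zc] c by simp
  define w where "w i = a [^] (2 * i :: int) \<otimes> z [^] (- (s * i))" for i
  have wc: "w i \<in> carrier G" for i using ac zc by (simp add: w_def)
  have wx: "x \<otimes> w i = inv (w i) \<otimes> x" for i unfolding w_def by (rule D.apow_twisted_inverse)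
  have ww: "w i \<otimes> w i = w (2 * i)" for i
  proof -
    have "D.el (2 * i) (- (s * i)) False \<otimes> D.el (2 * i) (- (s * i)) False = D.el (2 * (2 * i)) (- (s * (2 * i))) False"
      by (simp add: D.el_mult algebra_simps)
    then show ?thesis using ac zc by (simp add: w_def D.el_def)
  qed
  have w_central: "w i \<in> center G" if "w i \<otimes> w i = \<one>" for i
  proof -
    have "inv (w i) = w i" using that wc by (simp add: inv_equality)
    then have "x \<otimes> w i = w i \<otimes> x" using wx by simp
    moreover have "a \<otimes> w i = w i \<otimes> a" unfolding w_def by (rule acomm)
    ultimately show ?thesis using wc by (intro central) auto
  qed
  have apow_w: "a [^] (2 * i :: int) = w i \<otimes> z [^] (s * i)" for i
    using ac zc by (simp add: w_def m_assoc int_pow_mult[symmetric])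
  have wZ: "a [^] (2 * i :: int) \<in> center G" if "w i \<in> center G" for i
    unfolding apow_w using that D.zpow_center by (intro subgroup.m_closed[OF center_subgroup])
  define i1 :: int where "i1 = 2 ^ (m - 1)"
  have i1: "2 * i1 = 2 ^ m" using m_pos by (simp add: i1_def power_eq_if)
  have w1: "w i1 \<in> center G"
    unfolding w_def i1 using m' D.zpow_center by (intro subgroup.m_closed[OF center_subgroup])
  have w1w1: "w i1 \<otimes> w i1 = \<one>"
  proof -
    have "inv (w i1) \<otimes> x = w i1 \<otimes> x" using wx centerD(2)[OF w1 x] by simp
    then have "inv (w i1) = w i1" using wc x by simp
    then show ?thesis using wc[of i1] by (metis r_inv)
  qed
  have w1_ne: "w i1 \<noteq> \<one>"
  proof
    assume w1_one: "w i1 = \<one>"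
    show False
    proof (cases "m = 1")
      case True
      then have "a [^] (2::int) = z [^] s" using apow_w[of 1] w1_one zc by (simp add: i1_def)
      then have "a \<otimes> a = z [^] s"
        using ac int_pow_mult[OF ac, of 1 1] by simp
      then have "inv a \<otimes> z [^] s = a" using ac by (simp add: m_assoc[symmetric] flip: \<open>a \<otimes> a = z [^] s\<close>)
      then have "x \<otimes> a = a \<otimes> x" using xa by simp
      then have "a \<in> center G" using ac by (intro central) auto
      then show False using a_notin by simp
    next
      case False
      define i2 :: int where "i2 = 2 ^ (m - 2)"
      have i2: "2 * i2 = 2 ^ (m - 1)" using False m_pos
        by (simp add: i2_def flip: power_Suc)
      have "w i2 \<otimes> w i2 = \<one>" unfolding ww using w1_one i2 by (simp add: i1_def)
      then have "a [^] (2 * i2) \<in> center G" using w_central wZ by blast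
      then have "2 ^ m dvd (2::int) ^ (m - 1)" unfolding i2 apow_center .
      then have "(2::int) ^ m \<le> 2 ^ (m - 1)" by (rule zdvd_imp_le) simp
      then have "m \<le> m - 1" by simp
      then show False using m_pos by simp
    qed
  qed
  obtain j :: int where j: "w i1 = z [^] j" using w1 center_eq by auto
  have "z [^] (j + j) = \<one>" using w1w1 unfolding j int_pow_mult[OF zc] .
  then have d1: "2 ^ c dvd 2 * j" unfolding zpow_one by (simp only: mult_2)
  have d2: "\<not> 2 ^ c dvd j" using w1_ne unfolding j zpow_one .
  have c_pos: "1 \<le> c" using d2 by (cases c) auto
  have c2: "(2::int) ^ c = 2 * 2 ^ (c - 1)" using c_pos by (simp add: power_eq_if)
  obtain t where t: "j = 2 ^ (c - 1) * t" using d1 unfolding c2 by auto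
  have "odd t" using d2 unfolding t c2 by auto
  then obtain u where "t = 2 * u + 1" by (rule oddE)
  then have "j - 2 ^ (c - 1) = 2 ^ c * u" unfolding t c2 by (simp add: algebra_simps)
  then have "z [^] (j - 2 ^ (c - 1)) = \<one>" unfolding zpow_one by simp
  then have zj: "z [^] j = z [^] ((2::int) ^ (c - 1))"
    using zc int_pow_mult[OF zc, of "j - 2 ^ (c - 1)" "2 ^ (c - 1)"] by simp
  have apow_eq: "a [^] ((2::int) ^ m) = z [^] (s * 2 ^ (m - 1) + 2 ^ (c - 1))"
    using apow_w[of i1] zc unfolding i1 j zj
    by (simp add: i1_def int_pow_mult[symmetric] add.commute)
  have "dihedral_ext G a x z s q m c"
    by unfold_locales
      (use center_eq elements apow_center zpow_one m_pos c_pos x_notin apow_eq qq in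
        \<open>auto simp: s_def k_def\<close>)
  then show ?thesis unfolding s_def k_def by blast
qed


text \<open>A central factor \<open>z^k\<close> changes the exponent of the square of a lift by \<open>2 k\<close>, so both exponents
  can be made 0 or 1.  Exchanging the lifts avoids the case \<open>(1, 0)\<close>.\<close>

lemma dihedral_ext_exists:
  assumes zc: "z \<in> carrier G" and center_eq: "center G = range (\<lambda>j::int. z [^] j)"
    and x: "x \<in> carrier G" and y: "y \<in> carrier G"
    and xx: "x \<otimes> x \<in> center G" and yy: "y \<otimes> y \<in> center G"
    and gen: "\<And>U. subgroup U G \<Longrightarrow> x \<in> U \<Longrightarrow> y \<in> U \<Longrightarrow> center G \<subseteq> U \<Longrightarrow> U = carrier G"
    and nonab: "center G \<noteq> carrier G"
  shows "\<exists>a x z s q m c. dihedral_ext G a x z s q m c"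
proof -
  have zZ: "z [^] (j::int) \<in> center G" for j unfolding center_eq by simp
  have normalise: "\<exists>u q. u \<in> carrier G \<and> u \<otimes> u = z [^] (q::int) \<and> q \<in> {0, 1} \<and>
      (\<exists>j::int. v = u \<otimes> z [^] j)" if v: "v \<in> carrier G" "v \<otimes> v \<in> center G" for v
  proof -
    obtain i :: int where i: "v \<otimes> v = z [^] i" using v center_eq by auto
    define u where "u = v \<otimes> z [^] (- (i div 2))"
    have "u \<otimes> u = v \<otimes> (z [^] (- (i div 2)) \<otimes> v) \<otimes> z [^] (- (i div 2))"
      using v zc by (simp add: u_def m_assoc)
    also have "\<dots> = (v \<otimes> v) \<otimes> (z [^] (- (i div 2)) \<otimes> z [^] (- (i div 2)))"
      using v zc centerD(2)[OF zZ v(1)] by (simp add: m_assoc)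
    also have "\<dots> = z [^] (i + (- (i div 2) + - (i div 2)))"
      unfolding i by (simp only: int_pow_mult[OF zc, symmetric])
    also have "i + (- (i div 2) + - (i div 2)) = i mod 2" by (simp add: minus_div_mult_eq_mod[symmetric])
    finally have uu: "u \<otimes> u = z [^] (i mod 2)" .
    have "u \<otimes> z [^] (i div 2) = v \<otimes> (z [^] (- (i div 2)) \<otimes> z [^] (i div 2))"
      unfolding u_def using v zc by (simp add: m_assoc)
    also have "\<dots> = v" using v zc by (simp add: int_pow_mult[symmetric])
    finally have ve: "v = u \<otimes> z [^] (i div 2)" by (rule sym)
    show ?thesis
    proof (rule exI[of _ u], rule exI[of _ "i mod 2"], intro conjI)
      show "u \<in> carrier G" using v zc by (simp add: u_def)
      show "i mod 2 \<in> {0, 1}" by auto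
      show "\<exists>j::int. v = u \<otimes> z [^] j" by (rule exI[of _ "i div 2"]) (rule ve)
    qed (rule uu)
  qed
  obtain u q j where u: "u \<in> carrier G" "u \<otimes> u = z [^] (q::int)" "q \<in> {0, 1}" "x = u \<otimes> z [^] (j::int)"
    using normalise[OF x xx] by blast
  obtain w q' k where w: "w \<in> carrier G" "w \<otimes> w = z [^] (q'::int)" "q' \<in> {0, 1}" "y = w \<otimes> z [^] (k::int)"
    using normalise[OF y yy] by blast
  have gen': "U = carrier G" if "subgroup U G" "u \<in> U" "w \<in> U" "center G \<subseteq> U" for U
  proof (rule gen[OF that(1) _ _ that(4)])
    show "x \<in> U" unfolding u(4) using that zZ by (blast intro: subgroup.m_closed)
    show "y \<in> U" unfolding w(4) using that zZ by (blast intro: subgroup.m_closed)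
  qed
  show ?thesis
  proof (cases "q = 1 \<and> q' = 0")
    case True
    \<comment> \<open>the lifts are exchanged\<close>
    have "\<exists>a m c. dihedral_ext G a w z (q' + q - 2 * (q' * q)) q' m c"
      using True w u gen' nonab by (intro dihedral_ext_of_pair[OF zc center_eq]) auto
    then show ?thesis by blast
  next
    case False
    have "\<exists>a m c. dihedral_ext G a u z (q + q' - 2 * (q * q')) q m c"
      using False w u gen' nonab by (intro dihedral_ext_of_pair[OF zc center_eq]) auto
    then show ?thesis by blast
  qed
qed

lemma central_quotient_hom: "group_hom G (G Mod center G) (\<lambda>g. center G #> g)"
proof -
  interpret Z: normal "center G" G by (rule center_normal)
  show ?thesis
    using Z.factorgroup_is_group Z.r_coset_hom_Mod is_group
    by (simp add: group_hom_def group_hom_axioms_def)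
qed

lemma central_quotient_kernel: "kernel G (G Mod center G) (\<lambda>g. center G #> g) = center G"
proof
  show "kernel G (G Mod center G) (\<lambda>g. center G #> g) \<subseteq> center G"
  proof
    fix g assume "g \<in> kernel G (G Mod center G) (\<lambda>g. center G #> g)"
    then have "g \<in> carrier G" "center G #> g = center G" by (simp_all add: kernel_def)
    then show "g \<in> center G" using coset_join1[OF _ _ center_subgroup] by blast
  qed
  show "center G \<subseteq> kernel G (G Mod center G) (\<lambda>g. center G #> g)"
  proof
    fix g assume g: "g \<in> center G"
    then have "center G #> g = center G" using coset_join2[OF centerD(1)[OF g] center_subgroup] by blast
    then show "g \<in> kernel G (G Mod center G) (\<lambda>g. center G #> g)"
      using centerD(1)[OF g] by (simp add: kernel_def)
  qed
qed

lemma pair_of_dihedral_quotient: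
  assumes "dihedral (G Mod center G)"
  shows "\<exists>x y. x \<in> carrier G \<and> y \<in> carrier G \<and> x \<otimes> x \<in> center G \<and> y \<otimes> y \<in> center G \<and>
    (\<forall>U. subgroup U G \<longrightarrow> x \<in> U \<longrightarrow> y \<in> U \<longrightarrow> center G \<subseteq> U \<longrightarrow> U = carrier G)"
    and "center G \<noteq> carrier G"
proof -
  let ?K = "G Mod center G" and ?p = "\<lambda>g. center G #> g"
  interpret p: group_hom G ?K ?p by (rule central_quotient_hom)
  have cK: "carrier ?K = ?p ` carrier G" by (rule carrier_FactGroup)
  obtain X Y where XY: "X \<in> carrier ?K" "Y \<in> carrier ?K" "X \<noteq> Y" "p.H.ord X = 2" "p.H.ord Y = 2"
    "generate ?K {X, Y} = carrier ?K" using assms by (auto simp: dihedral_def)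
  obtain x where x: "x \<in> carrier G" "X = ?p x" using XY(1) cK by blast
  obtain y where y: "y \<in> carrier G" "Y = ?p y" using XY(2) cK by blast
  have sq: "v \<otimes> v \<in> center G" if v: "v \<in> carrier G" and o: "p.H.ord (?p v) = 2" for v
  proof -
    have pv: "?p v \<in> carrier ?K" using v by (rule p.hom_closed)
    have "?p (v \<otimes> v) = ?p v \<otimes>\<^bsub>?K\<^esub> ?p v" using v by (intro p.hom_mult)
    also have "\<dots> = ?p v [^]\<^bsub>?K\<^esub> (2::nat)" using pv p.H.nat_pow_Suc p.H.nat_pow_0 p.H.l_one numeral_2_eq_2 by metis
    also have "\<dots> = \<one>\<^bsub>?K\<^esub>" using p.H.pow_ord_eq_1[OF pv] o by simp
    finally have "v \<otimes> v \<in> kernel G ?K ?p" using v by (simp only: kernel_def mem_Collect_eq m_closed simp_thms)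
    then show ?thesis unfolding central_quotient_kernel .
  qed
  have "U = carrier G" if U: "subgroup U G" "x \<in> U" "y \<in> U" "center G \<subseteq> U" for U
  proof
    show "U \<subseteq> carrier G" by (rule subgroup.subset[OF U(1)])
    show "carrier G \<subseteq> U"
    proof
      fix g assume g: "g \<in> carrier G"
      have sU: "subgroup (?p ` U) ?K" by (rule p.subgroup_img_is_subgroup[OF U(1)])
      have "generate ?K {X, Y} \<subseteq> ?p ` U"
        by (rule p.H.generate_subgroup_incl[OF _ sU]) (use U x y in blast)
      then have "?p g \<in> ?p ` U" using p.hom_closed[OF g] XY(6) by blast
      then obtain u where u: "u \<in> U" "?p g = ?p u" by blast
      have uc: "u \<in> carrier G" using subgroup.mem_carrier[OF U(1) u(1)] .
      have "g \<in> ?p u" using rcos_self[OF g center_subgroup] u(2) by simp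
      then obtain h where "h \<in> center G" "g = h \<otimes> u" by (auto simp: r_coset_def)
      then show "g \<in> U" using U u subgroup.m_closed[OF U(1)] by blast
    qed
  qed
  then show "\<exists>x y. x \<in> carrier G \<and> y \<in> carrier G \<and> x \<otimes> x \<in> center G \<and> y \<otimes> y \<in> center G \<and>
    (\<forall>U. subgroup U G \<longrightarrow> x \<in> U \<longrightarrow> y \<in> U \<longrightarrow> center G \<subseteq> U \<longrightarrow> U = carrier G)"
    using x y sq XY(4,5) by blast
  show "center G \<noteq> carrier G"
  proof
    assume e: "center G = carrier G"
    have "?p g = center G" if "g \<in> carrier G" for g
      using coset_join2[OF that center_subgroup] that e by simp
    then show False using x y XY(3) by simp
  qed
qed

text \<open>By \<open>cyclic_index_two\<close> the central quotient has a cyclic subgroup of index two, and its preimage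
  \<open>L\<close> is abelian.  If \<open>y\<close> lies outside \<open>L\<close>, then \<open>y^2\<close> lies in \<open>L\<close> and commutes with \<open>L\<close> and with
  \<open>y\<close>, which together generate the group.  So all elements outside \<open>L\<close> have central squares.\<close>

lemma pair_of_index_four:
  assumes idx: "card (rcosets center_derived G) = 4"
  shows "\<exists>x y. x \<in> carrier G \<and> y \<in> carrier G \<and> x \<otimes> x \<in> center G \<and> y \<otimes> y \<in> center G \<and>
    (\<forall>U. subgroup U G \<longrightarrow> x \<in> U \<longrightarrow> y \<in> U \<longrightarrow> center G \<subseteq> U \<longrightarrow> U = carrier G)"
proof -
  let ?K = "G Mod center G" and ?p = "\<lambda>g. center G #> g"
  interpret p: group_hom G ?K ?p by (rule central_quotient_hom)
  have cK: "carrier ?K = ?p ` carrier G" by (rule carrier_FactGroup)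
  note card_img = card_subgroup_image[OF p.group_hom_axioms fin, unfolded central_quotient_kernel]
  have oG: "order G = card (center G) * order ?K"
    using card_img[OF subgroup_self center_subset] cK by (simp add: order_def)
  have "order ?K dvd order G" unfolding oG by simp
  then have twK: "two_group ?K"
    unfolding two_group_def two_group_axioms_def
    using p.H.is_group fin dvd_order_imp_pow by (simp add: cK)
  have "?p ` center_derived G = derived ?K (carrier ?K)"
  proof
    have D: "derived ?K (carrier ?K) = ?p ` derived G (carrier G)"
      using p.derived_img[OF subset_refl] cK by simp
    have "derived G (carrier G) \<subseteq> center_derived G"
      unfolding derived_def by (intro generate_subgroup_incl center_derived_subgroup)
        (use commutator_in_center_derived in auto)
    then show "derived ?K (carrier ?K) \<subseteq> ?p ` center_derived G" unfolding D by (rule image_mono)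
    have sD: "subgroup (derived ?K (carrier ?K)) ?K" by (rule p.H.derived_is_subgroup[OF subset_refl])
    have "center_derived G \<subseteq> {g \<in> carrier G. ?p g \<in> derived ?K (carrier ?K)}"
    proof (rule center_derived_minimal)
      show "subgroup {g \<in> carrier G. ?p g \<in> derived ?K (carrier ?K)} G"
      proof (rule subgroupI)
        show "{g \<in> carrier G. ?p g \<in> derived ?K (carrier ?K)} \<noteq> {}"
          using subgroup.one_closed[OF sD] p.hom_one one_closed by (metis (mono_tags, lifting) empty_iff mem_Collect_eq)
        fix g assume g: "g \<in> {g \<in> carrier G. ?p g \<in> derived ?K (carrier ?K)}"
        then have "?p (inv g) \<in> derived ?K (carrier ?K)"
          using subgroup.m_inv_closed[OF sD] p.hom_inv by (metis (mono_tags, lifting) mem_Collect_eq)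
        then show "inv g \<in> {g \<in> carrier G. ?p g \<in> derived ?K (carrier ?K)}" using g by simp
        fix h assume h: "h \<in> {g \<in> carrier G. ?p g \<in> derived ?K (carrier ?K)}"
        have "?p (g \<otimes> h) \<in> derived ?K (carrier ?K)"
          using subgroup.m_closed[OF sD] p.hom_mult g h by (metis (mono_tags, lifting) mem_Collect_eq)
        then show "g \<otimes> h \<in> {g \<in> carrier G. ?p g \<in> derived ?K (carrier ?K)}" using g h by simp
      qed auto
      show "center G \<subseteq> {g \<in> carrier G. ?p g \<in> derived ?K (carrier ?K)}"
      proof
        fix g assume "g \<in> center G"
        then have "g \<in> kernel G ?K ?p" unfolding central_quotient_kernel .
        then show "g \<in> {g \<in> carrier G. ?p g \<in> derived ?K (carrier ?K)}"
          using subgroup.one_closed[OF sD] by (simp only: kernel_def mem_Collect_eq simp_thms)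
      qed
      fix g h assume g: "g \<in> carrier G" and h: "h \<in> carrier G"
      have "g \<otimes> h \<otimes> inv g \<otimes> inv h \<in> derived G (carrier G)"
        unfolding derived_def using g h by (intro generate.incl) auto
      then show "g \<otimes> h \<otimes> inv g \<otimes> inv h \<in> {g \<in> carrier G. ?p g \<in> derived ?K (carrier ?K)}"
        unfolding D using g h by (intro CollectI conjI imageI) auto
    qed
    then show "?p ` center_derived G \<subseteq> derived ?K (carrier ?K)" by blast
  qed
  then have "card (center_derived G) = card (center G) * card (derived ?K (carrier ?K))"
    using card_img[OF center_derived_subgroup center_in_center_derived] by simp
  moreover have "order G = 4 * card (center_derived G)"
    using lagrange[OF center_derived_subgroup] idx by simp
  moreover have "card (center G) \<noteq> 0"
    using finite_subset[OF center_subset fin] subgroup.one_closed[OF center_subgroup] by auto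
  ultimately have "order ?K = 4 * card (derived ?K (carrier ?K))" using oG by simp
  then obtain B where B: "B \<in> carrier ?K" "2 * card (generate ?K {B}) = order ?K"
    using two_group.cyclic_index_two[OF twK] by blast
  obtain a where a: "a \<in> carrier G" "B = ?p a" using B(1) cK by blast
  define L where "L = {g. \<exists>h\<in>center G. \<exists>i::int. g = h \<otimes> a [^] i}"
  have hc: "h \<in> center G \<Longrightarrow> h \<in> carrier G" for h by (rule centerD(1))
  have Lc: "g \<in> carrier G" if "g \<in> L" for g using that hc a by (auto simp: L_def)
  have powcomm: "a [^] (i::int) \<otimes> a [^] (j::int) = a [^] j \<otimes> a [^] i" for i j
    using a int_pow_mult[OF a(1), of i j] int_pow_mult[OF a(1), of j i] by (simp add: add.commute)
  have Lmult: "(h \<otimes> a [^] (i::int)) \<otimes> (k \<otimes> a [^] (j::int)) = (h \<otimes> k) \<otimes> a [^] (i + j)"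
    if "h \<in> center G" "k \<in> center G" for h k i j
  proof -
    have "(h \<otimes> a [^] i) \<otimes> (k \<otimes> a [^] j) = h \<otimes> (a [^] i \<otimes> k) \<otimes> a [^] j"
      using a hc that by (simp add: m_assoc)
    also have "a [^] i \<otimes> k = k \<otimes> a [^] i" by (rule centerD(2)[OF that(2), symmetric]) (use a in simp)
    finally show ?thesis using a hc that by (simp add: m_assoc int_pow_mult)
  qed
  have oneZ: "\<one> \<in> center G" by (rule subgroup.one_closed[OF center_subgroup])
  have sL: "subgroup L G"
  proof (rule subgroupI)
    show "L \<noteq> {}" using oneZ by (auto simp: L_def)
    fix g assume "g \<in> L"
    then obtain h i where h: "h \<in> center G" "g = h \<otimes> a [^] (i::int)" by (auto simp: L_def)
    have "(inv h \<otimes> a [^] (- i)) \<otimes> (h \<otimes> a [^] i) = \<one>"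
      using Lmult[OF subgroup.m_inv_closed[OF center_subgroup h(1)] h(1), of "- i" i] hc[OF h(1)] by simp
    then have "inv g = inv h \<otimes> a [^] (- i)" unfolding h(2) using hc[OF h(1)] a by (intro inv_equality) auto
    then show "inv g \<in> L" using subgroup.m_inv_closed[OF center_subgroup h(1)] by (auto simp: L_def)
    fix g' assume "g' \<in> L"
    then obtain k j where k: "k \<in> center G" "g' = k \<otimes> a [^] (j::int)" by (auto simp: L_def)
    show "g \<otimes> g' \<in> L"
      unfolding h(2) k(2) Lmult[OF h(1) k(1)] using subgroup.m_closed[OF center_subgroup h(1) k(1)]
      by (auto simp: L_def)
  qed (use Lc in auto)
  have ZL: "center G \<subseteq> L"
  proof
    fix h assume "h \<in> center G"
    then show "h \<in> L" unfolding L_def using hc by (auto intro!: bexI[of _ h] exI[of _ "0::int"])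
  qed
  have aL: "a \<in> L" unfolding L_def using oneZ a by (auto intro!: bexI[of _ \<one>] exI[of _ "1::int"])
  have "?p ` L = generate ?K {B}"
  proof
    show "?p ` L \<subseteq> generate ?K {B}"
    proof
      fix Y assume "Y \<in> ?p ` L"
      then obtain h i where h: "h \<in> center G" "Y = ?p (h \<otimes> a [^] (i::int))" by (auto simp: L_def)
      have "?p h = \<one>\<^bsub>?K\<^esub>" using h(1) central_quotient_kernel unfolding kernel_def by blast
      then have "Y = ?p (a [^] i)" using h hc a p.hom_mult[of h "a [^] i"] p.H.l_one[OF p.hom_closed] by simp
      also have "\<dots> = B [^]\<^bsub>?K\<^esub> i" using p.hom_int_pow[OF a(1)] a(2) by simp
      finally show "Y \<in> generate ?K {B}" using p.H.generate_pow[OF B(1)] by blast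
    qed
    show "generate ?K {B} \<subseteq> ?p ` L"
      using aL a(2) p.subgroup_img_is_subgroup[OF sL] by (intro p.H.generate_subgroup_incl) auto
  qed
  then have "card L = card (center G) * card (generate ?K {B})" using card_img[OF sL ZL] by simp
  then have oL: "2 * card L = order G" using B(2) oG by simp
  have Lcomm: "l \<otimes> n = n \<otimes> l" if l: "l \<in> L" and n: "n \<in> L" for l n
  proof -
    obtain h i where h: "h \<in> center G" "l = h \<otimes> a [^] (i::int)" using l by (auto simp: L_def)
    obtain k j where k: "k \<in> center G" "n = k \<otimes> a [^] (j::int)" using n by (auto simp: L_def)
    show ?thesis
      unfolding h(2) k(2) Lmult[OF h(1) k(1)] Lmult[OF k(1) h(1)]
      using centerD(2)[OF h(1) hc[OF k(1)]] by (simp add: add.commute)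
  qed
  obtain x where x: "x \<in> carrier G" "x \<notin> L" using exists_not_mem_index_two[OF sL oL] by auto
  have cover: "g \<in> L \<or> (\<exists>l\<in>L. g = y \<otimes> l)" if g: "g \<in> carrier G" and y: "y \<in> carrier G" "y \<notin> L" for g y
  proof (cases "g \<in> L")
    case False
    have iy: "inv y \<in> carrier G" "inv y \<notin> L"
      using y subgroup.m_inv_closed[OF sL, of "inv y"] by auto
    have "inv y \<otimes> g \<in> L" by (rule index_two_mult[OF sL oL iy g False])
    moreover have "g = y \<otimes> (inv y \<otimes> g)" using y g by (simp add: m_assoc[symmetric])
    ultimately show ?thesis by blast
  qed auto
  have sq: "y \<otimes> y \<in> center G" if y: "y \<in> carrier G" "y \<notin> L" for y
  proof (rule centerI)
    have yyL: "y \<otimes> y \<in> L" by (rule index_two_mult[OF sL oL y y])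
    fix g assume g: "g \<in> carrier G"
    consider "g \<in> L" | l where "l \<in> L" "g = y \<otimes> l" using cover[OF g y] by blast
    then show "y \<otimes> y \<otimes> g = g \<otimes> (y \<otimes> y)"
    proof cases
      case 1
      then show ?thesis by (rule Lcomm[OF yyL])
    next
      case 2
      have "y \<otimes> y \<otimes> g = y \<otimes> ((y \<otimes> y) \<otimes> l)" using 2 y Lc by (simp add: m_assoc)
      also have "(y \<otimes> y) \<otimes> l = l \<otimes> (y \<otimes> y)" by (rule Lcomm[OF yyL 2(1)])
      finally show ?thesis using 2 y Lc by (simp add: m_assoc)
    qed
  qed (use y in auto)
  have xa: "x \<otimes> a \<in> carrier G" "x \<otimes> a \<notin> L"
  proof -
    show "x \<otimes> a \<in> carrier G" using x a by simp
    show "x \<otimes> a \<notin> L"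
    proof
      assume "x \<otimes> a \<in> L"
      then have "x \<otimes> a \<otimes> inv a \<in> L" using aL subgroup.m_closed[OF sL] subgroup.m_inv_closed[OF sL] by blast
      then show False using x a by (simp add: m_assoc)
    qed
  qed
  have "U = carrier G" if U: "subgroup U G" "x \<in> U" "x \<otimes> a \<in> U" "center G \<subseteq> U" for U
  proof
    show "U \<subseteq> carrier G" by (rule subgroup.subset[OF U(1)])
    have "inv x \<otimes> (x \<otimes> a) \<in> U" using U subgroup.m_closed[OF U(1)] subgroup.m_inv_closed[OF U(1)] by blast
    then have aU: "a \<in> U" using x a by (simp add: m_assoc[symmetric])
    have LU: "L \<subseteq> U"
      unfolding L_def using U(4) subgroup_int_pow_closed[OF U(1) aU] subgroup.m_closed[OF U(1)] by blast
    show "carrier G \<subseteq> U"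
    proof
      fix g assume "g \<in> carrier G"
      then show "g \<in> U" using cover[OF _ x] LU U(2) subgroup.m_closed[OF U(1)] by blast
    qed
  qed
  then show ?thesis using x(1) xa(1) sq[OF x] sq[OF xa] by blast
qed

end

context dihedral_ext
begin

text \<open>The parities of the exponents of \<open>a\<close> and \<open>x\<close> are homomorphisms that vanish on the centre, and
  conversely \<open>a^2\<close> is a commutator up to a central factor.\<close>

lemma index_center_derived: "card (rcosets center_derived G) = 4"
proof -
  define U where "U = {g. \<exists>i j. g = el (2 * i) j False}"
  have U_el: "el i j False \<in> U" if "even i" for i j
    using that by (auto simp: U_def elim!: evenE)
  have "subgroup U G"
  proof (rule subgroupI)
    show "U \<noteq> {}" by (auto simp: U_def)
    fix g h assume "g \<in> U" "h \<in> U"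
    then obtain i j k l where g: "g = el (2 * i) j False" and h: "h = el (2 * k) l False"
      by (auto simp: U_def)
    show "inv g \<in> U" unfolding g el_inv by (rule U_el) simp
    show "g \<otimes> h \<in> U" unfolding g h el_mult by (rule U_el) simp
  qed (auto simp: U_def)
  moreover have ZU: "center G \<subseteq> U"
    unfolding center_eq using U_el[of 0] by (auto simp: el_gens)
  moreover have "g \<otimes> h \<otimes> inv g \<otimes> inv h \<in> U" if gh: "g \<in> carrier G" "h \<in> carrier G" for g h
  proof -
    obtain i j e where g: "g = el i j e" using elements[OF gh(1)] by blast
    obtain k l f where h: "h = el k l f" using elements[OF gh(2)] by blast
    show ?thesis
      unfolding g h by (cases e; cases f) (simp_all add: el_inv el_mult U_el)
  qed
  ultimately have NU: "center_derived G \<subseteq> U" by (rule center_derived_minimal)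
  have "U \<subseteq> center_derived G"
  proof
    fix g assume "g \<in> U"
    then obtain i j where g: "g = el (2 * i) j False" by (auto simp: U_def)
    have zN: "z [^] (j::int) \<in> center_derived G" for j
      using zpow_center center_in_center_derived by blast
    have "x \<otimes> inv a \<otimes> inv x \<otimes> inv (inv a) \<in> center_derived G"
      by (intro commutator_in_center_derived) auto
    moreover have "x \<otimes> inv a \<otimes> inv x \<otimes> inv (inv a) = el 2 (- s) False"
    proof -
      have "el 0 0 True \<otimes> inv (el 1 0 False) \<otimes> inv (el 0 0 True) \<otimes> inv (inv (el 1 0 False)) = el 2 (- s) False"
        by (simp only: el_mult el_inv) simp
      then show ?thesis by (simp only: el_gens(1,3))
    qed
    ultimately have "el 2 (- s) False [^] i \<in> center_derived G"
      using subgroup_int_pow_closed[OF center_derived_subgroup] by simp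
    moreover have "el 2 (- s) False [^] i = a [^] (2 * i) \<otimes> z [^] (- s * i)"
      by (simp add: el_def int_pow_mult_distrib zpow_comm int_pow_pow)
    ultimately have "a [^] (2 * i) \<otimes> z [^] (- s * i) \<otimes> z [^] (s * i + j) \<in> center_derived G"
      using zN subgroup.m_closed[OF center_derived_subgroup] by simp
    moreover have "a [^] (2 * i) \<otimes> z [^] (- s * i) \<otimes> z [^] (s * i + j) = g"
      unfolding g by (simp add: el_def m_assoc int_pow_mult[symmetric])
    ultimately show "g \<in> center_derived G" by simp
  qed
  then have N: "center_derived G = U" using NU by auto
  let ?S = "{0..<(2::int) ^ (m - 1)} \<times> {0..<(2::int) ^ c}"
  let ?f = "\<lambda>(i, j). el (2 * i) j False"
  have m2: "(2::int) ^ m = 2 * 2 ^ (m - 1)" using m_pos by (simp add: power_eq_if)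
  have "U = ?f ` ?S"
  proof
    show "U \<subseteq> ?f ` ?S"
    proof
      fix g assume "g \<in> U"
      then obtain i j where "g = el (2 * i) j False" by (auto simp: U_def)
      also have "\<dots> = el (2 * (i mod 2 ^ (m - 1))) ((j + r * (2 * i div 2 ^ m)) mod 2 ^ c) False"
        by (subst el_reduce) (simp add: m2)
      finally have "g = ?f (i mod 2 ^ (m - 1), (j + r * (2 * i div 2 ^ m)) mod 2 ^ c)" by simp
      then show "g \<in> ?f ` ?S" by (rule image_eqI) simp
    qed
  qed (auto simp: U_def)
  moreover have "inj_on ?f ?S"
  proof (rule inj_onI)
    fix u v assume uv: "u \<in> ?S" "v \<in> ?S" "?f u = ?f v"
    obtain i j where u: "u = (i, j)" by (cases u)
    obtain k l where v: "v = (k, l)" by (cases v)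
    have b: "0 \<le> i" "i < 2 ^ (m - 1)" "0 \<le> k" "k < 2 ^ (m - 1)" "0 \<le> j" "j < 2 ^ c" "0 \<le> l" "l < 2 ^ c"
      using uv u v by auto
    have e: "2 ^ m dvd 2 * i - 2 * k" "2 ^ c dvd r * ((2 * i - 2 * k) div 2 ^ m) + j - l"
      using uv(3) by (simp_all add: u v el_eq)
    have "2 * 2 ^ (m - 1) dvd 2 * (i - k)" using e(1) unfolding m2 by (simp only: right_diff_distrib)
    then have "2 ^ (m - 1) dvd i - k" unfolding dvd_mult_cancel_left by simp
    then have ik: "i = k" using b by (metis mod_eq_dvd_iff mod_pos_pos_trivial)
    then have "2 ^ c dvd j - l" using e(2) by simp
    then have "j = l" using b by (metis mod_eq_dvd_iff mod_pos_pos_trivial)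
    then show "u = v" using u v ik by simp
  qed
  ultimately have "card (center_derived G) = 2 ^ (m - 1 + c)"
    unfolding N by (simp add: card_image card_cartesian_product nat_power_eq power_add)
  moreover have "card (rcosets center_derived G) * card (center_derived G) = order G"
    by (rule lagrange[OF center_derived_subgroup])
  moreover have "order G = 4 * 2 ^ (m - 1 + c)"
    unfolding order_eq using m_pos by (simp add: power_add power_eq_if)
  ultimately show ?thesis by simp
qed

end

section \<open>Invariants of the group algebra\<close>

text \<open>For a group algebra: some central element is not a scalar modulo the square of the augmentation
  ideal.\<close>

definition central_derivation ::
  "('f, 'r) ring_scheme \<Rightarrow> ('f, 'a, 'm) module_scheme \<Rightarrow> bool" where
  "central_derivation F A \<longleftrightarrow> (\<exists>e d w. augmentation F A e \<and> derivation F A e d \<and>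
     w \<in> center A \<and> d w \<noteq> \<zero>\<^bsub>F\<^esub>)"

text \<open>For a group algebra: some square-zero element lies outside the square of the augmentation ideal.\<close>

definition square_zero_derivation ::
  "('f, 'r) ring_scheme \<Rightarrow> ('f, 'a, 'm) module_scheme \<Rightarrow> bool" where
  "square_zero_derivation F A \<longleftrightarrow> (\<exists>e d w. augmentation F A e \<and> derivation F A e d \<and>
     w \<in> carrier A \<and> w \<otimes>\<^bsub>A\<^esub> w = \<zero>\<^bsub>A\<^esub> \<and> d w \<noteq> \<zero>\<^bsub>F\<^esub>)"

text \<open>For a group algebra: the square-zero elements span the augmentation ideal modulo its square.\<close>

definition square_zero_separates ::
  "('f, 'r) ring_scheme \<Rightarrow> ('f, 'a, 'm) module_scheme \<Rightarrow> bool" where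
  "square_zero_separates F A \<longleftrightarrow> (\<forall>e d. augmentation F A e \<longrightarrow> derivation F A e d \<longrightarrow>
     (\<forall>w\<in>carrier A. w \<otimes>\<^bsub>A\<^esub> w = \<zero>\<^bsub>A\<^esub> \<longrightarrow> d w = \<zero>\<^bsub>F\<^esub>) \<longrightarrow> (\<forall>w\<in>carrier A. d w = \<zero>\<^bsub>F\<^esub>))"

context char2_group_algebra
begin

lemma pairing_mult':
  assumes f: "f \<in> carrier G \<rightarrow> carrier F" and u: "u \<in> carrier FG" and v: "v \<in> carrier FG"
  shows "pairing f (u \<otimes>\<^bsub>FG\<^esub> v) = (\<Oplus>y\<in>carrier G. u y \<otimes> pairing (\<lambda>k. f (y \<otimes>\<^bsub>G\<^esub> k)) v)"
  unfolding pairing_mult[OF assms]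
proof (rule finsum_cong')
  have fc: "f g \<in> carrier F" if "g \<in> carrier G" for g using f that by auto
  note cl = fc FG_closed_apply[OF u] FG_closed_apply[OF v]
  show "(\<lambda>y. u y \<otimes> pairing (\<lambda>k. f (y \<otimes>\<^bsub>G\<^esub> k)) v) \<in> carrier G \<rightarrow> carrier F"
    using cl v by (auto intro!: pairing_closed)
  fix y assume y: "y \<in> carrier G"
  have "(\<Oplus>k\<in>carrier G. u y \<otimes> v k \<otimes> f (y \<otimes>\<^bsub>G\<^esub> k)) = (\<Oplus>k\<in>carrier G. u y \<otimes> (v k \<otimes> f (y \<otimes>\<^bsub>G\<^esub> k)))"
    using cl y by (intro finsum_cong') (auto simp: m_assoc)
  also have "\<dots> = u y \<otimes> pairing (\<lambda>k. f (y \<otimes>\<^bsub>G\<^esub> k)) v"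
    unfolding pairing_def using cl y G.fin by (intro finsum_rdistr[symmetric]) auto
  finally show "(\<Oplus>k\<in>carrier G. u y \<otimes> v k \<otimes> f (y \<otimes>\<^bsub>G\<^esub> k)) = u y \<otimes> pairing (\<lambda>k. f (y \<otimes>\<^bsub>G\<^esub> k)) v" .
qed simp

text \<open>For a fixed left factor the functional is a trace, and on a central right factor a trace only
  sees central group elements, on which \<open>f\<close> is constant along cosets.\<close>

lemma central_abelian_of_coset_function:
  assumes f: "f \<in> carrier G \<rightarrow> carrier F"
    and inv: "\<And>g n. g \<in> carrier G \<Longrightarrow> n \<in> center_derived G \<Longrightarrow> f (g \<otimes>\<^bsub>G\<^esub> n) = f g"
  shows "central_abelian_functional F FG aug (pairing f)"
proof -
  interpret FG: ring FG by (rule FG_ring)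
  have fc: "f g \<in> carrier F" if "g \<in> carrier G" for g using f that by auto
  have sh: "(\<lambda>k. f (y \<otimes>\<^bsub>G\<^esub> k)) \<in> carrier G \<rightarrow> carrier F" if "y \<in> carrier G" for y
    using fc that by auto
  have tr: "trace_functional F FG (pairing (\<lambda>k. f (y \<otimes>\<^bsub>G\<^esub> k)))" if y: "y \<in> carrier G" for y
  proof (rule trace_of_class_function[OF sh[OF y]])
    fix g h assume g: "g \<in> carrier G" and h: "h \<in> carrier G"
    let ?n = "inv\<^bsub>G\<^esub> g \<otimes>\<^bsub>G\<^esub> inv\<^bsub>G\<^esub> h \<otimes>\<^bsub>G\<^esub> inv\<^bsub>G\<^esub> (inv\<^bsub>G\<^esub> g) \<otimes>\<^bsub>G\<^esub> inv\<^bsub>G\<^esub> (inv\<^bsub>G\<^esub> h)"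
    have "h \<otimes>\<^bsub>G\<^esub> g \<otimes>\<^bsub>G\<^esub> ?n = h \<otimes>\<^bsub>G\<^esub> (g \<otimes>\<^bsub>G\<^esub> inv\<^bsub>G\<^esub> g) \<otimes>\<^bsub>G\<^esub> inv\<^bsub>G\<^esub> h \<otimes>\<^bsub>G\<^esub> g \<otimes>\<^bsub>G\<^esub> h"
      using g h by (simp only: G.m_assoc G.inv_closed G.m_closed G.inv_inv)
    also have "\<dots> = g \<otimes>\<^bsub>G\<^esub> h" using g h by simp
    finally have e: "y \<otimes>\<^bsub>G\<^esub> (g \<otimes>\<^bsub>G\<^esub> h) = y \<otimes>\<^bsub>G\<^esub> (h \<otimes>\<^bsub>G\<^esub> g) \<otimes>\<^bsub>G\<^esub> ?n"
      using g h y by (simp only: G.m_assoc G.inv_closed G.m_closed)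
    show "f (y \<otimes>\<^bsub>G\<^esub> (g \<otimes>\<^bsub>G\<^esub> h)) = f (y \<otimes>\<^bsub>G\<^esub> (h \<otimes>\<^bsub>G\<^esub> g))"
      unfolding e using g h y by (intro inv G.commutator_in_center_derived) auto
  qed
  show ?thesis
    unfolding central_abelian_functional_def
  proof (intro conjI ballI)
    fix u v w assume u: "u \<in> carrier FG" and v: "v \<in> carrier FG" and w: "w \<in> carrier FG"
    have "pairing (\<lambda>k. f (y \<otimes>\<^bsub>G\<^esub> k)) (v \<otimes>\<^bsub>FG\<^esub> w) = pairing (\<lambda>k. f (y \<otimes>\<^bsub>G\<^esub> k)) (w \<otimes>\<^bsub>FG\<^esub> v)"
      if "y \<in> carrier G" for y using tr[OF that] v w unfolding trace_functional_def by blast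
    then show "pairing f (u \<otimes>\<^bsub>FG\<^esub> (v \<otimes>\<^bsub>FG\<^esub> w)) = pairing f (u \<otimes>\<^bsub>FG\<^esub> (w \<otimes>\<^bsub>FG\<^esub> v))"
      unfolding pairing_mult'[OF f u FG.m_closed[OF v w]] pairing_mult'[OF f u FG.m_closed[OF w v]]
      using u v w sh by (intro finsum_cong') (auto intro!: pairing_closed)
  next
    fix u z assume u: "u \<in> carrier FG" and z: "z \<in> center FG"
    have zc: "z \<in> carrier FG" using z by (rule centerD(1))
    have p: "pairing (\<lambda>k. f (y \<otimes>\<^bsub>G\<^esub> k)) z = f y \<otimes> aug z" if y: "y \<in> carrier G" for y
    proof -
      have "pairing (\<lambda>k. f (y \<otimes>\<^bsub>G\<^esub> k)) z =
          (\<Oplus>h\<in>center G. z h \<otimes> pairing (\<lambda>k. f (y \<otimes>\<^bsub>G\<^esub> k)) (single h))"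
        by (rule trace_on_center[OF tr[OF y] z])
      also have "\<dots> = (\<Oplus>h\<in>center G. f y \<otimes> z h)"
        using zc y fc G.center_subset G.center_in_center_derived
        by (intro finsum_cong') (auto simp: pairing_single[OF _ sh[OF y]] inv m_comm subset_iff)
      also have "\<dots> = f y \<otimes> aug z"
        unfolding aug_center[OF z] using zc y fc G.center_subset finite_subset[OF G.center_subset G.fin]
        by (intro finsum_rdistr[symmetric]) auto
      finally show ?thesis .
    qed
    have "pairing f (u \<otimes>\<^bsub>FG\<^esub> z) = (\<Oplus>y\<in>carrier G. (u y \<otimes> f y) \<otimes> aug z)"
      unfolding pairing_mult'[OF f u zc] using u zc fc p
      by (intro finsum_cong') (auto simp: m_assoc)
    also have "\<dots> = pairing f u \<otimes> aug z"
      unfolding pairing_def using u zc fc G.fin by (intro finsum_ldistr[symmetric]) auto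
    finally show "pairing f (u \<otimes>\<^bsub>FG\<^esub> z) = pairing f u \<otimes> aug z" .
  qed (rule pairing_linear[OF f])
qed

text \<open>The right translations that do not change the values of \<open>L\<close> on group elements form a subgroup
  containing the centre and the commutators.\<close>

lemma central_abelian_single:
  assumes L: "central_abelian_functional F FG aug L"
    and n: "n \<in> center_derived G" and g: "g \<in> carrier G"
  shows "L (single (g \<otimes>\<^bsub>G\<^esub> n)) = L (single g)"
proof -
  have Lc: "L (single g) \<in> carrier F" for g
    using L by (auto simp: central_abelian_functional_def linear_functional_def)
  have swap: "L (single (a \<otimes>\<^bsub>G\<^esub> (b \<otimes>\<^bsub>G\<^esub> c))) = L (single (a \<otimes>\<^bsub>G\<^esub> (c \<otimes>\<^bsub>G\<^esub> b)))"
    if "a \<in> carrier G" "b \<in> carrier G" "c \<in> carrier G" for a b c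
  proof -
    have "L (single a \<otimes>\<^bsub>FG\<^esub> (single b \<otimes>\<^bsub>FG\<^esub> single c)) = L (single a \<otimes>\<^bsub>FG\<^esub> (single c \<otimes>\<^bsub>FG\<^esub> single b))"
      using L single_closed unfolding central_abelian_functional_def by blast
    then show ?thesis using that by (simp add: single_mult_single)
  qed
  define U where "U = {n \<in> carrier G. \<forall>g\<in>carrier G. L (single (g \<otimes>\<^bsub>G\<^esub> n)) = L (single g)}"
  have "subgroup U G"
  proof (rule G.subgroupI)
    show "U \<noteq> {}" by (auto simp: U_def intro!: exI[of _ "\<one>\<^bsub>G\<^esub>"])
    fix a assume a: "a \<in> U"
    show "inv\<^bsub>G\<^esub> a \<in> U"
    proof -
      have "L (single (g \<otimes>\<^bsub>G\<^esub> inv\<^bsub>G\<^esub> a)) = L (single g)" if "g \<in> carrier G" for g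
      proof -
        have "L (single (g \<otimes>\<^bsub>G\<^esub> inv\<^bsub>G\<^esub> a \<otimes>\<^bsub>G\<^esub> a)) = L (single (g \<otimes>\<^bsub>G\<^esub> inv\<^bsub>G\<^esub> a))"
          using a that by (auto simp: U_def)
        then show ?thesis using a that by (simp add: U_def G.m_assoc)
      qed
      then show ?thesis using a by (auto simp: U_def)
    qed
    fix b assume b: "b \<in> U"
    show "a \<otimes>\<^bsub>G\<^esub> b \<in> U"
      using a b by (auto simp: U_def G.m_assoc[symmetric])
  qed (auto simp: U_def)
  moreover have "center G \<subseteq> U"
  proof
    fix z assume z: "z \<in> center G"
    have "L (single (g \<otimes>\<^bsub>G\<^esub> z)) = L (single g)" if "g \<in> carrier G" for g
    proof -
      have "L (single g \<otimes>\<^bsub>FG\<^esub> single z) = L (single g) \<otimes> aug (single z)"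
        using L single_closed single_in_center[OF z] unfolding central_abelian_functional_def by blast
      then show ?thesis using that centerD(1)[OF z] Lc by (simp add: single_mult_single aug_single)
    qed
    then show "z \<in> U" using centerD(1)[OF z] by (auto simp: U_def)
  qed
  moreover have "a \<otimes>\<^bsub>G\<^esub> b \<otimes>\<^bsub>G\<^esub> inv\<^bsub>G\<^esub> a \<otimes>\<^bsub>G\<^esub> inv\<^bsub>G\<^esub> b \<in> U"
    if a: "a \<in> carrier G" and b: "b \<in> carrier G" for a b
  proof -
    have "L (single (g \<otimes>\<^bsub>G\<^esub> (a \<otimes>\<^bsub>G\<^esub> b \<otimes>\<^bsub>G\<^esub> inv\<^bsub>G\<^esub> a \<otimes>\<^bsub>G\<^esub> inv\<^bsub>G\<^esub> b))) = L (single g)"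
      if g: "g \<in> carrier G" for g
    proof -
      have "L (single (g \<otimes>\<^bsub>G\<^esub> (a \<otimes>\<^bsub>G\<^esub> b \<otimes>\<^bsub>G\<^esub> inv\<^bsub>G\<^esub> a \<otimes>\<^bsub>G\<^esub> inv\<^bsub>G\<^esub> b))) =
        L (single (g \<otimes>\<^bsub>G\<^esub> (a \<otimes>\<^bsub>G\<^esub> (b \<otimes>\<^bsub>G\<^esub> inv\<^bsub>G\<^esub> a \<otimes>\<^bsub>G\<^esub> inv\<^bsub>G\<^esub> b))))"
        using a b by (simp only: G.m_assoc G.inv_closed G.m_closed)
      also have "\<dots> = L (single (g \<otimes>\<^bsub>G\<^esub> ((b \<otimes>\<^bsub>G\<^esub> inv\<^bsub>G\<^esub> a \<otimes>\<^bsub>G\<^esub> inv\<^bsub>G\<^esub> b) \<otimes>\<^bsub>G\<^esub> a)))"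
        using a b g by (intro swap) auto
      also have "\<dots> = L (single ((g \<otimes>\<^bsub>G\<^esub> b) \<otimes>\<^bsub>G\<^esub> (inv\<^bsub>G\<^esub> a \<otimes>\<^bsub>G\<^esub> (inv\<^bsub>G\<^esub> b \<otimes>\<^bsub>G\<^esub> a))))"
        using a b g by (simp only: G.m_assoc G.inv_closed G.m_closed)
      also have "\<dots> = L (single ((g \<otimes>\<^bsub>G\<^esub> b) \<otimes>\<^bsub>G\<^esub> ((inv\<^bsub>G\<^esub> b \<otimes>\<^bsub>G\<^esub> a) \<otimes>\<^bsub>G\<^esub> inv\<^bsub>G\<^esub> a)))"
        using a b g by (intro swap) auto
      also have "(g \<otimes>\<^bsub>G\<^esub> b) \<otimes>\<^bsub>G\<^esub> ((inv\<^bsub>G\<^esub> b \<otimes>\<^bsub>G\<^esub> a) \<otimes>\<^bsub>G\<^esub> inv\<^bsub>G\<^esub> a) =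
          g \<otimes>\<^bsub>G\<^esub> (b \<otimes>\<^bsub>G\<^esub> inv\<^bsub>G\<^esub> b) \<otimes>\<^bsub>G\<^esub> (a \<otimes>\<^bsub>G\<^esub> inv\<^bsub>G\<^esub> a)"
        using a b g by (simp only: G.m_assoc G.inv_closed G.m_closed)
      also have "\<dots> = g" using a b g by simp
      finally show ?thesis .
    qed
    then show ?thesis using a b by (auto simp: U_def)
  qed
  ultimately have "center_derived G \<subseteq> U" by (rule G.center_derived_minimal)
  then show ?thesis using n g by (auto simp: U_def)
qed

lemma iter_square_single:
  assumes "z \<in> carrier G"
  shows "iter_square FG k (single z \<oplus>\<^bsub>FG\<^esub> \<one>\<^bsub>FG\<^esub>) = single (z [^]\<^bsub>G\<^esub> ((2::nat) ^ k)) \<oplus>\<^bsub>FG\<^esub> \<one>\<^bsub>FG\<^esub>"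
  using assms
proof (induction k arbitrary: z)
  case (Suc k)
  interpret FG: ring FG by (rule FG_ring)
  have z: "z \<in> carrier G" by fact
  let ?u = "single z"
  have uu: "?u \<oplus>\<^bsub>FG\<^esub> ?u = \<zero>\<^bsub>FG\<^esub>"
    by (rule FG_eqI) (auto simp: FG_add_apply single_apply group_algebra_def one_add_one)
  have "(?u \<oplus>\<^bsub>FG\<^esub> \<one>\<^bsub>FG\<^esub>) \<otimes>\<^bsub>FG\<^esub> (?u \<oplus>\<^bsub>FG\<^esub> \<one>\<^bsub>FG\<^esub>) =
      ?u \<otimes>\<^bsub>FG\<^esub> ?u \<oplus>\<^bsub>FG\<^esub> (?u \<oplus>\<^bsub>FG\<^esub> ?u) \<oplus>\<^bsub>FG\<^esub> \<one>\<^bsub>FG\<^esub>"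
    by (simp add: FG.l_distr FG.r_distr FG.a_assoc)
  also have "\<dots> = single (z \<otimes>\<^bsub>G\<^esub> z) \<oplus>\<^bsub>FG\<^esub> \<one>\<^bsub>FG\<^esub>"
    using z by (simp add: uu single_mult_single)
  finally show ?case
    unfolding iter_square_Suc using Suc.IH[of "z \<otimes>\<^bsub>G\<^esub> z"] z G.square_pow[OF z, of k] by simp
qed (use G.nat_pow_eone in auto)

end

text \<open>The inverse isomorphism is a parameter, so that every statement can also be used in the opposite
  direction.\<close>

locale group_algebra_iso = A: char2_group_algebra F G + B: char2_group_algebra F H
  for F :: "('f, 'r) ring_scheme" (structure)
    and G :: "('g, 'm) monoid_scheme" and H :: "('h, 'n) monoid_scheme" +
  fixes \<phi> :: "('g \<Rightarrow> 'f) \<Rightarrow> 'h \<Rightarrow> 'f" and \<psi> :: "('h \<Rightarrow> 'f) \<Rightarrow> 'g \<Rightarrow> 'f"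
  assumes phi: "\<phi> \<in> algebra_iso F (group_algebra F G) (group_algebra F H)"
    and psi: "\<psi> \<in> algebra_iso F (group_algebra F H) (group_algebra F G)"
    and psi_phi: "\<And>u. u \<in> carrier (group_algebra F G) \<Longrightarrow> \<psi> (\<phi> u) = u"
    and phi_psi: "\<And>v. v \<in> carrier (group_algebra F H) \<Longrightarrow> \<phi> (\<psi> v) = v"
begin

abbreviation FG where "FG \<equiv> group_algebra F G"
abbreviation FH where "FH \<equiv> group_algebra F H"

lemma phi_hom:
  "u \<in> carrier FG \<Longrightarrow> \<phi> u \<in> carrier FH"
  "u \<in> carrier FG \<Longrightarrow> v \<in> carrier FG \<Longrightarrow> \<phi> (u \<otimes>\<^bsub>FG\<^esub> v) = \<phi> u \<otimes>\<^bsub>FH\<^esub> \<phi> v"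
  "u \<in> carrier FG \<Longrightarrow> v \<in> carrier FG \<Longrightarrow> \<phi> (u \<oplus>\<^bsub>FG\<^esub> v) = \<phi> u \<oplus>\<^bsub>FH\<^esub> \<phi> v"
  "\<phi> \<one>\<^bsub>FG\<^esub> = \<one>\<^bsub>FH\<^esub>"
  "c \<in> carrier F \<Longrightarrow> u \<in> carrier FG \<Longrightarrow> \<phi> (c \<odot>\<^bsub>FG\<^esub> u) = c \<odot>\<^bsub>FH\<^esub> \<phi> u"
  using phi by (auto simp: algebra_iso_def ring_iso_def ring_hom_def)

lemma psi_closed: "v \<in> carrier FH \<Longrightarrow> \<psi> v \<in> carrier FG"
  using psi by (auto simp: algebra_iso_def ring_iso_def ring_hom_def)

lemma reverse: "group_algebra_iso F H G \<psi> \<phi>"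
  by unfold_locales (use phi psi psi_phi phi_psi in auto)

lemma phi_center: "w \<in> center FG \<Longrightarrow> \<phi> w \<in> center FH"
proof (rule centerI)
  fix v assume w: "w \<in> center FG" and v: "v \<in> carrier FH"
  have "\<phi> w \<otimes>\<^bsub>FH\<^esub> \<phi> (\<psi> v) = \<phi> (\<psi> v) \<otimes>\<^bsub>FH\<^esub> \<phi> w"
    using phi_hom(2)[OF centerD(1)[OF w] psi_closed[OF v]]
      phi_hom(2)[OF psi_closed[OF v] centerD(1)[OF w]] centerD(2)[OF w psi_closed[OF v]] by simp
  then show "\<phi> w \<otimes>\<^bsub>FH\<^esub> v = v \<otimes>\<^bsub>FH\<^esub> \<phi> w" using phi_psi[OF v] by simp
qed (use centerD(1) phi_hom(1) in fast)

lemma phi_zero: "\<phi> \<zero>\<^bsub>FG\<^esub> = \<zero>\<^bsub>FH\<^esub>"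
proof -
  interpret FG: ring FG by (rule A.FG_ring)
  interpret FH: ring FH by (rule B.FG_ring)
  show ?thesis
    using phi_hom(3)[of "\<zero>\<^bsub>FG\<^esub>" "\<zero>\<^bsub>FG\<^esub>"] phi_hom(1)[of "\<zero>\<^bsub>FG\<^esub>"]
      FH.add.l_cancel_one'[of "\<phi> \<zero>\<^bsub>FG\<^esub>" "\<phi> \<zero>\<^bsub>FG\<^esub>"] by simp
qed

lemma linear_functional_pullback:
  "linear_functional F FH L \<Longrightarrow> linear_functional F FG (\<lambda>u. L (\<phi> u))"
  unfolding linear_functional_def by (auto simp: phi_hom)

lemma augmentation_pullback:
  "augmentation F FH e \<Longrightarrow> augmentation F FG (\<lambda>u. e (\<phi> u))"
  using linear_functional_pullback unfolding augmentation_def by (auto simp: phi_hom)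

lemma derivation_pullback:
  "derivation F FH e d \<Longrightarrow> derivation F FG (\<lambda>u. e (\<phi> u)) (\<lambda>u. d (\<phi> u))"
  using linear_functional_pullback unfolding derivation_def by (auto simp: phi_hom)

lemma trace_pullback:
  "trace_functional F FH t \<Longrightarrow> trace_functional F FG (\<lambda>u. t (\<phi> u))"
  using linear_functional_pullback unfolding trace_functional_def by (auto simp: phi_hom)

lemma aug_phi: "u \<in> carrier FG \<Longrightarrow> B.aug (\<phi> u) = A.aug u"
  using A.augmentation_unique[OF augmentation_pullback[OF B.aug_augmentation]] .

lemma central_abelian_pullback:
  "central_abelian_functional F FH B.aug f \<Longrightarrow>
    central_abelian_functional F FG A.aug (\<lambda>u. f (\<phi> u))"
  using linear_functional_pullback A.FG_mult_closed unfolding central_abelian_functional_def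
  by (auto simp: phi_hom phi_center aug_phi A.center_FG_closed)

lemma central_derivation_pullback: "central_derivation F FH \<Longrightarrow> central_derivation F FG"
  unfolding central_derivation_def
proof (elim exE conjE)
  fix e d w assume *: "augmentation F FH e" "derivation F FH e d" "w \<in> center FH" "d w \<noteq> \<zero>"
  interpret r: group_algebra_iso F H G \<psi> \<phi> by (rule reverse)
  have "d (\<phi> (\<psi> w)) \<noteq> \<zero>" using * phi_psi centerD(1)[OF *(3)] by simp
  then show "\<exists>e d w. augmentation F FG e \<and> derivation F FG e d \<and> w \<in> center FG \<and> d w \<noteq> \<zero>"
    using augmentation_pullback[OF *(1)] derivation_pullback[OF *(2)] r.phi_center[OF *(3)] by blast
qed

lemma square_zero_derivation_pullback:
  "square_zero_derivation F FH \<Longrightarrow> square_zero_derivation F FG"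
  unfolding square_zero_derivation_def
proof (elim exE conjE)
  fix e d w assume *: "augmentation F FH e" "derivation F FH e d" "w \<in> carrier FH"
    "w \<otimes>\<^bsub>FH\<^esub> w = \<zero>\<^bsub>FH\<^esub>" "d w \<noteq> \<zero>"
  interpret r: group_algebra_iso F H G \<psi> \<phi> by (rule reverse)
  have "d (\<phi> (\<psi> w)) \<noteq> \<zero>" using * phi_psi by simp
  moreover have "\<psi> w \<otimes>\<^bsub>FG\<^esub> \<psi> w = \<zero>\<^bsub>FG\<^esub>"
    using r.phi_hom(2)[OF *(3) *(3)] *(4) r.phi_zero by simp
  ultimately show "\<exists>e d w. augmentation F FG e \<and> derivation F FG e d \<and> w \<in> carrier FG \<and>
      w \<otimes>\<^bsub>FG\<^esub> w = \<zero>\<^bsub>FG\<^esub> \<and> d w \<noteq> \<zero>"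
    using augmentation_pullback[OF *(1)] derivation_pullback[OF *(2)] psi_closed[OF *(3)] by blast
qed

lemma square_zero_separates_push:
  assumes "square_zero_separates F FG" shows "square_zero_separates F FH"
  unfolding square_zero_separates_def
proof (intro allI impI ballI)
  fix e d v assume *: "augmentation F FH e" "derivation F FH e d"
    "\<forall>w\<in>carrier FH. w \<otimes>\<^bsub>FH\<^esub> w = \<zero>\<^bsub>FH\<^esub> \<longrightarrow> d w = \<zero>" and v: "v \<in> carrier FH"
  have "d (\<phi> w) = \<zero>" if "w \<in> carrier FG" "w \<otimes>\<^bsub>FG\<^esub> w = \<zero>\<^bsub>FG\<^esub>" for w
    using *(3) phi_hom(1)[OF that(1)] phi_hom(2)[OF that(1) that(1)] that(2) phi_zero by simp
  then have "\<forall>w\<in>carrier FG. d (\<phi> w) = \<zero>"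
    using assms augmentation_pullback[OF *(1)] derivation_pullback[OF *(2)]
    unfolding square_zero_separates_def by blast
  then show "d v = \<zero>" using phi_psi[OF v] psi_closed[OF v] by metis
qed

lemma iter_square_phi:
  "w \<in> carrier FG \<Longrightarrow> iter_square FH k (\<phi> w) = \<phi> (iter_square FG k w)"
proof (induction k arbitrary: w)
  case (Suc k)
  have "w \<otimes>\<^bsub>FG\<^esub> w \<in> carrier FG" using Suc.prems by (intro A.FG_mult_closed)
  then show ?case
    using Suc.IH[of "w \<otimes>\<^bsub>FG\<^esub> w"] by (simp add: iter_square_Suc phi_hom(2)[OF Suc.prems Suc.prems])
qed simp

lemma coefficient_pullback:
  assumes "g \<in> carrier G"
  shows "linear_functional F FH (\<lambda>v. \<psi> v g)"
proof -
  interpret r: group_algebra_iso F H G \<psi> \<phi> by (rule reverse)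
  have "linear_functional F FG (\<lambda>u. u g)"
    using assms by (auto simp: linear_functional_def A.FG_add_apply A.FG_smult_apply)
  then show ?thesis by (rule r.linear_functional_pullback)
qed

text \<open>The group elements and the coordinate functionals of \<open>FG\<close> are dual to each other, and their
  pairing can be computed in the coordinates of \<open>FH\<close>.\<close>

lemma order_le: "card (carrier G) \<le> card (carrier H)"
proof (rule A.card_le_if_factors[OF A.G.fin B.G.fin])
  fix g g' assume g: "g \<in> carrier G" and g': "g' \<in> carrier G"
  have "(\<lambda>v. \<psi> v g') (\<phi> (A.single g)) = B.pairing (\<lambda>h. \<psi> (B.single h) g') (\<phi> (A.single g))"
    by (rule B.linear_functional_expand[OF coefficient_pullback[OF g'] phi_hom(1)[OF A.single_closed]])
  then show "(\<Oplus>h\<in>carrier H. \<phi> (A.single g) h \<otimes> \<psi> (B.single h) g') = (if g = g' then \<one> else \<zero>)"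
    using g g' by (auto simp: B.pairing_def psi_phi A.single_apply)
next
  fix g h assume "g \<in> carrier G" "h \<in> carrier H"
  then show "\<phi> (A.single g) h \<in> carrier F" "\<psi> (B.single h) g \<in> carrier F"
    using phi_hom(1)[OF A.single_closed] psi_closed[OF B.single_closed] by blast+
qed

lemma coefficient_trace:
  assumes "z \<in> center G"
  shows "trace_functional F FG (\<lambda>u. u z)"
proof -
  let ?f = "\<lambda>g. if g = z then \<one> else \<zero>"
  have z: "z \<in> carrier G" using assms by (rule centerD(1))
  have "trace_functional F FG (A.pairing ?f)"
  proof (rule A.trace_of_class_function)
    fix g h assume g: "g \<in> carrier G" and h: "h \<in> carrier G"
    have "g' \<otimes>\<^bsub>G\<^esub> h' = z" if "h' \<otimes>\<^bsub>G\<^esub> g' = z" "g' \<in> carrier G" "h' \<in> carrier G" for g' h'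
    proof -
      have "g' = inv\<^bsub>G\<^esub> h' \<otimes>\<^bsub>G\<^esub> z" using that A.G.inv_solve_left[of g' h' z] z by auto
      also have "\<dots> = z \<otimes>\<^bsub>G\<^esub> inv\<^bsub>G\<^esub> h'" using centerD(2)[OF assms] that by simp
      finally show ?thesis using that z by (simp add: A.G.m_assoc)
    qed
    then show "?f (g \<otimes>\<^bsub>G\<^esub> h) = ?f (h \<otimes>\<^bsub>G\<^esub> g)" using g h by auto
  qed auto
  moreover have "A.pairing ?f u = u z" if u: "u \<in> carrier FG" for u
  proof -
    have "A.pairing ?f u = (\<Oplus>x\<in>carrier G. (if x = z then \<one> else \<zero>) \<otimes> u x)"
      unfolding A.pairing_def using u by (intro A.finsum_cong') auto
    also have "\<dots> = u z" using u z by (intro A.sum_delta) auto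
    finally show ?thesis .
  qed
  ultimately show ?thesis
    using A.FG_mult_closed ring.ring_simprules(1)[OF A.FG_ring]
      module.smult_closed[OF A.FG_module] z
    unfolding trace_functional_def linear_functional_def
    by (auto simp: A.FG_add_apply A.FG_smult_apply)
qed

text \<open>The coefficient at a central element is a trace, and a trace of a central element of \<open>FH\<close> only
  depends on the coefficients at the centre of \<open>H\<close>.\<close>

lemma card_center_le: "card (center G) \<le> card (center H)"
proof (rule A.card_le_if_factors)
  interpret r: group_algebra_iso F H G \<psi> \<phi> by (rule reverse)
  show "finite (center G)" "finite (center H)"
    using A.G.fin A.G.center_subset B.G.fin B.G.center_subset finite_subset by blast+
  fix g g' assume g: "g \<in> center G" and g': "g' \<in> center G"
  have "(\<lambda>v. \<psi> v g') (\<phi> (A.single g)) =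
      (\<Oplus>h\<in>center H. \<phi> (A.single g) h \<otimes> (\<lambda>v. \<psi> v g') (B.single h))"
    by (rule B.trace_on_center[OF r.trace_pullback[OF coefficient_trace[OF g']]
          phi_center[OF A.single_in_center[OF g]]])
  then show "(\<Oplus>h\<in>center H. \<phi> (A.single g) h \<otimes> \<psi> (B.single h) g') = (if g = g' then \<one> else \<zero>)"
    using centerD(1)[OF g] centerD(1)[OF g'] by (auto simp: psi_phi A.single_apply)
next
  fix g h assume "g \<in> center G" "h \<in> center H"
  then show "\<phi> (A.single g) h \<in> carrier F" "\<psi> (B.single h) g \<in> carrier F"
    using A.FG_closed_apply[OF psi_closed[OF B.single_closed] centerD(1)]
      B.FG_closed_apply[OF phi_hom(1)[OF A.single_closed] centerD(1)] by auto
qed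

text \<open>If \<open>z^(2^k)\<close> is not 1, the coefficient at \<open>z^(2^k)\<close> is a trace that does not vanish on the
  iterated square of \<open>z + 1\<close>.  If \<open>2^k\<close> annihilated the centre of \<open>H\<close>, all traces of the image in
  \<open>FH\<close> would vanish by \<open>iter_square_vanishes\<close>.\<close>

lemma center_exponent:
  assumes "\<And>h. h \<in> center H \<Longrightarrow> h [^]\<^bsub>H\<^esub> ((2::nat) ^ k) = \<one>\<^bsub>H\<^esub>" and z: "z \<in> center G"
  shows "z [^]\<^bsub>G\<^esub> ((2::nat) ^ k) = \<one>\<^bsub>G\<^esub>"
proof (rule ccontr)
  interpret r: group_algebra_iso F H G \<psi> \<phi> by (rule reverse)
  interpret FG: ring FG by (rule A.FG_ring)
  interpret FH: ring FH by (rule B.FG_ring)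
  assume ne: "z [^]\<^bsub>G\<^esub> ((2::nat) ^ k) \<noteq> \<one>\<^bsub>G\<^esub>"
  define t where "t = z [^]\<^bsub>G\<^esub> ((2::nat) ^ k)"
  have zc: "z \<in> carrier G" using z by (rule centerD(1))
  have tz: "t \<in> center G" "t \<in> carrier G"
    unfolding t_def using A.G.center_pow_closed[OF z] zc by auto
  define w where "w = A.single z \<oplus>\<^bsub>FG\<^esub> \<one>\<^bsub>FG\<^esub>"
  have wc: "w \<in> carrier FG" by (simp add: w_def)
  have w: "w \<in> center FG"
  proof (rule centerI[OF wc])
    fix v assume v: "v \<in> carrier FG"
    show "w \<otimes>\<^bsub>FG\<^esub> v = v \<otimes>\<^bsub>FG\<^esub> w"
      unfolding w_def using v centerD(2)[OF A.single_in_center[OF z] v]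
      by (simp add: FG.l_distr FG.r_distr)
  qed
  have aw: "A.aug w = \<zero>"
    using A.aug_augmentation A.aug_single[OF zc] A.one_add_one unfolding w_def
    by (simp add: augmentation_def linear_functional_def)
  have "iter_square FH k (\<phi> w) \<in> center FH \<and> (\<forall>h\<in>center H. iter_square FH k (\<phi> w) h = \<zero>)"
    using phi_center[OF w] aug_phi[OF wc] aw assms(1) by (intro B.iter_square_vanishes) auto
  then have v: "\<phi> (iter_square FG k w) \<in> center FH"
    and v0: "\<And>h. h \<in> center H \<Longrightarrow> \<phi> (iter_square FG k w) h = \<zero>"
    unfolding iter_square_phi[OF wc] by auto
  have it: "iter_square FG k w = A.single t \<oplus>\<^bsub>FG\<^esub> \<one>\<^bsub>FG\<^esub>"
    unfolding w_def t_def by (rule A.iter_square_single[OF zc])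
  have "(\<lambda>v. \<psi> v t) (\<phi> (iter_square FG k w)) =
      (\<Oplus>h\<in>center H. \<phi> (iter_square FG k w) h \<otimes> (\<lambda>v. \<psi> v t) (B.single h))"
    by (rule B.trace_on_center[OF r.trace_pullback[OF coefficient_trace[OF tz(1)]] v])
  also have "\<dots> = (\<Oplus>h\<in>center H. \<zero>)"
    using v0 tz psi_closed[OF B.single_closed] by (intro A.finsum_cong') auto
  finally have "iter_square FG k w t = \<zero>"
    by (simp add: it psi_phi)
  then show False
    using ne tz unfolding it t_def[symmetric]
    by (simp add: A.FG_add_apply A.one_eq_single A.single_apply)
qed

text \<open>The indicator functions of the cosets of \<open>center_derived G\<close> are dual to coset representatives.
  Carried over to \<open>FH\<close> they are constant on the cosets of \<open>center_derived H\<close>, so the pairing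
  factors through these cosets.\<close>

lemma index_center_derived_le:
  "card (rcosets\<^bsub>G\<^esub> center_derived G) \<le> card (rcosets\<^bsub>H\<^esub> center_derived H)"
proof -
  interpret r: group_algebra_iso F H G \<psi> \<phi> by (rule reverse)
  define kG where "kG g = center_derived G #>\<^bsub>G\<^esub> g" for g
  define kH where "kH h = center_derived H #>\<^bsub>H\<^esub> h" for h
  have IG: "rcosets\<^bsub>G\<^esub> center_derived G = kG ` carrier G"
    by (auto simp: RCOSETS_def kG_def)
  have IH: "rcosets\<^bsub>H\<^esub> center_derived H = kH ` carrier H"
    by (auto simp: RCOSETS_def kH_def)
  define rG where "rG = inv_into (carrier G) kG"
  define rH where "rH = inv_into (carrier H) kH"
  have rG: "rG K \<in> carrier G" "kG (rG K) = K" if "K \<in> kG ` carrier G" for K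
    using that by (simp_all add: rG_def inv_into_into f_inv_into_f)
  have rH: "rH K \<in> carrier H" "kH (rH K) = K" if "K \<in> kH ` carrier H" for K
    using that by (simp_all add: rH_def inv_into_into f_inv_into_f)
  have kG_eq: "kG (g \<otimes>\<^bsub>G\<^esub> n) = kG g" if g: "g \<in> carrier G" and n: "n \<in> center_derived G" for g n
  proof -
    have nc: "n \<in> carrier G" using n subgroup.mem_carrier[OF A.G.center_derived_subgroup] by blast
    have m: "g \<otimes>\<^bsub>G\<^esub> n \<otimes>\<^bsub>G\<^esub> inv\<^bsub>G\<^esub> g \<in> center_derived G"
      using A.G.center_derived_normal g n by (simp add: A.G.normal_inv_iff)
    have "g \<otimes>\<^bsub>G\<^esub> n = (g \<otimes>\<^bsub>G\<^esub> n \<otimes>\<^bsub>G\<^esub> inv\<^bsub>G\<^esub> g) \<otimes>\<^bsub>G\<^esub> g" using g nc by (simp add: A.G.m_assoc)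
    then have "g \<otimes>\<^bsub>G\<^esub> n \<in> kG g" unfolding kG_def r_coset_def using m by blast
    then show ?thesis
      unfolding kG_def using A.G.repr_independence[OF _ g A.G.center_derived_subgroup] by auto
  qed
  have kH_eq: "\<exists>n\<in>center_derived H. h' = h \<otimes>\<^bsub>H\<^esub> n"
    if h: "h \<in> carrier H" and h': "h' \<in> carrier H" and e: "kH h = kH h'" for h h'
  proof -
    have "h' \<in> kH h'" unfolding kH_def by (rule B.G.rcos_self[OF h' B.G.center_derived_subgroup])
    then have "h' \<in> kH h" by (simp only: e)
    then obtain m where m: "m \<in> center_derived H" "h' = m \<otimes>\<^bsub>H\<^esub> h" by (auto simp: kH_def r_coset_def)
    have mc: "m \<in> carrier H" using m subgroup.mem_carrier[OF B.G.center_derived_subgroup] by blast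
    have "inv\<^bsub>H\<^esub> h \<otimes>\<^bsub>H\<^esub> m \<otimes>\<^bsub>H\<^esub> inv\<^bsub>H\<^esub> (inv\<^bsub>H\<^esub> h) \<in> center_derived H"
      using B.G.center_derived_normal B.G.inv_closed[OF h] m(1) unfolding B.G.normal_inv_iff by blast
    moreover have "h' = h \<otimes>\<^bsub>H\<^esub> (inv\<^bsub>H\<^esub> h \<otimes>\<^bsub>H\<^esub> m \<otimes>\<^bsub>H\<^esub> inv\<^bsub>H\<^esub> (inv\<^bsub>H\<^esub> h))"
      using h mc m(2) by (simp add: B.G.m_assoc[symmetric])
    ultimately show ?thesis by blast
  qed
  define f where "f K g = (if kG g = K then \<one> else \<zero>)" for K g
  define L where "L K v = A.pairing (f K) (\<psi> v)" for K v
  have fc: "f K \<in> carrier G \<rightarrow> carrier F" for K by (auto simp: f_def)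
  have Lca: "central_abelian_functional F FH B.aug (L K)" for K
    unfolding L_def
    by (rule r.central_abelian_pullback[OF A.central_abelian_of_coset_function[OF fc]])
      (auto simp: f_def kG_eq)
  have Llin: "linear_functional F FH (L K)" for K
    using Lca by (simp add: central_abelian_functional_def)
  have Lc: "L K (B.single h) \<in> carrier F" for K h
    by (rule B.linear_functional_closed[OF Llin B.single_closed])
  have Lcos: "L K (B.single h) = L K (B.single (rH (kH h)))" if h: "h \<in> carrier H" for K h
  proof -
    have r: "rH (kH h) \<in> carrier H" "kH (rH (kH h)) = kH h" using rH[of "kH h"] h by auto
    obtain n where "n \<in> center_derived H" "rH (kH h) = h \<otimes>\<^bsub>H\<^esub> n"
      using kH_eq[OF h r(1)] r(2) by metis
    then show ?thesis using B.central_abelian_single[OF Lca _ h] by simp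
  qed
  have pc: "\<phi> (A.single g) h \<in> carrier F" if "h \<in> carrier H" for g h
    using phi_hom(1)[OF A.single_closed] that by auto
  \<comment> \<open>sums the coefficients of the image of a coset representative over a coset of
    \<open>center_derived H\<close>\<close>
  define P where "P K C = (\<Oplus>h\<in>{h \<in> carrier H. kH h = C}. \<phi> (A.single (rG K)) h)" for K C
  show ?thesis
    unfolding IG IH
  proof (rule A.card_le_if_factors)
    fix K C assume "K \<in> kG ` carrier G" "C \<in> kH ` carrier H"
    show "P K C \<in> carrier F" unfolding P_def using pc by (intro A.finsum_closed) auto
    show "L K (B.single (rH C)) \<in> carrier F" by (rule Lc)
  next
    fix K K' assume K: "K \<in> kG ` carrier G" and K': "K' \<in> kG ` carrier G"
    let ?g = "\<lambda>h. \<phi> (A.single (rG K)) h \<otimes> L K' (B.single h)"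
    have "(\<Oplus>C\<in>kH ` carrier H. P K C \<otimes> L K' (B.single (rH C))) =
        (\<Oplus>C\<in>kH ` carrier H. finsum F ?g {h \<in> carrier H. kH h = C})"
    proof (rule A.finsum_cong')
      fix C assume "C \<in> kH ` carrier H"
      have "P K C \<otimes> L K' (B.single (rH C)) =
          (\<Oplus>h\<in>{h \<in> carrier H. kH h = C}. \<phi> (A.single (rG K)) h \<otimes> L K' (B.single (rH C)))"
        unfolding P_def using pc Lc B.G.fin by (intro A.finsum_ldistr) auto
      also have "\<dots> = finsum F ?g {h \<in> carrier H. kH h = C}"
        using pc Lc Lcos by (intro A.finsum_cong') auto
      finally show "P K C \<otimes> L K' (B.single (rH C)) = finsum F ?g {h \<in> carrier H. kH h = C}" .
    qed (use pc Lc in \<open>auto intro!: A.finsum_closed\<close>)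
    also have "\<dots> = finsum F ?g (\<Union>C\<in>kH ` carrier H. {h \<in> carrier H. kH h = C})"
      using pc Lc B.G.fin
      by (intro A.add.finprod_UN_disjoint[symmetric]) (auto simp: pairwise_def disjnt_def)
    also have "(\<Union>C\<in>kH ` carrier H. {h \<in> carrier H. kH h = C}) = carrier H" by auto
    also have "finsum F ?g (carrier H) = L K' (\<phi> (A.single (rG K)))"
      unfolding B.linear_functional_expand[OF Llin phi_hom(1)[OF A.single_closed]] B.pairing_def ..
    also have "\<dots> = (if K = K' then \<one> else \<zero>)"
      unfolding L_def psi_phi[OF A.single_closed]
      using A.pairing_single[OF rG(1)[OF K] fc] rG(2)[OF K] by (simp add: f_def)
    finally show "(\<Oplus>C\<in>kH ` carrier H. P K C \<otimes> L K' (B.single (rH C))) = (if K = K' then \<one> else \<zero>)" .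
  qed (use A.G.fin B.G.fin in auto)
qed

end

lemma group_algebra_isoI:
  assumes "char2_group_algebra F G" "char2_group_algebra F H"
    and "algebras_isomorphic F (group_algebra F G) (group_algebra F H)"
  obtains \<phi> \<psi> where "group_algebra_iso F G H \<phi> \<psi>"
proof -
  interpret A: char2_group_algebra F G by fact
  interpret B: char2_group_algebra F H by fact
  let ?A = "group_algebra F G" and ?B = "group_algebra F H"
  interpret RA: ring ?A by (rule A.FG_ring)
  interpret MA: module F ?A by (rule A.FG_module)
  obtain \<phi> where \<phi>: "\<phi> \<in> algebra_iso F ?A ?B"
    using assms(3) by (auto simp: algebras_isomorphic_def)
  define \<psi> where "\<psi> = inv_into (carrier ?A) \<phi>"
  have iso: "\<phi> \<in> ring_iso ?A ?B" using \<phi> by (simp add: algebra_iso_def)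
  have bij: "bij_betw \<phi> (carrier ?A) (carrier ?B)" using iso by (simp add: ring_iso_def)
  have r: "\<psi> \<in> ring_iso ?B ?A"
    unfolding \<psi>_def by (rule ring_iso_set_sym[OF RA.ring_axioms iso])
  have inv1: "\<psi> (\<phi> u) = u" if "u \<in> carrier ?A" for u
    using bij that by (simp add: \<psi>_def bij_betw_inv_into_left)
  have inv2: "\<phi> (\<psi> v) = v" if "v \<in> carrier ?B" for v
    using bij that by (simp add: \<psi>_def bij_betw_inv_into_right)
  have cl: "\<psi> v \<in> carrier ?A" if "v \<in> carrier ?B" for v
    using r that by (auto simp: ring_iso_def ring_hom_def)
  have "\<psi> (c \<odot>\<^bsub>?B\<^esub> v) = c \<odot>\<^bsub>?A\<^esub> \<psi> v" if "c \<in> carrier F" "v \<in> carrier ?B" for c v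
  proof -
    have "\<phi> (c \<odot>\<^bsub>?A\<^esub> \<psi> v) = c \<odot>\<^bsub>?B\<^esub> v"
      using \<phi> cl[OF that(2)] that inv2[OF that(2)] by (simp add: algebra_iso_def)
    then show ?thesis using inv1[OF MA.smult_closed[OF that(1) cl[OF that(2)]]] by simp
  qed
  then have "\<psi> \<in> algebra_iso F ?B ?A" using r by (simp add: algebra_iso_def)
  then have "group_algebra_iso F G H \<phi> \<psi>"
    unfolding group_algebra_iso_def group_algebra_iso_axioms_def
    using assms \<phi> inv1 inv2 by blast
  then show ?thesis by (rule that)
qed

section \<open>Coincidences between the families\<close>

context dihedral_ext
begin

lemma generated_by:
  assumes U: "subgroup U G" "x \<in> U" "a \<in> U" "center G \<subseteq> U"
  shows "U = carrier G"
proof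
  show "U \<subseteq> carrier G" by (rule subgroup.subset[OF U(1)])
  show "carrier G \<subseteq> U"
  proof
    fix g assume "g \<in> carrier G"
    then obtain i j e where g: "g = el i j e" using elements by blast
    have "a [^] i \<in> U" "z [^] j \<in> U" "\<one> \<in> U"
      using subgroup_int_pow_closed[OF U(1,3)] U(4) zpow_center subgroup.one_closed[OF U(1)] by auto
    then show "g \<in> U" unfolding g el_def using subgroup.m_closed[OF U(1)] U(2) by simp
  qed
qed

lemma a_notin_center: "a \<notin> center G"
proof
  assume "a \<in> center G"
  then have "a [^] (1::int) \<in> center G" by simp
  then have "2 ^ m dvd (1::int)" unfolding apow_center .
  moreover have "(2::int) dvd 2 ^ m" using m_pos by simp
  ultimately have "(2::int) dvd 1" by (rule dvd_trans[rotated])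
  then show False by simp
qed

lemma center_neq: "center G \<noteq> carrier G"
proof
  assume "center G = carrier G"
  then have "a \<in> center G" using a_closed by (simp only:)
  then show False using a_notin_center by contradiction
qed

end

lemma dihedral_ext_unique:
  assumes "dihedral_ext G a x z s q m c" "dihedral_ext G a' x' z' s' q' m' c'"
  shows "m = m'" "c = c'"
proof -
  interpret A: dihedral_ext G a x z s q m c by fact
  interpret B: dihedral_ext G a' x' z' s' q' m' c' by fact
  show c: "c = c'" using A.card_center B.card_center by simp
  show "m = m'" using A.order_eq B.order_eq c by simp
qed

text \<open>In the dihedral group of order eight \<open>a\<close> is an involution here, as \<open>a^2 = z^2 = 1\<close>, so that \<open>x\<close>
  and \<open>a\<close> can be taken as the two lifts.\<close>

lemma (in dihedral_ext) type_10_order_eight: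
  assumes "s = 1" "q = 0" "m = 1" "c = 1"
  shows "\<exists>a' x' z'. dihedral_ext G a' x' z' 0 0 m c"
proof -
  have r2: "r = 2" unfolding r_def using assms by simp
  have "el 2 0 False = el 0 0 False" unfolding el_eq using assms r2 by simp
  then have aa: "a \<otimes> a = z [^] (0::int)"
    using el_mult(1)[of 1 0 1 0 False] by (simp add: el_gens(1) el_zero)
  have xx: "x \<otimes> x = z [^] (0::int)" using x_x assms by simp
  obtain a' m' c' where D: "dihedral_ext G a' x z (0 + 0 - 2 * (0 * 0)) 0 m' c'"
    using dihedral_ext_of_pair[OF z_closed center_eq x_closed a_closed xx aa _ generated_by center_neq] by auto
  have "m = m'" "c = c'"
    using dihedral_ext_unique[OF dihedral_ext_axioms D] by auto
  then show ?thesis using D by auto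
qed

text \<open>For \<open>m = 1\<close> the square of \<open>a\<close> is the involution \<open>z^(2^(c - 1))\<close>, and for \<open>c \<ge> 2\<close> this is the
  square of a power of \<open>z\<close>.  So a central factor makes \<open>a\<close> an involution, which is then taken as
  the first lift.\<close>

lemma (in dihedral_ext) type_01_modular:
  assumes "s = 0" "q = 1" "m = 1" "2 \<le> c"
  shows "\<exists>a' x' z'. dihedral_ext G a' x' z' 1 0 m c"
proof -
  define w where "w = el 1 (2 ^ (c - 2)) False"
  have c1: "(2::int) ^ (c - 2) + 2 ^ (c - 2) = 2 ^ (c - 1)"
  proof -
    have "Suc (c - 2) = c - 1" using assms(4) by simp
    then show ?thesis using power_Suc[of "2::int" "c - 2"] by simp
  qed
  have c2: "(2::int) ^ (c - 1) + 2 ^ (c - 1) = 2 ^ c" using c_pos by (simp add: power_eq_if)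
  have r1: "r = 2 ^ (c - 1)" unfolding r_def using assms by simp
  have "el (1 + 1) (2 ^ (c - 2) + 2 ^ (c - 2)) False = el 0 0 False"
    unfolding el_eq c1 using assms r1 c2 by simp
  then have ww: "w \<otimes> w = z [^] (0::int)" unfolding w_def el_mult by (simp add: el_zero)
  have xx: "x \<otimes> x = z [^] (1::int)" using x_x assms by simp
  have wc: "w \<in> carrier G" by (simp add: w_def)
  have gen: "U = carrier G" if U: "subgroup U G" "w \<in> U" "x \<in> U" "center G \<subseteq> U" for U
  proof (rule generated_by[OF U(1,3) _ U(4)])
    have "w \<otimes> z [^] (- (2 ^ (c - 2)) :: int) \<in> U"
      using U zpow_center subgroup.m_closed[OF U(1)] by blast
    moreover have "w \<otimes> z [^] (- (2 ^ (c - 2)) :: int) = a"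
      unfolding w_def using el_mult(1)[of 1 "2 ^ (c - 2)" 0 "- (2 ^ (c - 2))" False]
      by (simp add: el_gens(1,4))
    ultimately show "a \<in> U" by simp
  qed
  obtain a' m' c' where D: "dihedral_ext G a' w z (0 + 1 - 2 * (0 * 1)) 0 m' c'"
    using dihedral_ext_of_pair[OF z_closed center_eq wc x_closed ww xx _ gen center_neq] by auto
  have "m = m'" "c = c'"
    using dihedral_ext_unique[OF dihedral_ext_axioms D] by auto
  then show ?thesis using D by auto
qed

context dihedral_ext
begin

definition reflection :: "'a \<Rightarrow> bool" where "reflection g \<longleftrightarrow> (\<exists>i j. g = el i j True)"
text \<open>The exponent of \<open>a\<close> in the normal form is odd, also if \<open>x\<close> occurs.\<close>

definition odd_exponent :: "'a \<Rightarrow> bool" where "odd_exponent g \<longleftrightarrow> (\<exists>i j e. g = el i j e \<and> odd i)"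

lemma reflection_el [simp]: "reflection (el i j e) = e"
proof
  show "reflection (el i j e) \<Longrightarrow> e" unfolding reflection_def el_eq by blast
  show "e \<Longrightarrow> reflection (el i j e)" unfolding reflection_def by auto
qed

lemma odd_exponent_el [simp]: "odd_exponent (el i j e) = odd i"
proof -
  have "odd i" if "el i j e = el k l f" "odd k" for k l f
  proof -
    have "(2::int) dvd 2 ^ m" using m_pos by simp
    then have "2 dvd i - k" using that(1) unfolding el_eq by (meson dvd_trans)
    then show ?thesis using that(2) by presburger
  qed
  then show ?thesis unfolding odd_exponent_def by blast
qed

lemma reflection_mult:
  assumes "g \<in> carrier G" "h \<in> carrier G"
  shows "reflection (g \<otimes> h) \<longleftrightarrow> reflection g \<noteq> reflection h"
proof -
  obtain i j e where g: "g = el i j e" using elements[OF assms(1)] by blast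
  obtain k l f where h: "h = el k l f" using elements[OF assms(2)] by blast
  show ?thesis unfolding g h by (cases e; cases f) (simp_all add: el_mult)
qed

lemma odd_exponent_mult:
  assumes "g \<in> carrier G" "h \<in> carrier G"
  shows "odd_exponent (g \<otimes> h) \<longleftrightarrow> odd_exponent g \<noteq> odd_exponent h"
proof -
  obtain i j e where g: "g = el i j e" using elements[OF assms(1)] by blast
  obtain k l f where h: "h = el k l f" using elements[OF assms(2)] by blast
  show ?thesis unfolding g h by (cases e; cases f) (simp_all add: el_mult)
qed

end

section \<open>Square-zero elements\<close>

context char2_field
begin

text \<open>Off the diagonal the summands for \<open>(y, k)\<close> and \<open>(k, y)\<close> cancel.\<close>

lemma symmetric_double_sum:
  assumes "finite S" "\<And>y k. y \<in> S \<Longrightarrow> k \<in> S \<Longrightarrow> h y k \<in> carrier F"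
    and "\<And>y k. y \<in> S \<Longrightarrow> k \<in> S \<Longrightarrow> h y k = h k y"
  shows "(\<Oplus>y\<in>S. \<Oplus>k\<in>S. h y k) = (\<Oplus>y\<in>S. h y y)"
  using assms
proof (induction S rule: finite_induct)
  case (insert b S)
  have c: "h y k \<in> carrier F" if "y \<in> insert b S" "k \<in> insert b S" for y k
    using insert.prems(1) that .
  have rc: "(\<Oplus>k\<in>S. h y k) \<in> carrier F" if "y \<in> insert b S" for y
    using c that by (intro finsum_closed) auto
  have inner: "(\<Oplus>k\<in>insert b S. h y k) = h y b \<oplus> (\<Oplus>k\<in>S. h y k)" if "y \<in> insert b S" for y
    using insert.hyps c that by (intro finsum_insert) auto
  have "(\<Oplus>y\<in>insert b S. \<Oplus>k\<in>insert b S. h y k) = (\<Oplus>y\<in>insert b S. h y b \<oplus> (\<Oplus>k\<in>S. h y k))"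
    using inner c rc by (intro finsum_cong') auto
  also have "\<dots> = (h b b \<oplus> (\<Oplus>k\<in>S. h b k)) \<oplus> (\<Oplus>y\<in>S. h y b \<oplus> (\<Oplus>k\<in>S. h y k))"
    using insert.hyps c rc by (intro finsum_insert) auto
  also have "(\<Oplus>y\<in>S. h y b \<oplus> (\<Oplus>k\<in>S. h y k)) = (\<Oplus>y\<in>S. h y b) \<oplus> (\<Oplus>y\<in>S. \<Oplus>k\<in>S. h y k)"
    using c rc by (intro finsum_addf) auto
  also have "(\<Oplus>y\<in>S. h y b) = (\<Oplus>k\<in>S. h b k)"
    using c insert.prems(2) by (intro finsum_cong') auto
  also have "(\<Oplus>y\<in>S. \<Oplus>k\<in>S. h y k) = (\<Oplus>y\<in>S. h y y)"
    using insert by (intro insert.IH) auto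
  also have "(h b b \<oplus> (\<Oplus>k\<in>S. h b k)) \<oplus> ((\<Oplus>k\<in>S. h b k) \<oplus> (\<Oplus>y\<in>S. h y y)) = h b b \<oplus> (\<Oplus>y\<in>S. h y y)"
  proof -
    have *: "h b b \<in> carrier F" "(\<Oplus>k\<in>S. h b k) \<in> carrier F" "(\<Oplus>y\<in>S. h y y) \<in> carrier F"
      using c rc by (auto intro!: finsum_closed)
    have "(h b b \<oplus> (\<Oplus>k\<in>S. h b k)) \<oplus> ((\<Oplus>k\<in>S. h b k) \<oplus> (\<Oplus>y\<in>S. h y y)) =
        h b b \<oplus> (((\<Oplus>k\<in>S. h b k) \<oplus> (\<Oplus>k\<in>S. h b k)) \<oplus> (\<Oplus>y\<in>S. h y y))"
      using * by (simp only: a_assoc a_closed)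
    then show ?thesis using * by simp
  qed
  also have "\<dots> = (\<Oplus>y\<in>insert b S. h y y)"
    using insert.hyps c by (intro finsum_insert[symmetric]) auto
  finally show ?case .
qed simp

lemma finsum_indicator:
  assumes "finite S" "f \<in> S \<rightarrow> carrier F"
  shows "(\<Oplus>y\<in>S. f y \<otimes> (if P y then \<one> else \<zero>)) = finsum F f {y \<in> S. P y}"
proof -
  have "(\<Oplus>y\<in>S. f y \<otimes> (if P y then \<one> else \<zero>)) =
     finsum F (\<lambda>y. f y \<otimes> (if P y then \<one> else \<zero>)) {y \<in> S. P y} \<oplus>
     finsum F (\<lambda>y. f y \<otimes> (if P y then \<one> else \<zero>)) {y \<in> S. \<not> P y}"
    using assms by (intro finsum_split) auto
  also have "finsum F (\<lambda>y. f y \<otimes> (if P y then \<one> else \<zero>)) {y \<in> S. P y} = finsum F f {y \<in> S. P y}"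
    using assms by (intro finsum_cong') (auto simp: Pi_iff)
  also have "finsum F (\<lambda>y. f y \<otimes> (if P y then \<one> else \<zero>)) {y \<in> S. \<not> P y} = (\<Oplus>y\<in>{y \<in> S. \<not> P y}. \<zero>)"
    using assms by (intro finsum_cong') (auto simp: Pi_iff)
  finally show ?thesis using assms finsum_closed[of f "{y \<in> S. P y}"] by (auto simp: Pi_iff)
qed

end

context char2_group_algebra
begin

definition indicator_fun :: "('g \<Rightarrow> bool) \<Rightarrow> 'g \<Rightarrow> 'f" where
  "indicator_fun P g = (if P g then \<one> else \<zero>)"

lemma indicator_fun_closed [simp]: "indicator_fun P \<in> carrier G \<rightarrow> carrier F" "indicator_fun P g \<in> carrier F"
  by (auto simp: indicator_fun_def)

lemma pairing_indicator:
  "w \<in> carrier FG \<Longrightarrow> pairing (indicator_fun P) w = finsum F w {g \<in> carrier G. P g}"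
  unfolding pairing_def indicator_fun_def using G.fin by (intro finsum_indicator) auto

lemma pairing_zero: "f \<in> carrier G \<rightarrow> carrier F \<Longrightarrow> pairing f \<zero>\<^bsub>FG\<^esub> = \<zero>"
proof -
  assume f: "f \<in> carrier G \<rightarrow> carrier F"
  have "pairing f \<zero>\<^bsub>FG\<^esub> = (\<Oplus>g\<in>carrier G. \<zero>)"
    unfolding pairing_def using f by (intro finsum_cong') (auto simp: group_algebra_def Pi_iff)
  then show ?thesis by simp
qed

text \<open>The coefficients of \<open>w^2\<close> on the set described by \<open>P\<close> have the sum \<open>w y w k\<close> over all pairs with
  \<open>y k\<close> in the set.  The pairs \<open>(y, k)\<close> and \<open>(k, y)\<close> cancel, and the diagonal leaves a sum of
  squares, which is the square of the sum in question.\<close>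

lemma square_zero_roots:
  assumes w: "w \<in> carrier FG" and ww: "w \<otimes>\<^bsub>FG\<^esub> w = \<zero>\<^bsub>FG\<^esub>"
    and S: "\<And>g h. g \<in> carrier G \<Longrightarrow> h \<in> carrier G \<Longrightarrow> P (g \<otimes>\<^bsub>G\<^esub> h) = P (h \<otimes>\<^bsub>G\<^esub> g)"
  shows "finsum F w {y \<in> carrier G. P (y \<otimes>\<^bsub>G\<^esub> y)} = \<zero>"
proof -
  let ?Y = "{y \<in> carrier G. P (y \<otimes>\<^bsub>G\<^esub> y)}"
  let ?f = "indicator_fun P"
  have fY: "finite ?Y" using G.fin by simp
  have "\<zero> = (\<Oplus>y\<in>carrier G. \<Oplus>k\<in>carrier G. w y \<otimes> w k \<otimes> ?f (y \<otimes>\<^bsub>G\<^esub> k))"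
    using pairing_mult[OF indicator_fun_closed(1) w w, of P] ww pairing_zero[OF indicator_fun_closed(1)] by simp
  also have "\<dots> = (\<Oplus>y\<in>carrier G. w y \<otimes> w y \<otimes> ?f (y \<otimes>\<^bsub>G\<^esub> y))"
    using G.fin w S by (intro symmetric_double_sum) (auto simp: m_comm indicator_fun_def)
  also have "\<dots> = finsum F (\<lambda>y. w y \<otimes> w y) ?Y"
    unfolding indicator_fun_def using G.fin w by (intro finsum_indicator) auto
  also have "\<dots> = finsum F w ?Y \<otimes> finsum F w ?Y"
    using fY w by (intro finsum_square[symmetric]) auto
  finally show ?thesis
    using square_eq_zero_iff[of "finsum F w ?Y"] w by (simp add: finsum_closed Pi_iff)
qed

lemma parity_derivation:
  assumes P: "\<And>g h. g \<in> carrier G \<Longrightarrow> h \<in> carrier G \<Longrightarrow> P (g \<otimes>\<^bsub>G\<^esub> h) \<longleftrightarrow> P g \<noteq> P h"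
  shows "derivation F FG aug (pairing (indicator_fun P))"
  by (rule derivation_of_hom) (auto simp: indicator_fun_def P one_add_one)

text \<open>Each squaring of \<open>B\<close> moves its support to squares inside the abelian subgroup, so that some
  iterated square of \<open>B\<close> is a nonzero scalar.\<close>

lemma abelian_support_cancel:
  assumes A: "subgroup A G" and comm: "\<And>u v. u \<in> A \<Longrightarrow> v \<in> A \<Longrightarrow> u \<otimes>\<^bsub>G\<^esub> v = v \<otimes>\<^bsub>G\<^esub> u"
    and T: "T \<in> carrier FG"
  shows "B \<in> carrier FG \<Longrightarrow>
    (\<And>g. g \<in> carrier G \<Longrightarrow> B g \<noteq> \<zero> \<Longrightarrow> g \<in> A \<and> g [^]\<^bsub>G\<^esub> ((2::nat) ^ n) = \<one>\<^bsub>G\<^esub>) \<Longrightarrow>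
    aug B \<noteq> \<zero> \<Longrightarrow> B \<otimes>\<^bsub>FG\<^esub> T = \<zero>\<^bsub>FG\<^esub> \<Longrightarrow> g \<in> carrier G \<Longrightarrow> T g = \<zero>"
proof (induction n arbitrary: B)
  case 0
  have one: "\<one>\<^bsub>G\<^esub> \<in> carrier G" by simp
  have B0: "B g = \<zero>" if "g \<in> carrier G" "g \<noteq> \<one>\<^bsub>G\<^esub>" for g using 0(2)[OF that(1)] that by auto
  have delta: "(\<Oplus>y\<in>carrier G. B y \<otimes> f y) = B \<one>\<^bsub>G\<^esub> \<otimes> f \<one>\<^bsub>G\<^esub>" if f: "f \<in> carrier G \<rightarrow> carrier F" for f
  proof -
    have "(\<Oplus>y\<in>carrier G. B y \<otimes> f y) = (\<Oplus>y\<in>carrier G. if \<one>\<^bsub>G\<^esub> = y then B y \<otimes> f y else \<zero>)"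
      using B0 0(1) f by (intro finsum_cong') (auto simp: Pi_iff)
    also have "\<dots> = B \<one>\<^bsub>G\<^esub> \<otimes> f \<one>\<^bsub>G\<^esub>"
      using 0(1) f G.fin by (intro finsum_singleton) auto
    finally show ?thesis .
  qed
  have aB: "aug B = B \<one>\<^bsub>G\<^esub>" unfolding aug_def pairing_def using delta[of "\<lambda>_. \<one>"] 0(1) by simp
  have "(B \<otimes>\<^bsub>FG\<^esub> T) g = B \<one>\<^bsub>G\<^esub> \<otimes> T g"
    unfolding FG_mult_apply[OF 0(5)] using T 0(5) by (subst delta) auto
  moreover have "(B \<otimes>\<^bsub>FG\<^esub> T) g = \<zero>" unfolding 0(4) using 0(5) by (simp add: group_algebra_def)
  ultimately show ?case using aB 0(1,3,5) T integral[of "B \<one>\<^bsub>G\<^esub>" "T g"] by auto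
next
  case (Suc n)
  interpret FG: ring FG by (rule FG_ring)
  interpret A: subgroup A G by (rule A)
  have Bc: "B \<in> carrier FG" by (rule Suc.prems(1))
  show ?case
  proof (rule Suc.IH)
    show "B \<otimes>\<^bsub>FG\<^esub> B \<in> carrier FG" using Bc by simp
    show "aug (B \<otimes>\<^bsub>FG\<^esub> B) \<noteq> \<zero>" unfolding aug_mult[OF Bc Bc] using Suc.prems(3) Bc square_eq_zero_iff by simp
    have "B \<otimes>\<^bsub>FG\<^esub> B \<otimes>\<^bsub>FG\<^esub> T = B \<otimes>\<^bsub>FG\<^esub> (B \<otimes>\<^bsub>FG\<^esub> T)" using Bc T by (intro FG.m_assoc)
    then show "B \<otimes>\<^bsub>FG\<^esub> B \<otimes>\<^bsub>FG\<^esub> T = \<zero>\<^bsub>FG\<^esub>" using Suc.prems(4) Bc by simp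
    show "g \<in> carrier G" by (rule Suc.prems(5))
    fix h assume h: "h \<in> carrier G" and ne: "(B \<otimes>\<^bsub>FG\<^esub> B) h \<noteq> \<zero>"
    let ?Y = "{y \<in> carrier G. y \<in> A \<and> inv\<^bsub>G\<^esub> y \<otimes>\<^bsub>G\<^esub> h \<in> A}"
    let ?b = "\<lambda>y. B y \<otimes> B (inv\<^bsub>G\<^esub> y \<otimes>\<^bsub>G\<^esub> h)"
    have bc: "?b \<in> carrier G \<rightarrow> carrier F" using Bc h by auto
    have cY: "finsum F ?b {y \<in> ?Y. inv\<^bsub>G\<^esub> y \<otimes>\<^bsub>G\<^esub> h = y} \<in> carrier F"
      using bc by (intro finsum_closed) auto
    have "(B \<otimes>\<^bsub>FG\<^esub> B) h = finsum F ?b ?Y \<oplus> finsum F ?b {y \<in> carrier G. \<not> (y \<in> A \<and> inv\<^bsub>G\<^esub> y \<otimes>\<^bsub>G\<^esub> h \<in> A)}"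
      unfolding FG_mult_apply[OF h] by (rule finsum_split[OF G.fin bc])
    also have "finsum F ?b {y \<in> carrier G. \<not> (y \<in> A \<and> inv\<^bsub>G\<^esub> y \<otimes>\<^bsub>G\<^esub> h \<in> A)} =
        (\<Oplus>y\<in>{y \<in> carrier G. \<not> (y \<in> A \<and> inv\<^bsub>G\<^esub> y \<otimes>\<^bsub>G\<^esub> h \<in> A)}. \<zero>)"
    proof (rule finsum_cong')
      fix y assume y: "y \<in> {y \<in> carrier G. \<not> (y \<in> A \<and> inv\<^bsub>G\<^esub> y \<otimes>\<^bsub>G\<^esub> h \<in> A)}"
      then have "B y = \<zero> \<or> B (inv\<^bsub>G\<^esub> y \<otimes>\<^bsub>G\<^esub> h) = \<zero>"
        using Suc.prems(2)[of y] Suc.prems(2)[of "inv\<^bsub>G\<^esub> y \<otimes>\<^bsub>G\<^esub> h"] h by blast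
      then show "?b y = \<zero>" using y Bc h by auto
    qed auto
    also have "finsum F ?b ?Y = finsum F ?b {y \<in> ?Y. inv\<^bsub>G\<^esub> y \<otimes>\<^bsub>G\<^esub> h = y}"
    proof (rule finsum_involution)
      show "finite ?Y" using G.fin by simp
      show "?b \<in> ?Y \<rightarrow> carrier F" using bc by auto
      fix y assume y: "y \<in> ?Y"
      then have yc: "y \<in> carrier G" "y \<in> A" "inv\<^bsub>G\<^esub> y \<otimes>\<^bsub>G\<^esub> h \<in> A" by auto
      have hA: "h \<in> A"
      proof -
        have "y \<otimes>\<^bsub>G\<^esub> (inv\<^bsub>G\<^esub> y \<otimes>\<^bsub>G\<^esub> h) \<in> A" by (rule A.m_closed[OF yc(2,3)])
        then show ?thesis using yc h by (simp add: G.m_assoc[symmetric])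
      qed
      have inv: "inv\<^bsub>G\<^esub> (inv\<^bsub>G\<^esub> y \<otimes>\<^bsub>G\<^esub> h) \<otimes>\<^bsub>G\<^esub> h = y"
      proof -
        have "inv\<^bsub>G\<^esub> (inv\<^bsub>G\<^esub> y \<otimes>\<^bsub>G\<^esub> h) \<otimes>\<^bsub>G\<^esub> h = inv\<^bsub>G\<^esub> h \<otimes>\<^bsub>G\<^esub> (y \<otimes>\<^bsub>G\<^esub> h)"
          using yc h by (simp add: G.inv_mult_group G.m_assoc)
        also have "y \<otimes>\<^bsub>G\<^esub> h = h \<otimes>\<^bsub>G\<^esub> y" by (rule comm[OF yc(2) hA])
        finally show ?thesis using yc h by (simp add: G.m_assoc[symmetric])
      qed
      show "inv\<^bsub>G\<^esub> y \<otimes>\<^bsub>G\<^esub> h \<in> ?Y"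
        unfolding mem_Collect_eq inv by (intro conjI G.m_closed G.inv_closed yc h)
      show "inv\<^bsub>G\<^esub> (inv\<^bsub>G\<^esub> y \<otimes>\<^bsub>G\<^esub> h) \<otimes>\<^bsub>G\<^esub> h = y" by (rule inv)
      show "?b (inv\<^bsub>G\<^esub> y \<otimes>\<^bsub>G\<^esub> h) = ?b y" unfolding inv using Bc yc h by (intro m_comm) auto
    qed
    finally have e: "(B \<otimes>\<^bsub>FG\<^esub> B) h = finsum F ?b {y \<in> ?Y. inv\<^bsub>G\<^esub> y \<otimes>\<^bsub>G\<^esub> h = y}"
      by (simp only: finsum_zero r_zero[OF cY])
    have "\<exists>y\<in>?Y. inv\<^bsub>G\<^esub> y \<otimes>\<^bsub>G\<^esub> h = y \<and> ?b y \<noteq> \<zero>"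
    proof (rule ccontr)
      assume "\<not> ?thesis"
      then have "finsum F ?b {y \<in> ?Y. inv\<^bsub>G\<^esub> y \<otimes>\<^bsub>G\<^esub> h = y} = (\<Oplus>y\<in>{y \<in> ?Y. inv\<^bsub>G\<^esub> y \<otimes>\<^bsub>G\<^esub> h = y}. \<zero>)"
        by (intro finsum_cong') auto
      then show False using e ne by simp
    qed
    then obtain y where y: "y \<in> carrier G" "y \<in> A" "inv\<^bsub>G\<^esub> y \<otimes>\<^bsub>G\<^esub> h = y" "?b y \<noteq> \<zero>" by blast
    have hy: "h = y \<otimes>\<^bsub>G\<^esub> y" using y(1,3) h G.inv_solve_left'[of y y h] by simp
    have "B y \<noteq> \<zero>" using y(4) Bc h y(1) by auto
    then have "y [^]\<^bsub>G\<^esub> ((2::nat) ^ Suc n) = \<one>\<^bsub>G\<^esub>" using Suc.prems(2)[OF y(1)] by blast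
    then show "h \<in> A \<and> h [^]\<^bsub>G\<^esub> ((2::nat) ^ n) = \<one>\<^bsub>G\<^esub>"
      unfolding hy G.square_pow[OF y(1)] using y(2) by simp
  qed
qed

text \<open>Write \<open>w = \<alpha> + \<beta> x\<close> with \<open>\<alpha>\<close> and \<open>\<beta>\<close> supported on \<open>A\<close>.  As \<open>A\<close> is
  abelian, the part of \<open>w^2\<close> outside \<open>A\<close> is \<open>\<beta>\<close> times \<open>\<alpha> + x \<alpha> x^(-1)\<close>, up to
  the factor \<open>x\<close>.  The augmentation of \<open>\<beta>\<close> is nonzero, so \<open>\<beta>\<close> can be cancelled.\<close>

lemma square_zero_invariant:
  assumes A: "subgroup A G" and comm: "\<And>u v. u \<in> A \<Longrightarrow> v \<in> A \<Longrightarrow> u \<otimes>\<^bsub>G\<^esub> v = v \<otimes>\<^bsub>G\<^esub> u"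
    and x: "x \<in> carrier G" "x \<notin> A"
    and out: "\<And>g. g \<in> carrier G \<Longrightarrow> g \<notin> A \<Longrightarrow> g \<otimes>\<^bsub>G\<^esub> inv\<^bsub>G\<^esub> x \<in> A"
    and w: "w \<in> carrier FG" and ww: "w \<otimes>\<^bsub>FG\<^esub> w = \<zero>\<^bsub>FG\<^esub>"
    and ne: "finsum F w {g \<in> carrier G. g \<notin> A} \<noteq> \<zero>"
    and g: "g \<in> A"
  shows "w (inv\<^bsub>G\<^esub> x \<otimes>\<^bsub>G\<^esub> g \<otimes>\<^bsub>G\<^esub> x) = w g"
proof -
  interpret A: subgroup A G by (rule A)
  note Ac = A.mem_carrier
  have fA: "finite A" by (rule finite_subset[OF A.subset G.fin])
  have Aeq: "{g \<in> carrier G. g \<in> A} = A" using A.subset by auto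
  have reidx: "finsum F f {g \<in> carrier G. g \<notin> A} = finsum F (\<lambda>u. f (u \<otimes>\<^bsub>G\<^esub> x)) A"
    if f: "f \<in> carrier G \<rightarrow> carrier F" for f
  proof -
    have inj: "inj_on (\<lambda>u. u \<otimes>\<^bsub>G\<^esub> x) A" using x Ac by (auto intro!: inj_onI)
    have im: "(\<lambda>u. u \<otimes>\<^bsub>G\<^esub> x) ` A = {g \<in> carrier G. g \<notin> A}"
    proof
      show "(\<lambda>u. u \<otimes>\<^bsub>G\<^esub> x) ` A \<subseteq> {g \<in> carrier G. g \<notin> A}"
      proof
        fix y assume "y \<in> (\<lambda>u. u \<otimes>\<^bsub>G\<^esub> x) ` A"
        then obtain u where u: "u \<in> A" "y = u \<otimes>\<^bsub>G\<^esub> x" by blast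
        have "y \<notin> A"
        proof
          assume "y \<in> A"
          then have "inv\<^bsub>G\<^esub> u \<otimes>\<^bsub>G\<^esub> y \<in> A" using u by simp
          then show False using u x Ac by (simp add: G.m_assoc[symmetric])
        qed
        then show "y \<in> {g \<in> carrier G. g \<notin> A}" using u x Ac by simp
      qed
      show "{g \<in> carrier G. g \<notin> A} \<subseteq> (\<lambda>u. u \<otimes>\<^bsub>G\<^esub> x) ` A"
      proof
        fix y assume "y \<in> {g \<in> carrier G. g \<notin> A}"
        then have "y \<otimes>\<^bsub>G\<^esub> inv\<^bsub>G\<^esub> x \<in> A" "y = (y \<otimes>\<^bsub>G\<^esub> inv\<^bsub>G\<^esub> x) \<otimes>\<^bsub>G\<^esub> x"
          using out x by (auto simp: G.m_assoc)
        then show "y \<in> (\<lambda>u. u \<otimes>\<^bsub>G\<^esub> x) ` A" by (rule rev_image_eqI)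
      qed
    qed
    show ?thesis
      using finsum_reindex[OF _ inj, of f] f unfolding im by auto
  qed
  \<comment> \<open>\<open>B\<close> and \<open>T\<close> are \<open>\<beta>\<close> and \<open>\<alpha> + x \<alpha> x^(-1)\<close>, read off from the
    coefficients of \<open>w\<close>\<close>
  define B where "B = (\<lambda>h\<in>carrier G. if h \<in> A then w (h \<otimes>\<^bsub>G\<^esub> x) else \<zero>)"
  define T where "T = (\<lambda>h\<in>carrier G. if h \<in> A then w h \<oplus> w (inv\<^bsub>G\<^esub> x \<otimes>\<^bsub>G\<^esub> h \<otimes>\<^bsub>G\<^esub> x) else \<zero>)"
  have Bc: "B \<in> carrier FG" and Tc: "T \<in> carrier FG"
    using w x by (auto simp: B_def T_def group_algebra_def PiE_iff)
  have augB: "aug B \<noteq> \<zero>"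
  proof -
    have "aug B = finsum F B {h \<in> carrier G. h \<in> A} \<oplus> finsum F B {h \<in> carrier G. h \<notin> A}"
      unfolding aug_eq[OF Bc] using G.fin Bc by (intro finsum_split) auto
    also have "finsum F B {h \<in> carrier G. h \<notin> A} = (\<Oplus>h\<in>{h \<in> carrier G. h \<notin> A}. \<zero>)"
      by (rule finsum_cong') (auto simp: B_def)
    also have "finsum F B {h \<in> carrier G. h \<in> A} = finsum F (\<lambda>u. w (u \<otimes>\<^bsub>G\<^esub> x)) A"
      unfolding Aeq using w x Ac by (intro finsum_cong') (auto simp: B_def)
    also have "\<dots> = finsum F w {g \<in> carrier G. g \<notin> A}"
      using w by (intro reidx[symmetric]) auto
    finally have "aug B = finsum F w {g \<in> carrier G. g \<notin> A} \<oplus> \<zero>" by simp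
    then show ?thesis using ne w by (simp add: finsum_closed Pi_iff)
  qed
  have BT: "B \<otimes>\<^bsub>FG\<^esub> T = \<zero>\<^bsub>FG\<^esub>"
  proof (rule FG_eqI)
    interpret FG: ring FG by (rule FG_ring)
    show "B \<otimes>\<^bsub>FG\<^esub> T \<in> carrier FG" "\<zero>\<^bsub>FG\<^esub> \<in> carrier FG" using Bc Tc by auto
    fix h assume h: "h \<in> carrier G"
    have z0: "\<zero>\<^bsub>FG\<^esub> y = \<zero>" if "y \<in> carrier G" for y using that by (simp add: group_algebra_def)
    show "(B \<otimes>\<^bsub>FG\<^esub> T) h = \<zero>\<^bsub>FG\<^esub> h"
    proof (cases "h \<in> A")
      case False
      have "(B \<otimes>\<^bsub>FG\<^esub> T) h = (\<Oplus>u\<in>carrier G. \<zero>)"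
        unfolding FG_mult_apply[OF h]
      proof (rule finsum_cong')
        fix u assume u: "u \<in> carrier G"
        have "\<not> (u \<in> A \<and> inv\<^bsub>G\<^esub> u \<otimes>\<^bsub>G\<^esub> h \<in> A)"
        proof
          assume uA: "u \<in> A \<and> inv\<^bsub>G\<^esub> u \<otimes>\<^bsub>G\<^esub> h \<in> A"
          then have "u \<otimes>\<^bsub>G\<^esub> (inv\<^bsub>G\<^esub> u \<otimes>\<^bsub>G\<^esub> h) \<in> A" by blast
          then show False using False u h by (simp add: G.m_assoc[symmetric])
        qed
        then have "B u = \<zero> \<or> T (inv\<^bsub>G\<^esub> u \<otimes>\<^bsub>G\<^esub> h) = \<zero>" using u h by (auto simp: B_def T_def)
        then show "B u \<otimes> T (inv\<^bsub>G\<^esub> u \<otimes>\<^bsub>G\<^esub> h) = \<zero>" using Bc Tc u h by auto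
      qed auto
      then show ?thesis using z0[OF h] by simp
    next
      case True
      have hx: "h \<otimes>\<^bsub>G\<^esub> x \<in> carrier G" using h x by simp
      let ?p = "\<lambda>u. w (u \<otimes>\<^bsub>G\<^esub> x) \<otimes> w (inv\<^bsub>G\<^esub> u \<otimes>\<^bsub>G\<^esub> h)"
      let ?q = "\<lambda>u. w (u \<otimes>\<^bsub>G\<^esub> x) \<otimes> w (inv\<^bsub>G\<^esub> x \<otimes>\<^bsub>G\<^esub> (inv\<^bsub>G\<^esub> u \<otimes>\<^bsub>G\<^esub> h) \<otimes>\<^bsub>G\<^esub> x)"
      let ?v = "\<lambda>y. w y \<otimes> w (inv\<^bsub>G\<^esub> y \<otimes>\<^bsub>G\<^esub> (h \<otimes>\<^bsub>G\<^esub> x))"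
      have vc: "?v \<in> carrier G \<rightarrow> carrier F" using w hx by auto
      have pc: "?p \<in> A \<rightarrow> carrier F" "?q \<in> A \<rightarrow> carrier F" using w h x Ac by auto
      have "(B \<otimes>\<^bsub>FG\<^esub> T) h = finsum F (\<lambda>u. B u \<otimes> T (inv\<^bsub>G\<^esub> u \<otimes>\<^bsub>G\<^esub> h)) {u \<in> carrier G. u \<in> A} \<oplus>
          finsum F (\<lambda>u. B u \<otimes> T (inv\<^bsub>G\<^esub> u \<otimes>\<^bsub>G\<^esub> h)) {u \<in> carrier G. u \<notin> A}"
        unfolding FG_mult_apply[OF h] using Bc Tc h by (intro finsum_split[OF G.fin]) auto
      also have "finsum F (\<lambda>u. B u \<otimes> T (inv\<^bsub>G\<^esub> u \<otimes>\<^bsub>G\<^esub> h)) {u \<in> carrier G. u \<notin> A} =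
          (\<Oplus>u\<in>{u \<in> carrier G. u \<notin> A}. \<zero>)"
        using Tc h by (intro finsum_cong') (auto simp: B_def)
      also have "finsum F (\<lambda>u. B u \<otimes> T (inv\<^bsub>G\<^esub> u \<otimes>\<^bsub>G\<^esub> h)) {u \<in> carrier G. u \<in> A} =
          (\<Oplus>u\<in>A. ?p u \<oplus> ?q u)"
        unfolding Aeq
      proof (rule finsum_cong')
        fix u assume u: "u \<in> A"
        have uh: "inv\<^bsub>G\<^esub> u \<otimes>\<^bsub>G\<^esub> h \<in> A" using u True by simp
        show "B u \<otimes> T (inv\<^bsub>G\<^esub> u \<otimes>\<^bsub>G\<^esub> h) = ?p u \<oplus> ?q u"
          using u uh Ac w x h by (simp add: B_def T_def r_distr)
      qed (use pc in \<open>auto simp: Pi_iff\<close>)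
      also have "(\<Oplus>u\<in>A. ?p u \<oplus> ?q u) = finsum F ?p A \<oplus> finsum F ?q A"
        by (rule finsum_addf[OF pc])
      also have "finsum F ?q A = finsum F ?v {y \<in> carrier G. y \<notin> A}"
      proof -
        have "finsum F ?v {y \<in> carrier G. y \<notin> A} = finsum F (\<lambda>u. ?v (u \<otimes>\<^bsub>G\<^esub> x)) A"
          by (rule reidx[OF vc])
        also have "\<dots> = finsum F ?q A"
          using pc(2) Ac x h by (intro finsum_cong') (auto simp: G.inv_mult_group G.m_assoc)
        finally show ?thesis by simp
      qed
      also have "finsum F ?p A = finsum F ?v A"
      proof -
        have inj: "inj_on (\<lambda>u. inv\<^bsub>G\<^esub> u \<otimes>\<^bsub>G\<^esub> h) A"
          using Ac h by (auto intro!: inj_onI)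
        have im: "(\<lambda>u. inv\<^bsub>G\<^esub> u \<otimes>\<^bsub>G\<^esub> h) ` A = A"
          using True by (intro endo_inj_surj[OF fA _ inj]) auto
        have "finsum F ?v ((\<lambda>u. inv\<^bsub>G\<^esub> u \<otimes>\<^bsub>G\<^esub> h) ` A) = finsum F (\<lambda>u. ?v (inv\<^bsub>G\<^esub> u \<otimes>\<^bsub>G\<^esub> h)) A"
          using vc Ac h by (intro finsum_reindex[OF _ inj]) auto
        also have "\<dots> = finsum F ?p A"
        proof (rule finsum_cong')
          fix u assume u: "u \<in> A"
          have "inv\<^bsub>G\<^esub> (inv\<^bsub>G\<^esub> u \<otimes>\<^bsub>G\<^esub> h) \<otimes>\<^bsub>G\<^esub> (h \<otimes>\<^bsub>G\<^esub> x) = inv\<^bsub>G\<^esub> h \<otimes>\<^bsub>G\<^esub> (u \<otimes>\<^bsub>G\<^esub> h) \<otimes>\<^bsub>G\<^esub> x"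
            using u Ac h x by (simp add: G.inv_mult_group G.m_assoc)
          also have "u \<otimes>\<^bsub>G\<^esub> h = h \<otimes>\<^bsub>G\<^esub> u" by (rule comm[OF u True])
          finally have "inv\<^bsub>G\<^esub> (inv\<^bsub>G\<^esub> u \<otimes>\<^bsub>G\<^esub> h) \<otimes>\<^bsub>G\<^esub> (h \<otimes>\<^bsub>G\<^esub> x) = u \<otimes>\<^bsub>G\<^esub> x"
            using u Ac h x by (simp add: G.m_assoc[symmetric])
          then show "?v (inv\<^bsub>G\<^esub> u \<otimes>\<^bsub>G\<^esub> h) = ?p u" using w u Ac h x by (simp add: m_comm)
        qed (use pc in auto)
        finally show ?thesis unfolding im by simp
      qed
      also have "(finsum F ?v A \<oplus> finsum F ?v {y \<in> carrier G. y \<notin> A}) \<oplus> (\<Oplus>u\<in>{u \<in> carrier G. u \<notin> A}. \<zero>)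
          = finsum F ?v (carrier G)"
        using finsum_split[OF G.fin vc, of "\<lambda>y. y \<in> A"] vc A.subset unfolding Aeq
        by (simp add: finsum_closed Pi_iff subset_iff)
      also have "\<dots> = (w \<otimes>\<^bsub>FG\<^esub> w) (h \<otimes>\<^bsub>G\<^esub> x)" by (rule FG_mult_apply[OF hx, symmetric])
      also have "\<dots> = \<zero>" unfolding ww by (rule z0[OF hx])
      finally show ?thesis using z0[OF h] by simp
    qed
  qed
  obtain n where n: "order G = 2 ^ n" using G.order_pow by auto
  have "T g = \<zero>"
  proof (rule abelian_support_cancel[OF A comm Tc Bc _ augB BT])
    fix h assume "h \<in> carrier G" "B h \<noteq> \<zero>"
    then show "h \<in> A \<and> h [^]\<^bsub>G\<^esub> ((2::nat) ^ n) = \<one>\<^bsub>G\<^esub>"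
      using G.pow_order_eq_1[of h] n by (auto simp: B_def split: if_splits)
  qed (use g Ac in auto)
  then have "w g \<oplus> w (inv\<^bsub>G\<^esub> x \<otimes>\<^bsub>G\<^esub> g \<otimes>\<^bsub>G\<^esub> x) = \<zero>" using g Ac by (simp add: T_def)
  then show ?thesis using g Ac x w by (simp add: add_eq_zero_iff)
qed

end

locale dihedral_algebra = char2_group_algebra F G + D: dihedral_ext G a x z s q m c
  for F :: "('f, 'r) ring_scheme" (structure) and G :: "('g, 'm) monoid_scheme" (structure)
    and a x z and s q :: int and m c :: nat
begin

lemma not_reflection_one: "\<not> D.reflection \<one>\<^bsub>G\<^esub>"
  using D.reflection_el[of 0 0 False] unfolding D.el_zero by simp

lemma reflection_x: "D.reflection x" "\<not> D.odd_exponent x"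
  using D.reflection_el[of 0 0 True] D.odd_exponent_el[of 0 0 True] unfolding D.el_gens(3) by simp_all

lemma odd_exponent_a: "\<not> D.reflection a" "D.odd_exponent a"
  using D.reflection_el[of 1 0 False] D.odd_exponent_el[of 1 0 False] unfolding D.el_gens(1) by simp_all

lemma reflection_inv: "g \<in> carrier G \<Longrightarrow> D.reflection (inv\<^bsub>G\<^esub> g) \<longleftrightarrow> D.reflection g"
  using D.reflection_mult[of g "inv\<^bsub>G\<^esub> g"] not_reflection_one by simp

lemma rotations_subgroup: "subgroup {g \<in> carrier G. \<not> D.reflection g} G"
proof (rule G.subgroupI)
  show "{g \<in> carrier G. \<not> D.reflection g} \<noteq> {}" using not_reflection_one by blast
qed (auto simp: D.reflection_mult reflection_inv)

lemma rotation_el: "g \<in> carrier G \<Longrightarrow> \<not> D.reflection g \<Longrightarrow> \<exists>i j. g = D.el i j False"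
proof -
  assume g: "g \<in> carrier G" "\<not> D.reflection g"
  obtain i j e where e: "g = D.el i j e" using D.elements[OF g(1)] by blast
  then have "\<not> e" using g(2) by simp
  then show ?thesis using e by auto
qed

lemma rotations_commute:
  assumes "g \<in> carrier G" "\<not> D.reflection g" "h \<in> carrier G" "\<not> D.reflection h"
  shows "g \<otimes>\<^bsub>G\<^esub> h = h \<otimes>\<^bsub>G\<^esub> g"
proof -
  obtain i j where g: "g = D.el i j False" using rotation_el assms by blast
  obtain k l where h: "h = D.el k l False" using rotation_el assms by blast
  show ?thesis unfolding g h by (simp add: D.el_mult add.commute)
qed

definition even_reflection_sum where
  "even_reflection_sum w = finsum F w {g \<in> carrier G. D.reflection g \<and> \<not> D.odd_exponent g}"
definition odd_reflection_sum where
  "odd_reflection_sum w = finsum F w {g \<in> carrier G. D.reflection g \<and> D.odd_exponent g}"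
definition odd_rotation_sum where
  "odd_rotation_sum w = finsum F w {g \<in> carrier G. \<not> D.reflection g \<and> D.odd_exponent g}"

lemma sums_closed [simp]:
  assumes "w \<in> carrier FG"
  shows "even_reflection_sum w \<in> carrier F" "odd_reflection_sum w \<in> carrier F"
    "odd_rotation_sum w \<in> carrier F"
  unfolding even_reflection_sum_def odd_reflection_sum_def odd_rotation_sum_def
  using assms by (auto intro!: finsum_closed)

lemma sum_split_pred:
  assumes "w \<in> carrier FG"
  shows "finsum F w {g \<in> carrier G. P g} =
    finsum F w {g \<in> carrier G. P g \<and> Q g} \<oplus> finsum F w {g \<in> carrier G. P g \<and> \<not> Q g}"
proof -
  have "finsum F w {g \<in> carrier G. P g} =
      finsum F w {g \<in> {g \<in> carrier G. P g}. Q g} \<oplus> finsum F w {g \<in> {g \<in> carrier G. P g}. \<not> Q g}"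
    using assms G.fin by (intro finsum_split) auto
  then show ?thesis by (simp add: conj_ac)
qed

lemma reflection_sum:
  assumes "w \<in> carrier FG"
  shows "finsum F w {g \<in> carrier G. D.reflection g} = even_reflection_sum w \<oplus> odd_reflection_sum w"
  using sum_split_pred[OF assms, of D.reflection D.odd_exponent] sums_closed[OF assms]
  unfolding even_reflection_sum_def odd_reflection_sum_def by (simp add: a_comm)

lemma odd_sum:
  assumes "w \<in> carrier FG"
  shows "finsum F w {g \<in> carrier G. D.odd_exponent g} = odd_rotation_sum w \<oplus> odd_reflection_sum w"
  using sum_split_pred[OF assms, of D.odd_exponent D.reflection] sums_closed[OF assms]
  unfolding odd_rotation_sum_def odd_reflection_sum_def by (simp add: a_comm conj_commute)

text \<open>The elements \<open>a^i z^j\<close> with \<open>i\<close> congruent to 2 modulo 4 form a conjugation-invariant set, and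
  their square roots are the elements \<open>a^i z^j\<close> with \<open>i\<close> odd.\<close>

lemma odd_rotation_sum_zero:
  assumes m: "2 \<le> m" and w: "w \<in> carrier FG" and ww: "w \<otimes>\<^bsub>FG\<^esub> w = \<zero>\<^bsub>FG\<^esub>"
  shows "odd_rotation_sum w = \<zero>"
proof -
  define P where "P g \<longleftrightarrow> (\<exists>i j. g = D.el i j False \<and> i mod 4 = 2)" for g
  have four: "(4::int) dvd 2 ^ m" using m le_imp_power_dvd[of 2 m "2::int"] by simp
  have P_el: "P (D.el i j e) \<longleftrightarrow> \<not> e \<and> i mod 4 = 2" for i j e
  proof
    assume "P (D.el i j e)"
    then obtain k l where k: "D.el i j e = D.el k l False" "k mod 4 = 2" unfolding P_def by blast
    then have "\<not> e" "4 dvd i - k" using dvd_trans[OF four] unfolding D.el_eq by auto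
    then show "\<not> e \<and> i mod 4 = 2" using k(2) by presburger
  qed (auto simp: P_def)
  have sym: "P (g \<otimes>\<^bsub>G\<^esub> h) = P (h \<otimes>\<^bsub>G\<^esub> g)" if gh: "g \<in> carrier G" "h \<in> carrier G" for g h
  proof -
    obtain i j e where g: "g = D.el i j e" using D.elements[OF gh(1)] by blast
    obtain k l f where h: "h = D.el k l f" using D.elements[OF gh(2)] by blast
    have "(i - k) mod 4 = 2 \<longleftrightarrow> (k - i) mod 4 = 2" by presburger
    then show ?thesis
      unfolding g h by (cases e; cases f) (simp_all add: D.el_mult P_el add.commute)
  qed
  have "{y \<in> carrier G. P (y \<otimes>\<^bsub>G\<^esub> y)} = {g \<in> carrier G. \<not> D.reflection g \<and> D.odd_exponent g}"
  proof (rule Collect_cong, rule conj_cong[OF refl])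
    fix y assume "y \<in> carrier G"
    then obtain i j e where y: "y = D.el i j e" using D.elements by blast
    have "(i + i) mod 4 = 2 \<longleftrightarrow> odd i" by presburger
    then show "P (y \<otimes>\<^bsub>G\<^esub> y) = (\<not> D.reflection y \<and> D.odd_exponent y)"
      unfolding y by (cases e) (simp_all add: D.el_mult P_el)
  qed
  then show ?thesis
    using square_zero_roots[OF w ww, of P] sym unfolding odd_rotation_sum_def by simp
qed

text \<open>The odd powers of \<open>z\<close>: they are central without having a square root in the centre.\<close>

definition odd_central where "odd_central g \<longleftrightarrow> (\<exists>j. odd j \<and> g = D.el 0 j False)"

lemma odd_central_el: "odd_central (D.el 0 j False) \<longleftrightarrow> odd j"
proof
  assume "odd_central (D.el 0 j False)"
  then obtain k where k: "odd k" "D.el 0 j False = D.el 0 k False" unfolding odd_central_def by blast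
  then have "2 ^ c dvd j - k" unfolding D.el_eq by simp
  moreover have "(2::int) dvd 2 ^ c" using D.c_pos by simp
  ultimately have "2 dvd j - k" by (rule dvd_trans[rotated])
  then show "odd j" using k(1) by presburger
qed (auto simp: odd_central_def)

lemma odd_central_center: "odd_central g \<Longrightarrow> g \<in> center G"
  unfolding odd_central_def using D.zpow_center by (auto simp: D.el_gens(4))

lemma odd_central_root_sum:
  assumes w: "w \<in> carrier FG" and ww: "w \<otimes>\<^bsub>FG\<^esub> w = \<zero>\<^bsub>FG\<^esub>"
  shows "finsum F w {y \<in> carrier G. odd_central (y \<otimes>\<^bsub>G\<^esub> y)} = \<zero>"
proof (rule square_zero_roots[OF w ww])
  have *: "h \<otimes>\<^bsub>G\<^esub> g = g \<otimes>\<^bsub>G\<^esub> h" if gh: "g \<in> carrier G" "h \<in> carrier G" and c: "odd_central (g \<otimes>\<^bsub>G\<^esub> h)" for g h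
  proof -
    have "inv\<^bsub>G\<^esub> g \<otimes>\<^bsub>G\<^esub> (g \<otimes>\<^bsub>G\<^esub> h) \<otimes>\<^bsub>G\<^esub> inv\<^bsub>G\<^esub> (inv\<^bsub>G\<^esub> g) = g \<otimes>\<^bsub>G\<^esub> h"
      using G.center_conj[OF odd_central_center[OF c] G.inv_closed[OF gh(1)]] .
    then show ?thesis using gh by (simp add: G.m_assoc[symmetric])
  qed
  fix g h assume "g \<in> carrier G" "h \<in> carrier G"
  then show "odd_central (g \<otimes>\<^bsub>G\<^esub> h) = odd_central (h \<otimes>\<^bsub>G\<^esub> g)" using *[of g h] *[of h g] by auto
qed

lemma odd_central_reflection:
  assumes "y \<in> carrier G" "D.reflection y"
  shows "odd_central (y \<otimes>\<^bsub>G\<^esub> y) \<longleftrightarrow> odd (s * (if D.odd_exponent y then 1 else 0) + q)"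
proof -
  obtain i j e where y: "y = D.el i j e" using D.elements[OF assms(1)] by blast
  then have e: "e" using assms(2) by simp
  show ?thesis unfolding y using e by (simp add: D.el_mult odd_central_el)
qed

text \<open>By \<open>square_zero_invariant\<close>, conjugation by \<open>x\<close> does not change the coefficients of \<open>w\<close> at
  rotations.  It permutes the rotations whose square is a given odd power of \<open>z\<close> without fixed
  points, since a rotation fixed by \<open>x\<close> is central.\<close>

lemma odd_central_reflection_sum:
  assumes w: "w \<in> carrier FG" and ww: "w \<otimes>\<^bsub>FG\<^esub> w = \<zero>\<^bsub>FG\<^esub>"
    and ne: "even_reflection_sum w \<oplus> odd_reflection_sum w \<noteq> \<zero>"
  shows "finsum F w {y \<in> carrier G. odd_central (y \<otimes>\<^bsub>G\<^esub> y) \<and> D.reflection y} = \<zero>"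
    and "finsum F w {y \<in> carrier G. odd_central (y \<otimes>\<^bsub>G\<^esub> y) \<and> \<not> D.reflection y} = \<zero>"
proof -
  let ?A = "{g \<in> carrier G. \<not> D.reflection g}"
  let ?Y = "{y \<in> carrier G. odd_central (y \<otimes>\<^bsub>G\<^esub> y) \<and> \<not> D.reflection y}"
  have xx: "x \<otimes>\<^bsub>G\<^esub> x \<in> center G" unfolding D.x_x by (rule D.zpow_center)
  have out: "{g \<in> carrier G. g \<notin> ?A} = {g \<in> carrier G. D.reflection g}" by auto
  have w_inv: "w (inv\<^bsub>G\<^esub> x \<otimes>\<^bsub>G\<^esub> g \<otimes>\<^bsub>G\<^esub> x) = w g" if "g \<in> ?A" for g
  proof (rule square_zero_invariant[OF rotations_subgroup _ D.x_closed _ _ w ww _ that])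
    show "finsum F w {g \<in> carrier G. g \<notin> ?A} \<noteq> \<zero>"
      unfolding out reflection_sum[OF w] by (rule ne)
  qed (auto simp: reflection_x D.reflection_mult reflection_inv intro: rotations_commute)
  have "finsum F w ?Y = finsum F w {y \<in> ?Y. inv\<^bsub>G\<^esub> x \<otimes>\<^bsub>G\<^esub> y \<otimes>\<^bsub>G\<^esub> x = y}"
  proof (rule finsum_involution)
    show "finite ?Y" using G.fin by simp
    show "w \<in> ?Y \<rightarrow> carrier F" using w by auto
    fix y assume "y \<in> ?Y"
    then have y: "y \<in> carrier G" "odd_central (y \<otimes>\<^bsub>G\<^esub> y)" "\<not> D.reflection y" by auto
    let ?u = "inv\<^bsub>G\<^esub> x \<otimes>\<^bsub>G\<^esub> y \<otimes>\<^bsub>G\<^esub> x"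
    have "?u \<otimes>\<^bsub>G\<^esub> ?u = inv\<^bsub>G\<^esub> x \<otimes>\<^bsub>G\<^esub> y \<otimes>\<^bsub>G\<^esub> (x \<otimes>\<^bsub>G\<^esub> inv\<^bsub>G\<^esub> x) \<otimes>\<^bsub>G\<^esub> y \<otimes>\<^bsub>G\<^esub> x"
      using y(1) by (simp only: G.m_assoc G.m_closed G.inv_closed D.x_closed)
    also have "\<dots> = inv\<^bsub>G\<^esub> x \<otimes>\<^bsub>G\<^esub> (y \<otimes>\<^bsub>G\<^esub> y) \<otimes>\<^bsub>G\<^esub> inv\<^bsub>G\<^esub> (inv\<^bsub>G\<^esub> x)"
      using y(1) by (simp add: G.m_assoc)
    also have "\<dots> = y \<otimes>\<^bsub>G\<^esub> y"
      by (rule G.center_conj[OF odd_central_center[OF y(2)]]) simp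
    finally have uu: "?u \<otimes>\<^bsub>G\<^esub> ?u = y \<otimes>\<^bsub>G\<^esub> y" .
    show "?u \<in> ?Y"
      unfolding mem_Collect_eq uu using y by (simp add: D.reflection_mult reflection_inv reflection_x)
    have "inv\<^bsub>G\<^esub> x \<otimes>\<^bsub>G\<^esub> ?u \<otimes>\<^bsub>G\<^esub> x = inv\<^bsub>G\<^esub> (x \<otimes>\<^bsub>G\<^esub> x) \<otimes>\<^bsub>G\<^esub> (y \<otimes>\<^bsub>G\<^esub> (x \<otimes>\<^bsub>G\<^esub> x))"
      using y(1) by (simp add: G.m_assoc G.inv_mult_group)
    also have "y \<otimes>\<^bsub>G\<^esub> (x \<otimes>\<^bsub>G\<^esub> x) = (x \<otimes>\<^bsub>G\<^esub> x) \<otimes>\<^bsub>G\<^esub> y"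
      by (rule centerD(2)[OF xx y(1), symmetric])
    also have "inv\<^bsub>G\<^esub> (x \<otimes>\<^bsub>G\<^esub> x) \<otimes>\<^bsub>G\<^esub> ((x \<otimes>\<^bsub>G\<^esub> x) \<otimes>\<^bsub>G\<^esub> y) = y"
    proof -
      have "inv\<^bsub>G\<^esub> v \<otimes>\<^bsub>G\<^esub> (v \<otimes>\<^bsub>G\<^esub> y) = y" if "v \<in> carrier G" for v
        using that y(1) by (simp add: G.m_assoc[symmetric])
      then show ?thesis by simp
    qed
    finally show "inv\<^bsub>G\<^esub> x \<otimes>\<^bsub>G\<^esub> ?u \<otimes>\<^bsub>G\<^esub> x = y" .
    show "w ?u = w y" using w_inv y by simp
  qed
  also have "{y \<in> ?Y. inv\<^bsub>G\<^esub> x \<otimes>\<^bsub>G\<^esub> y \<otimes>\<^bsub>G\<^esub> x = y} = {}"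
  proof (rule ccontr)
    assume "{y \<in> ?Y. inv\<^bsub>G\<^esub> x \<otimes>\<^bsub>G\<^esub> y \<otimes>\<^bsub>G\<^esub> x = y} \<noteq> {}"
    then obtain y where y: "y \<in> carrier G" "odd_central (y \<otimes>\<^bsub>G\<^esub> y)" "\<not> D.reflection y"
      "inv\<^bsub>G\<^esub> x \<otimes>\<^bsub>G\<^esub> y \<otimes>\<^bsub>G\<^esub> x = y" by blast
    have "x \<otimes>\<^bsub>G\<^esub> (inv\<^bsub>G\<^esub> x \<otimes>\<^bsub>G\<^esub> y \<otimes>\<^bsub>G\<^esub> x) = x \<otimes>\<^bsub>G\<^esub> y" using y(4) by simp
    then have "x \<otimes>\<^bsub>G\<^esub> y = y \<otimes>\<^bsub>G\<^esub> x" using y(1) by (simp add: G.m_assoc[symmetric])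
    moreover have "a \<otimes>\<^bsub>G\<^esub> y = y \<otimes>\<^bsub>G\<^esub> a" using y odd_exponent_a by (intro rotations_commute) auto
    ultimately have "y \<in> center G" using D.central_if_commutes[OF D.elements y(1)] by blast
    then obtain j where "y = D.el 0 j False" unfolding D.center_eq by (auto simp: D.el_gens(4))
    then have "y \<otimes>\<^bsub>G\<^esub> y = D.el 0 (j + j) False" by (simp add: D.el_mult)
    then show False using y(2) odd_central_el[of "j + j"] by simp
  qed
  finally show Y0: "finsum F w ?Y = \<zero>" by simp
  have "finsum F w {y \<in> carrier G. odd_central (y \<otimes>\<^bsub>G\<^esub> y) \<and> D.reflection y} \<in> carrier F"
    using w by (intro finsum_closed) auto
  then show "finsum F w {y \<in> carrier G. odd_central (y \<otimes>\<^bsub>G\<^esub> y) \<and> D.reflection y} = \<zero>"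
    using odd_central_root_sum[OF w ww] Y0
      sum_split_pred[OF w, of "\<lambda>y. odd_central (y \<otimes>\<^bsub>G\<^esub> y)" D.reflection] by simp
qed

lemma mod_four_facts:
  fixes A B n :: int
  shows "4 dvd A - B \<Longrightarrow> B mod 4 = 1 \<Longrightarrow> A mod 4 = 1"
    and "odd n \<Longrightarrow> A - B = 2 * n + 4 * k \<Longrightarrow> (A - B) mod 4 = 2"
    and "odd A \<Longrightarrow> (A - B) mod 4 = 2 \<Longrightarrow> A mod 4 = 1 \<longleftrightarrow> B mod 4 \<noteq> 1"
  by presburger+

text \<open>Consider the coefficients of \<open>w^2\<close> at the elements \<open>a^i z^j\<close> with \<open>i + 2^m j\<close> congruent to 1
  modulo 4.  If \<open>y\<close> is a reflection with even and \<open>k\<close> one with odd exponent, exactly one of \<open>y k\<close>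
  and \<open>k y\<close> has this form, so that these pairs contribute the product of the two sums.  All other
  pairs cancel or do not contribute.  The summand \<open>2^m j\<close> makes the condition well defined in the
  quaternion group of order eight, where \<open>a^2 = z\<close>; it is divisible by 4 if \<open>m \<ge> 2\<close>.\<close>

lemma reflection_sums_product:
  assumes h: "2 \<le> m \<or> (c = 1 \<and> s = 0)" and w: "w \<in> carrier FG" and ww: "w \<otimes>\<^bsub>FG\<^esub> w = \<zero>\<^bsub>FG\<^esub>"
  shows "even_reflection_sum w \<otimes> odd_reflection_sum w = \<zero>"
proof -
  define P where "P g \<longleftrightarrow> (\<exists>i j. g = D.el i j False \<and> (i + 2 ^ m * j) mod 4 = 1)" for g
  have two: "(2::int) dvd 2 ^ m" using D.m_pos by simp
  have s4: "(4::int) dvd 2 ^ m * s"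
  proof (cases "2 \<le> m")
    case True
    then have "(4::int) dvd 2 ^ m" using le_imp_power_dvd[of 2 m "2::int"] by simp
    then show ?thesis by simp
  qed (use h in auto)
  have P_el: "P (D.el i j e) \<longleftrightarrow> \<not> e \<and> (i + 2 ^ m * j) mod 4 = 1" for i j e
  proof
    assume "P (D.el i j e)"
    then obtain k l where k: "D.el i j e = D.el k l False" "(k + 2 ^ m * l) mod 4 = 1" unfolding P_def by blast
    have e: "\<not> e" "2 ^ m dvd i - k" "2 ^ c dvd D.r * ((i - k) div 2 ^ m) + j - l"
      using k(1) unfolding D.el_eq by auto
    have "4 dvd (i + 2 ^ m * j) - (k + 2 ^ m * l)"
    proof (cases "2 \<le> m")
      case True
      then have f: "(4::int) dvd 2 ^ m" using le_imp_power_dvd[of 2 m "2::int"] by simp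
      have "4 dvd (i - k) + 2 ^ m * (j - l)"
        by (rule dvd_add[OF dvd_trans[OF f e(2)] dvd_mult2[OF f]])
      then show ?thesis by (simp add: algebra_simps)
    next
      case False
      then have mc: "m = 1" "c = 1" "s = 0" using h D.m_pos by auto
      have "2 dvd i - k" using e(2) unfolding mc power_one_right .
      then obtain t where t: "i - k = 2 * t" by (rule dvdE)
      have "D.r = 1" unfolding D.r_def using mc by simp
      then have "2 dvd t + j - l" using e(3) t mc by simp
      then have "4 dvd 2 * (t + j - l)" by presburger
      moreover have "(i + 2 ^ m * j) - (k + 2 ^ m * l) = 2 * (t + j - l)" using t mc by simp
      ultimately show ?thesis by simp
    qed
    then show "\<not> e \<and> (i + 2 ^ m * j) mod 4 = 1" using e(1) mod_four_facts(1)[OF _ k(2)] by blast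
  qed (auto simp: P_def)
  let ?E = "\<lambda>y. D.reflection y \<and> \<not> D.odd_exponent y" and ?O = "\<lambda>y. D.reflection y \<and> D.odd_exponent y"
  let ?o = "\<lambda>y k. if ?E y \<and> ?O k then \<one> else \<zero>"
  \<comment> \<open>adding the indicator of the pairs of an even and an odd reflection makes the indicator of
    \<open>P (y k)\<close> symmetric\<close>
  define Q where "Q y k = indicator_fun P (y \<otimes>\<^bsub>G\<^esub> k) \<oplus> ?o y k" for y k
  have Q_sym: "Q y k = Q k y" and Q_diag: "Q y y = \<zero>"
    if yk: "y \<in> carrier G" "k \<in> carrier G" for y k
  proof -
    obtain i j e where y: "y = D.el i j e" using D.elements[OF yk(1)] by blast
    obtain i' j' f where k: "k = D.el i' j' f" using D.elements[OF yk(2)] by blast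
    have ev: "n mod 4 \<noteq> 1" if "even n" for n :: int using that by presburger
    obtain u where u: "(2::int) ^ m = 2 * u" using two by (rule dvdE)
    have n1: "(i + i + 2 ^ m * (j + j)) mod 4 \<noteq> 1" by (rule ev) simp
    have n2: "(i - i' + 2 ^ m * n) mod 4 \<noteq> 1" if "even i \<longleftrightarrow> even i'" for n
      by (rule ev) (use that u in simp)
    have n2': "(i' - i + 2 ^ m * n) mod 4 \<noteq> 1" if "even i \<longleftrightarrow> even i'" for n
      by (rule ev) (use that u in simp)
    have n0: "(2 ^ m * n :: int) mod 4 \<noteq> 1" for n
      by (rule ev) (use u in simp)
    have n3: "(i - i' + 2 ^ m * (j + j' + s * i' + q)) mod 4 = 1 \<longleftrightarrow>
        (i' - i + 2 ^ m * (j' + j + s * i + q)) mod 4 \<noteq> 1" if "even i \<longleftrightarrow> odd i'"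
    proof -
      let ?A = "i - i' + 2 ^ m * (j + j' + s * i' + q)" and ?B = "i' - i + 2 ^ m * (j' + j + s * i + q)"
      obtain v where v: "2 ^ m * s = 4 * v" using s4 by (rule dvdE)
      have "?A - ?B = 2 * (i - i') + (2 ^ m * s) * (i' - i)" by (simp add: algebra_simps)
      then have "?A - ?B = 2 * (i - i') + 4 * (v * (i' - i))" using v by simp
      moreover have "odd (i - i')" using that by simp
      ultimately have d: "(?A - ?B) mod 4 = 2" using mod_four_facts(2) by blast
      have "odd ?A" using that u by simp
      then show ?thesis using d by (rule mod_four_facts(3))
    qed
    show "Q y k = Q k y"
    proof (cases "e \<and> f")
      case True
      then show ?thesis
        unfolding Q_def y k indicator_fun_def
        using n2 n2' n3 by (cases "even i"; cases "even i'") (auto simp: D.el_mult P_el one_add_one)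
    next
      case False
      then show ?thesis
        unfolding Q_def y k indicator_fun_def
        by (cases e; cases f) (auto simp: D.el_mult P_el add.commute)
    qed
    show "Q y y = \<zero>"
      unfolding Q_def y indicator_fun_def
      using n1 n0 by (cases e) (auto simp: D.el_mult P_el)
  qed
  have Qc: "Q y k \<in> carrier F" for y k by (simp add: Q_def)
  have wc: "w y \<in> carrier F" if "y \<in> carrier G" for y using w that by auto
  have zero: "(\<Oplus>y\<in>carrier G. \<Oplus>k\<in>carrier G. w y \<otimes> w k \<otimes> indicator_fun P (y \<otimes>\<^bsub>G\<^esub> k)) = \<zero>"
    using pairing_mult[OF indicator_fun_closed(1) w w, of P] ww pairing_zero[OF indicator_fun_closed(1)] by simp
  have "(\<Oplus>y\<in>carrier G. \<Oplus>k\<in>carrier G. w y \<otimes> w k \<otimes> Q y k) = (\<Oplus>y\<in>carrier G. w y \<otimes> w y \<otimes> Q y y)"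
    using G.fin wc Qc Q_sym by (intro symmetric_double_sum) (auto simp: m_comm)
  also have "\<dots> = (\<Oplus>y\<in>carrier G. \<zero>)" using wc Q_diag by (intro finsum_cong') auto
  finally have "(\<Oplus>y\<in>carrier G. \<Oplus>k\<in>carrier G. w y \<otimes> w k \<otimes> Q y k) = \<zero>" by simp
  moreover have "(\<Oplus>y\<in>carrier G. \<Oplus>k\<in>carrier G. w y \<otimes> w k \<otimes> Q y k) =
      (\<Oplus>y\<in>carrier G. (\<Oplus>k\<in>carrier G. w y \<otimes> w k \<otimes> indicator_fun P (y \<otimes>\<^bsub>G\<^esub> k)) \<oplus>
        (\<Oplus>k\<in>carrier G. (w y \<otimes> (if ?E y then \<one> else \<zero>)) \<otimes> (w k \<otimes> (if ?O k then \<one> else \<zero>))))"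
  proof (rule finsum_cong')
    fix y assume y: "y \<in> carrier G"
    have "(\<Oplus>k\<in>carrier G. w y \<otimes> w k \<otimes> Q y k) =
        (\<Oplus>k\<in>carrier G. w y \<otimes> w k \<otimes> indicator_fun P (y \<otimes>\<^bsub>G\<^esub> k) \<oplus>
          (w y \<otimes> (if ?E y then \<one> else \<zero>)) \<otimes> (w k \<otimes> (if ?O k then \<one> else \<zero>)))"
      using wc y by (intro finsum_cong') (auto simp: Q_def r_distr)
    also have "\<dots> = (\<Oplus>k\<in>carrier G. w y \<otimes> w k \<otimes> indicator_fun P (y \<otimes>\<^bsub>G\<^esub> k)) \<oplus>
        (\<Oplus>k\<in>carrier G. (w y \<otimes> (if ?E y then \<one> else \<zero>)) \<otimes> (w k \<otimes> (if ?O k then \<one> else \<zero>)))"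
      using wc y by (intro finsum_addf) auto
    finally show "(\<Oplus>k\<in>carrier G. w y \<otimes> w k \<otimes> Q y k) = \<dots>" .
  qed (use wc in \<open>auto intro!: finsum_closed\<close>)
  moreover have "\<dots> = (\<Oplus>y\<in>carrier G. \<Oplus>k\<in>carrier G. w y \<otimes> w k \<otimes> indicator_fun P (y \<otimes>\<^bsub>G\<^esub> k)) \<oplus>
      (\<Oplus>y\<in>carrier G. \<Oplus>k\<in>carrier G. (w y \<otimes> (if ?E y then \<one> else \<zero>)) \<otimes> (w k \<otimes> (if ?O k then \<one> else \<zero>)))"
    using wc by (intro finsum_addf) (auto intro!: finsum_closed)
  moreover have "(\<Oplus>y\<in>carrier G. \<Oplus>k\<in>carrier G. (w y \<otimes> (if ?E y then \<one> else \<zero>)) \<otimes> (w k \<otimes> (if ?O k then \<one> else \<zero>))) =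
      (\<Oplus>y\<in>carrier G. w y \<otimes> (if ?E y then \<one> else \<zero>)) \<otimes> (\<Oplus>k\<in>carrier G. w k \<otimes> (if ?O k then \<one> else \<zero>))"
    using wc G.fin by (intro double_sum_times) auto
  moreover have "\<dots> = even_reflection_sum w \<otimes> odd_reflection_sum w"
    unfolding even_reflection_sum_def odd_reflection_sum_def
    using wc G.fin by (simp add: finsum_indicator Pi_iff)
  ultimately show ?thesis using zero sums_closed[OF w] by simp
qed

section \<open>The three families\<close>

text \<open>If \<open>s + q = 1\<close>, every power of \<open>z\<close> is a square, as \<open>(a z^k x)^2 = z^(2 k + 1)\<close>, so derivations
  kill it.\<close>

lemma derivation_values:
  assumes sq: "s + q = 1" and e: "augmentation F FG e" and d: "derivation F FG e d"
  shows "d (single (D.el i j r)) =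
    (if odd i then d (single a) else \<zero>) \<oplus> (if r then d (single x) else \<zero>)"
proof -
  have dc: "d (single g) \<in> carrier F" for g
    using d by (auto simp: derivation_def linear_functional_def)
  have hom: "d (single (g \<otimes>\<^bsub>G\<^esub> h)) = d (single g) \<oplus> d (single h)"
    if "g \<in> carrier G" "h \<in> carrier G" for g h
    by (rule derivation_single[OF e d that])
  have square: "d (single (g \<otimes>\<^bsub>G\<^esub> g)) = \<zero>" if "g \<in> carrier G" for g
    using hom[OF that that] dc by simp
  have zj: "d (single (D.el 0 j False)) = \<zero>" for j
  proof (cases "even j")
    case True
    then obtain k where "j = k + k" by (metis evenE mult_2)
    then have "D.el 0 j False = D.el 0 k False \<otimes>\<^bsub>G\<^esub> D.el 0 k False" by (simp add: D.el_mult)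
    then show ?thesis using square by simp
  next
    case False
    then obtain k where k: "j = 2 * k + 1" by (rule oddE)
    have "D.el 1 k True \<otimes>\<^bsub>G\<^esub> D.el 1 k True = D.el (1 - 1) (k + k + s * 1 + q) False" by (rule D.el_mult(3))
    also have "\<dots> = D.el 0 j False"
    proof -
      have "k + k + s * 1 + q = j" using sq k by linarith
      then show ?thesis by simp
    qed
    finally show ?thesis using square[OF D.el_closed[of 1 k True]] by simp
  qed
  have ai: "d (single (D.el i 0 False)) = (if odd i then d (single a) else \<zero>)" for i
  proof (cases "even i")
    case True
    then obtain k where "i = k + k" by (metis evenE mult_2)
    then have "D.el i 0 False = D.el k 0 False \<otimes>\<^bsub>G\<^esub> D.el k 0 False" by (simp add: D.el_mult)
    then show ?thesis using square True by simp
  next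
    case False
    then obtain k where k: "i = 2 * k + 1" by (rule oddE)
    have "D.el i 0 False = (D.el k 0 False \<otimes>\<^bsub>G\<^esub> D.el k 0 False) \<otimes>\<^bsub>G\<^esub> D.el 1 0 False"
      using k by (simp add: D.el_mult)
    then have "d (single (D.el i 0 False)) = d (single (D.el 1 0 False))"
      using hom[of "D.el k 0 False \<otimes>\<^bsub>G\<^esub> D.el k 0 False" "D.el 1 0 False"] square dc by simp
    then show ?thesis using False unfolding D.el_gens(1) by simp
  qed
  have "D.el i j False = D.el i 0 False \<otimes>\<^bsub>G\<^esub> D.el 0 j False" by (simp add: D.el_mult)
  then have ij: "d (single (D.el i j False)) = (if odd i then d (single a) else \<zero>)"
    using hom[of "D.el i 0 False" "D.el 0 j False"] zj ai dc by simp
  show ?thesis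
  proof (cases r)
    case True
    have "D.el i j True = D.el i j False \<otimes>\<^bsub>G\<^esub> x" by (rule D.el_True)
    then show ?thesis using hom[of "D.el i j False" x] ij True dc by simp
  qed (use ij dc in simp)
qed

lemma derivation_formula:
  assumes sq: "s + q = 1" and e: "augmentation F FG e" and d: "derivation F FG e d"
    and w: "w \<in> carrier FG"
  shows "d w = (odd_rotation_sum w \<oplus> odd_reflection_sum w) \<otimes> d (single a) \<oplus>
    (even_reflection_sum w \<oplus> odd_reflection_sum w) \<otimes> d (single x)"
proof -
  have dl: "linear_functional F FG d" using d by (simp add: derivation_def)
  have dc: "d (single g) \<in> carrier F" for g
    by (rule linear_functional_closed[OF dl single_closed])
  have wc: "w y \<in> carrier F" if "y \<in> carrier G" for y using w that by auto
  let ?o = "\<lambda>g. if D.odd_exponent g then \<one> else \<zero>" and ?f = "\<lambda>g. if D.reflection g then \<one> else \<zero>"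
  have "d w = (\<Oplus>g\<in>carrier G. w g \<otimes> d (single g))"
    using linear_functional_expand[OF dl w] by (simp add: pairing_def)
  also have "\<dots> = (\<Oplus>g\<in>carrier G. (w g \<otimes> ?o g) \<otimes> d (single a) \<oplus> (w g \<otimes> ?f g) \<otimes> d (single x))"
  proof (rule finsum_cong')
    fix g assume g: "g \<in> carrier G"
    then obtain i j r where gi: "g = D.el i j r" using D.elements by blast
    have "w g \<in> carrier F" by (rule wc[OF g])
    then show "w g \<otimes> d (single g) = (w g \<otimes> ?o g) \<otimes> d (single a) \<oplus> (w g \<otimes> ?f g) \<otimes> d (single x)"
      using dc unfolding gi by (cases "odd i"; cases r; simp add: derivation_values[OF sq e d] r_distr)
  qed (use wc dc in auto)
  also have "\<dots> = (\<Oplus>g\<in>carrier G. (w g \<otimes> ?o g) \<otimes> d (single a)) \<oplus> (\<Oplus>g\<in>carrier G. (w g \<otimes> ?f g) \<otimes> d (single x))"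
    using wc dc by (intro finsum_addf) auto
  also have "(\<Oplus>g\<in>carrier G. (w g \<otimes> ?o g) \<otimes> d (single a)) = (\<Oplus>g\<in>carrier G. w g \<otimes> ?o g) \<otimes> d (single a)"
    using wc dc G.fin by (intro finsum_ldistr[symmetric]) auto
  also have "(\<Oplus>g\<in>carrier G. (w g \<otimes> ?f g) \<otimes> d (single x)) = (\<Oplus>g\<in>carrier G. w g \<otimes> ?f g) \<otimes> d (single x)"
    using wc dc G.fin by (intro finsum_ldistr[symmetric]) auto
  also have "(\<Oplus>g\<in>carrier G. w g \<otimes> ?o g) = odd_rotation_sum w \<oplus> odd_reflection_sum w"
    using odd_sum[OF w] wc G.fin by (simp add: finsum_indicator Pi_iff)
  also have "(\<Oplus>g\<in>carrier G. w g \<otimes> ?f g) = even_reflection_sum w \<oplus> odd_reflection_sum w"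
    using reflection_sum[OF w] wc G.fin by (simp add: finsum_indicator Pi_iff)
  finally show ?thesis .
qed

text \<open>All reflections square to odd powers of \<open>z\<close>.  So if the coefficients of \<open>w\<close> at the reflections
  did not sum to zero, \<open>odd_central_reflection_sum\<close> would say that they do.  Hence the sums over
  the two classes of reflections agree, and since their product is zero, both vanish; the odd
  rotations sum to zero as well.\<close>

lemma no_square_zero_derivation:
  assumes t: "s = 0" "q = 1" and h: "2 \<le> m \<or> c = 1"
  shows "\<not> square_zero_derivation F FG"
proof
  assume "square_zero_derivation F FG"
  then obtain e d w where e: "augmentation F FG e" and d: "derivation F FG e d"
    and w: "w \<in> carrier FG" and ww: "w \<otimes>\<^bsub>FG\<^esub> w = \<zero>\<^bsub>FG\<^esub>" and dw: "d w \<noteq> \<zero>"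
    unfolding square_zero_derivation_def by blast
  note cl = sums_closed[OF w]
  have oc: "odd_central (y \<otimes>\<^bsub>G\<^esub> y)" if "y \<in> carrier G" "D.reflection y" for y
    using odd_central_reflection[OF that] t by simp
  have refl: "{y \<in> carrier G. odd_central (y \<otimes>\<^bsub>G\<^esub> y) \<and> D.reflection y} = {y \<in> carrier G. D.reflection y}"
    using oc by auto
  have r0: "even_reflection_sum w \<oplus> odd_reflection_sum w = \<zero>"
  proof (rule ccontr)
    assume ne: "even_reflection_sum w \<oplus> odd_reflection_sum w \<noteq> \<zero>"
    show False using odd_central_reflection_sum(1)[OF w ww ne] ne unfolding refl reflection_sum[OF w] by simp
  qed
  then have eq: "even_reflection_sum w = odd_reflection_sum w" using cl by (simp add: add_eq_zero_iff)
  have "even_reflection_sum w \<otimes> odd_reflection_sum w = \<zero>"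
    by (rule reflection_sums_product[OF _ w ww]) (use h t in auto)
  then have o0: "odd_reflection_sum w = \<zero>" using eq cl square_eq_zero_iff by simp
  have "odd_rotation_sum w = \<zero>"
  proof (cases "2 \<le> m")
    case True
    then show ?thesis by (rule odd_rotation_sum_zero[OF _ w ww])
  next
    case False
    then have mc: "m = 1" "c = 1" using h D.m_pos by auto
    have r1: "D.r = 1" unfolding D.r_def using mc t by simp
    have rot: "odd_central (y \<otimes>\<^bsub>G\<^esub> y) \<longleftrightarrow> D.odd_exponent y" if y: "y \<in> carrier G" "\<not> D.reflection y" for y
    proof -
      obtain i j where yi: "y = D.el i j False" using rotation_el[OF y] by blast
      have "y \<otimes>\<^bsub>G\<^esub> y = D.el (i + i) (j + j) False" unfolding yi by (rule D.el_mult)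
      also have "\<dots> = D.el 0 (i + (j + j)) False"
        unfolding D.el_eq using mc r1 by simp
      finally show ?thesis unfolding yi by (simp add: odd_central_el)
    qed
    have "{y \<in> carrier G. odd_central (y \<otimes>\<^bsub>G\<^esub> y) \<and> \<not> D.reflection y} =
        {y \<in> carrier G. \<not> D.reflection y \<and> D.odd_exponent y}" using rot by auto
    then have "finsum F w {y \<in> carrier G. odd_central (y \<otimes>\<^bsub>G\<^esub> y)} =
        finsum F w {y \<in> carrier G. D.reflection y} \<oplus> odd_rotation_sum w"
      using sum_split_pred[OF w, of "\<lambda>y. odd_central (y \<otimes>\<^bsub>G\<^esub> y)" D.reflection]
      unfolding refl odd_rotation_sum_def by simp
    then show ?thesis
      unfolding odd_central_root_sum[OF w ww] reflection_sum[OF w] r0 using cl by simp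
  qed
  then have "d w = \<zero>"
    using derivation_formula[OF _ e d w] t r0 o0 linear_functional_closed[of d "single a"]
      linear_functional_closed[of d "single x"] d by (simp add: derivation_def)
  then show False using dw by simp
qed

text \<open>The element \<open>x + 1\<close> squares to zero, and \<open>x\<close> lies outside the kernel of a homomorphism onto the
  group of order two.\<close>

lemma square_zero_derivation_if:
  assumes "q = 0"
  shows "square_zero_derivation F FG"
proof -
  let ?d = "pairing (indicator_fun D.reflection)"
  interpret FG: ring FG by (rule FG_ring)
  define w where "w = single x \<oplus>\<^bsub>FG\<^esub> \<one>\<^bsub>FG\<^esub>"
  have wc: "w \<in> carrier FG" by (simp add: w_def)
  have x2: "x [^]\<^bsub>G\<^esub> ((2::nat) ^ 1) = \<one>\<^bsub>G\<^esub>"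
    using D.x_x assms by (simp add: numeral_2_eq_2)
  have "w \<otimes>\<^bsub>FG\<^esub> w = iter_square FG 1 w" by (simp add: iter_square_def)
  also have "\<dots> = single \<one>\<^bsub>G\<^esub> \<oplus>\<^bsub>FG\<^esub> \<one>\<^bsub>FG\<^esub>"
    unfolding w_def iter_square_single[OF D.x_closed] x2 ..
  also have "\<dots> = \<zero>\<^bsub>FG\<^esub>"
    unfolding one_eq_single
    by (rule FG_eqI) (auto simp: FG_add_apply single_apply group_algebra_def one_add_one)
  finally have ww: "w \<otimes>\<^bsub>FG\<^esub> w = \<zero>\<^bsub>FG\<^esub>" .
  have d: "derivation F FG aug ?d" by (rule parity_derivation) (rule D.reflection_mult)
  then have "?d w = ?d (single x) \<oplus> ?d (single \<one>\<^bsub>G\<^esub>)"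
    unfolding w_def one_eq_single using single_closed unfolding derivation_def linear_functional_def by blast
  also have "\<dots> = \<one>"
    by (simp add: pairing_single) (simp add: indicator_fun_def reflection_x not_reflection_one)
  finally show ?thesis
    unfolding square_zero_derivation_def using aug_augmentation d wc ww one_not_zero by metis
qed

text \<open>A derivation is a trace, so its value at a central element only depends on the coefficients at
  the centre of the group, where it vanishes by \<open>derivation_values\<close>.\<close>

lemma no_central_derivation:
  assumes sq: "s + q = 1"
  shows "\<not> central_derivation F FG"
proof
  assume "central_derivation F FG"
  then obtain e d w where e: "augmentation F FG e" and d: "derivation F FG e d"
    and w: "w \<in> center FG" and dw: "d w \<noteq> \<zero>"
    unfolding central_derivation_def by blast
  have cl: "e u \<in> carrier F" "d u \<in> carrier F" if "u \<in> carrier FG" for u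
    using e d that by (auto simp: augmentation_def derivation_def linear_functional_def)
  have tr: "trace_functional F FG d"
    unfolding trace_functional_def
  proof (intro conjI ballI)
    fix u v assume u: "u \<in> carrier FG" and v: "v \<in> carrier FG"
    have "d (u \<otimes>\<^bsub>FG\<^esub> v) = e u \<otimes> d v \<oplus> d u \<otimes> e v" "d (v \<otimes>\<^bsub>FG\<^esub> u) = e v \<otimes> d u \<oplus> d v \<otimes> e u"
      using d u v unfolding derivation_def by blast+
    then show "d (u \<otimes>\<^bsub>FG\<^esub> v) = d (v \<otimes>\<^bsub>FG\<^esub> u)"
      using cl[OF u] cl[OF v] by (simp add: m_comm a_comm)
  qed (use d in \<open>simp add: derivation_def\<close>)
  have "d w = (\<Oplus>h\<in>center G. w h \<otimes> d (single h))" by (rule trace_on_center[OF tr w])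
  also have "\<dots> = (\<Oplus>h\<in>center G. \<zero>)"
  proof (rule finsum_cong')
    fix h assume h: "h \<in> center G"
    then obtain j where "h = D.el 0 j False" unfolding D.center_eq by (auto simp: D.el_gens(4))
    then have "d (single h) = \<zero>" using derivation_values[OF sq e d, of 0 j False] by simp
    then show "w h \<otimes> d (single h) = \<zero>" using centerD(1)[OF h] centerD(1)[OF w] by simp
  qed auto
  finally show False using dw by simp
qed

text \<open>The relations \<open>x^2 = 1\<close> and \<open>a^(2^m) = z^(2^(c - 1))\<close> only contain even powers of \<open>z\<close>, so the
  parity of the exponent of \<open>z\<close> is a homomorphism.\<close>

lemma central_derivation_if:
  assumes t: "s = 0" "q = 0" and c: "2 \<le> c"
  shows "central_derivation F FG"
proof -
  define P where "P g \<longleftrightarrow> (\<exists>i j e. g = D.el i j e \<and> odd j)" for g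
  have P_el: "P (D.el i j e) \<longleftrightarrow> odd j" for i j e
  proof
    assume "P (D.el i j e)"
    then obtain k l f where k: "D.el i j e = D.el k l f" "odd l" unfolding P_def by blast
    have "2 ^ c dvd D.r * ((i - k) div 2 ^ m) + j - l" using k(1) unfolding D.el_eq by blast
    moreover have "(2::int) dvd 2 ^ c" using c by simp
    ultimately have d: "2 dvd D.r * ((i - k) div 2 ^ m) + j - l" by (rule dvd_trans[rotated])
    have "even D.r" unfolding D.r_def using t c by simp
    then have "even (D.r * ((i - k) div 2 ^ m))" by simp
    then show "odd j" using d k(2) by auto
  qed (auto simp: P_def)
  have hom: "P (g \<otimes>\<^bsub>G\<^esub> h) \<longleftrightarrow> P g \<noteq> P h" if gh: "g \<in> carrier G" "h \<in> carrier G" for g h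
  proof -
    obtain i j e where g: "g = D.el i j e" using D.elements[OF gh(1)] by blast
    obtain k l f where h: "h = D.el k l f" using D.elements[OF gh(2)] by blast
    show ?thesis unfolding g h by (cases e; cases f) (simp_all add: D.el_mult P_el t)
  qed
  have "derivation F FG aug (pairing (indicator_fun P))" by (rule parity_derivation) (rule hom)
  moreover have "pairing (indicator_fun P) (single z) = \<one>"
    using P_el[of 0 1 False] unfolding D.el_gens(2) by (simp add: pairing_single indicator_fun_def[of P z])
  ultimately show ?thesis
    unfolding central_derivation_def
    using aug_augmentation single_in_center[OF D.z_center] one_not_zero by metis
qed

text \<open>The group is generated by the involutions \<open>x\<close> and \<open>a x\<close>.\<close>

lemma square_zero_separates_if:
  assumes t: "s = 0" "q = 0" "c = 1"
  shows "square_zero_separates F FG"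
  unfolding square_zero_separates_def
proof (intro allI impI ballI)
  fix e d v assume e: "augmentation F FG e" and d: "derivation F FG e d"
    and kill: "\<forall>w\<in>carrier FG. w \<otimes>\<^bsub>FG\<^esub> w = \<zero>\<^bsub>FG\<^esub> \<longrightarrow> d w = \<zero>" and v: "v \<in> carrier FG"
  interpret FG: ring FG by (rule FG_ring)
  have dl: "linear_functional F FG d" using d by (simp add: derivation_def)
  have dc: "d (single g) \<in> carrier F" for g
    by (rule linear_functional_closed[OF dl single_closed])
  have hom: "d (single (g \<otimes>\<^bsub>G\<^esub> h)) = d (single g) \<oplus> d (single h)"
    if "g \<in> carrier G" "h \<in> carrier G" for g h
    by (rule derivation_single[OF e d that])
  have d1: "d (single \<one>\<^bsub>G\<^esub>) = \<zero>" using hom[of "\<one>\<^bsub>G\<^esub>" "\<one>\<^bsub>G\<^esub>"] dc by simp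
  have inv0: "d (single g) = \<zero>" if g: "g \<in> carrier G" "g \<otimes>\<^bsub>G\<^esub> g = \<one>\<^bsub>G\<^esub>" for g
  proof -
    let ?w = "single g \<oplus>\<^bsub>FG\<^esub> \<one>\<^bsub>FG\<^esub>"
    have g2: "g [^]\<^bsub>G\<^esub> ((2::nat) ^ 1) = \<one>\<^bsub>G\<^esub>" using g by (simp add: numeral_2_eq_2)
    have "?w \<otimes>\<^bsub>FG\<^esub> ?w = iter_square FG 1 ?w" by (simp add: iter_square_def)
    also have "\<dots> = single \<one>\<^bsub>G\<^esub> \<oplus>\<^bsub>FG\<^esub> \<one>\<^bsub>FG\<^esub>" unfolding iter_square_single[OF g(1)] g2 ..
    also have "\<dots> = \<zero>\<^bsub>FG\<^esub>"
      unfolding one_eq_single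
      by (rule FG_eqI) (auto simp: FG_add_apply single_apply group_algebra_def one_add_one)
    finally have "d ?w = \<zero>" using kill by simp
    moreover have "d ?w = d (single g) \<oplus> d (single \<one>\<^bsub>G\<^esub>)"
      unfolding one_eq_single using dl single_closed unfolding linear_functional_def by blast
    ultimately show ?thesis using d1 dc by simp
  qed
  have x0: "d (single x) = \<zero>" by (rule inv0) (use D.x_x t in auto)
  have "D.el 1 0 True \<otimes>\<^bsub>G\<^esub> D.el 1 0 True = \<one>\<^bsub>G\<^esub>" by (simp add: D.el_mult t D.el_zero)
  then have "d (single (D.el 1 0 True)) = \<zero>" by (intro inv0) auto
  moreover have "D.el 1 0 True \<otimes>\<^bsub>G\<^esub> D.el 0 0 True = D.el 1 0 False" by (simp add: D.el_mult t)
  ultimately have a0: "d (single a) = \<zero>"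
    using hom[of "D.el 1 0 True" "D.el 0 0 True"] x0 unfolding D.el_gens(1,3) by simp
  define U where "U = {g \<in> carrier G. d (single g) = \<zero>}"
  have U: "subgroup U G"
  proof (rule G.subgroupI)
    show "U \<noteq> {}" using d1 by (auto simp: U_def)
    fix g assume "g \<in> U"
    then have g: "g \<in> carrier G" "d (single g) = \<zero>" by (auto simp: U_def)
    then show "inv\<^bsub>G\<^esub> g \<in> U" using hom[of g "inv\<^bsub>G\<^esub> g"] d1 dc by (simp add: U_def)
    fix h assume "h \<in> U"
    then show "g \<otimes>\<^bsub>G\<^esub> h \<in> U" using g hom by (simp add: U_def)
  qed (auto simp: U_def)
  have xU: "x \<in> U" and aU: "a \<in> U" using x0 a0 by (simp_all add: U_def)
  have "a [^]\<^bsub>G\<^esub> ((2::int) ^ m) = z"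
    unfolding D.apow_eq using t by simp
  then have "z \<in> U" using G.subgroup_int_pow_closed[OF U aU, of "2 ^ m"] by simp
  then have "center G \<subseteq> U" unfolding D.center_eq using G.subgroup_int_pow_closed[OF U] by blast
  then have "U = carrier G" by (rule D.generated_by[OF U xU aU])
  then have "d (single g) = \<zero>" if "g \<in> carrier G" for g using that by (auto simp: U_def)
  then have "(\<Oplus>g\<in>carrier G. v g \<otimes> d (single g)) = (\<Oplus>g\<in>carrier G. \<zero>)"
    using v by (intro finsum_cong') auto
  then show "d v = \<zero>" using linear_functional_expand[OF dl v] by (simp add: pairing_def)
qed

text \<open>The parity of the exponent of \<open>a\<close> defines a nonzero derivation that kills all square-zero
  elements.\<close>

lemma not_square_zero_separates:
  assumes "(s = 1 \<and> q = 0 \<and> 2 \<le> m) \<or> (s = 0 \<and> q = 1 \<and> c = 1)"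
  shows "\<not> square_zero_separates F FG"
proof
  let ?d = "pairing (indicator_fun D.odd_exponent)"
  assume sep: "square_zero_separates F FG"
  have d: "derivation F FG aug ?d" by (rule parity_derivation) (rule D.odd_exponent_mult)
  have "?d (single a) = \<one>"
    by (simp add: pairing_single) (simp add: indicator_fun_def odd_exponent_a)
  then have ne: "?d (single a) \<noteq> \<zero>" by simp
  have "?d w = \<zero>" if w: "w \<in> carrier FG" and ww: "w \<otimes>\<^bsub>FG\<^esub> w = \<zero>\<^bsub>FG\<^esub>" for w
    using assms
  proof
    assume t: "s = 0 \<and> q = 1 \<and> c = 1"
    then have "\<not> square_zero_derivation F FG" using no_square_zero_derivation by blast
    then show ?thesis using aug_augmentation d w ww unfolding square_zero_derivation_def by blast
  next
    assume t: "s = 1 \<and> q = 0 \<and> 2 \<le> m"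
    note cl = sums_closed[OF w]
    have "odd_reflection_sum w = \<zero>"
    proof (cases "even_reflection_sum w \<oplus> odd_reflection_sum w = \<zero>")
      case True
      then have "even_reflection_sum w = odd_reflection_sum w" using cl by (simp add: add_eq_zero_iff)
      then show ?thesis
        using reflection_sums_product[OF _ w ww] t cl square_eq_zero_iff by simp
    next
      case False
      have "odd_central (y \<otimes>\<^bsub>G\<^esub> y) \<longleftrightarrow> D.odd_exponent y" if "y \<in> carrier G" "D.reflection y" for y
        using odd_central_reflection[OF that] t by simp
      then have "{y \<in> carrier G. odd_central (y \<otimes>\<^bsub>G\<^esub> y) \<and> D.reflection y} =
          {y \<in> carrier G. D.reflection y \<and> D.odd_exponent y}" by auto
      then show ?thesis
        using odd_central_reflection_sum(1)[OF w ww False] unfolding odd_reflection_sum_def by simp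
    qed
    moreover have "odd_rotation_sum w = \<zero>" using odd_rotation_sum_zero[OF _ w ww] t by blast
    ultimately show ?thesis using pairing_indicator[OF w] odd_sum[OF w] by simp
  qed
  then have "\<forall>w\<in>carrier FG. ?d w = \<zero>"
    using sep aug_augmentation d unfolding square_zero_separates_def by blast
  then show False using ne single_closed by blast
qed

end

section \<open>The isomorphism problem\<close>

lemma char2_fieldI:
  assumes "field F" "ring_char F = 2"
  shows "char2_field F"
proof -
  interpret field F by fact
  have "\<one>\<^bsub>F\<^esub> [^]\<^bsub>add_monoid F\<^esub> (2::nat) = \<zero>\<^bsub>F\<^esub>"
    using group.pow_ord_eq_1[OF a_group, of "\<one>\<^bsub>F\<^esub>"] assms(2) by (simp add: ring_char_def)
  then have "\<one>\<^bsub>F\<^esub> \<oplus>\<^bsub>F\<^esub> \<one>\<^bsub>F\<^esub> = \<zero>\<^bsub>F\<^esub>"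
    by (simp add: numeral_2_eq_2 nat_pow_def)
  then show ?thesis by unfold_locales
qed

lemma (in two_group) cyclic_center_of_exponent:
  assumes c: "card (center G) = 2 ^ c" and h: "h \<in> center G" "h [^] ((2::nat) ^ (c - 1)) \<noteq> \<one>"
  shows "center G = range (\<lambda>j::int. h [^] j)"
proof -
  have hc: "h \<in> carrier G" using h(1) by (rule centerD(1))
  obtain k where k: "ord h = 2 ^ k" using dvd_order_imp_pow ord_dvd_group_order[OF hc] by blast
  have "\<not> (2::nat) ^ k dvd 2 ^ (c - 1)" using h(2) pow_eq_id[OF hc, of "2 ^ (c - 1)"] k by simp
  then have "\<not> k \<le> c - 1" using le_imp_power_dvd by blast
  then have ck: "c \<le> k" by simp
  have sub: "generate G {h} \<subseteq> center G"
    by (rule generate_subgroup_incl[OF _ center_subgroup]) (use h in simp)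
  have fc: "finite (center G)" by (rule finite_subset[OF center_subset fin])
  have "card (generate G {h}) = 2 ^ k" using generate_pow_card[OF hc] k by simp
  then have "card (center G) \<le> card (generate G {h})" unfolding c using ck by simp
  then have "generate G {h} = center G" using card_seteq[OF fc sub] by blast
  then show ?thesis unfolding generate_pow[OF hc] by auto
qed

context group_algebra_iso
begin

lemma order_eq: "order G = order H"
proof -
  interpret r: group_algebra_iso F H G \<psi> \<phi> by (rule reverse)
  show ?thesis using order_le r.order_le by (simp add: order_def)
qed

lemma card_center_eq: "card (center G) = card (center H)"
proof -
  interpret r: group_algebra_iso F H G \<psi> \<phi> by (rule reverse)
  show ?thesis using card_center_le r.card_center_le by simp
qed

lemma index_center_derived_eq:
  "card (rcosets\<^bsub>G\<^esub> center_derived G) = card (rcosets\<^bsub>H\<^esub> center_derived H)"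
proof -
  interpret r: group_algebra_iso F H G \<psi> \<phi> by (rule reverse)
  show ?thesis using index_center_derived_le r.index_center_derived_le by simp
qed

text \<open>A generator of the centre of \<open>H\<close> is found through the exponent, and lifts of two generating
  involutions of the central quotient through the index of \<open>center_derived H\<close>.\<close>

lemma dihedral_ext_transfer:
  assumes "dihedral_ext G a x z s q m c"
  shows "\<exists>a' x' z' s' q'. dihedral_ext H a' x' z' s' q' m c"
proof -
  interpret D: dihedral_ext G a x z s q m c by fact
  have cH: "card (center H) = 2 ^ c" using D.card_center card_center_eq by simp
  have zne: "z [^]\<^bsub>G\<^esub> ((2::nat) ^ (c - 1)) \<noteq> \<one>\<^bsub>G\<^esub>"
  proof
    assume "z [^]\<^bsub>G\<^esub> ((2::nat) ^ (c - 1)) = \<one>\<^bsub>G\<^esub>"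
    then have "z [^]\<^bsub>G\<^esub> (int (2 ^ (c - 1))) = \<one>\<^bsub>G\<^esub>" by (simp only: int_pow_int)
    then have "2 ^ c dvd int (2 ^ (c - 1))" unfolding D.zpow_one .
    then have "(2::int) ^ c dvd 2 ^ (c - 1)" by simp
    then have "(2::int) ^ c \<le> 2 ^ (c - 1)" by (rule zdvd_imp_le) simp
    then have "c \<le> c - 1" by simp
    then show False using D.c_pos by simp
  qed
  obtain h where h: "h \<in> center H" "h [^]\<^bsub>H\<^esub> ((2::nat) ^ (c - 1)) \<noteq> \<one>\<^bsub>H\<^esub>"
    using center_exponent[OF _ D.z_center, of "c - 1"] zne by blast
  have hc: "h \<in> carrier H" using h(1) by (rule centerD(1))
  have ceq: "center H = range (\<lambda>j::int. h [^]\<^bsub>H\<^esub> j)" by (rule B.G.cyclic_center_of_exponent[OF cH h])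
  have "card (rcosets\<^bsub>H\<^esub> center_derived H) = 4"
    using D.index_center_derived index_center_derived_eq by simp
  then obtain x y where xy: "x \<in> carrier H" "y \<in> carrier H" "x \<otimes>\<^bsub>H\<^esub> x \<in> center H" "y \<otimes>\<^bsub>H\<^esub> y \<in> center H"
    "\<And>U. subgroup U H \<Longrightarrow> x \<in> U \<Longrightarrow> y \<in> U \<Longrightarrow> center H \<subseteq> U \<Longrightarrow> U = carrier H"
    using B.G.pair_of_index_four by blast
  have oH: "order H = 2 ^ (m + c + 1)" using D.order_eq order_eq by simp
  have "center H \<noteq> carrier H"
  proof
    assume "center H = carrier H"
    then have "(2::nat) ^ c = 2 ^ (m + c + 1)" using cH oH by (simp add: order_def)
    then have "c = m + c + 1" by (simp only: power_inject_exp)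
    then show False by simp
  qed
  then obtain a' x' z' s' q' m' c' where D': "dihedral_ext H a' x' z' s' q' m' c'"
    using B.G.dihedral_ext_exists[OF hc ceq xy] by blast
  interpret D': dihedral_ext H a' x' z' s' q' m' c' by (rule D')
  have "(2::nat) ^ c = 2 ^ c'" using D'.card_center cH by simp
  then have cc: "c = c'" by simp
  have "(2::nat) ^ (m + c + 1) = 2 ^ (m' + c' + 1)" using D'.order_eq oH by simp
  then have "m = m'" using cc by simp
  then show ?thesis using D' cc by blast
qed

end

text \<open>A group can have two types: \<open>(0, 0)\<close> and \<open>(1, 0)\<close> if \<open>m = c = 1\<close>, and \<open>(1, 0)\<close> and \<open>(0, 1)\<close> if
  \<open>m = 1\<close> and \<open>c \<ge> 2\<close>.\<close>

definition has_type :: "('g, 'm) monoid_scheme \<Rightarrow> nat \<Rightarrow> nat \<Rightarrow> int \<Rightarrow> int \<Rightarrow> bool" where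
  "has_type G m c s q \<longleftrightarrow> (\<exists>a x z. dihedral_ext G a x z s q m c)"

text \<open>For \<open>c = 1\<close> the element \<open>z\<close> is a square in every family and no derivation is nonzero on the
  centre, so square-zero elements have to separate the families.\<close>

lemma type_00_iff:
  assumes A: "char2_group_algebra F G" and D: "dihedral_ext G a x z s q m c"
  shows "has_type G m c 0 0 \<longleftrightarrow>
    (if c = 1 then square_zero_separates F (group_algebra F G) else central_derivation F (group_algebra F G))"
proof -
  have alg: "dihedral_algebra F G a x z s q m c" if "dihedral_ext G a x z s q m c" for a x z s q
    using A that by (simp add: dihedral_algebra_def)
  show ?thesis
  proof
    assume "has_type G m c 0 0"
    then obtain a x z where "dihedral_ext G a x z 0 0 m c" by (auto simp: has_type_def)
    then interpret dihedral_algebra F G a x z 0 0 m c by (rule alg)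
    show "if c = 1 then square_zero_separates F (group_algebra F G)
        else central_derivation F (group_algebra F G)"
      using square_zero_separates_if central_derivation_if D.c_pos by auto
  next
    assume inv: "if c = 1 then square_zero_separates F (group_algebra F G)
        else central_derivation F (group_algebra F G)"
    interpret dihedral_algebra F G a x z s q m c by (rule alg[OF D])
    show "has_type G m c 0 0"
    proof (cases "s = 0 \<and> q = 0")
      case True
      then show ?thesis using D by (auto simp: has_type_def)
    next
      case False
      then have t: "(s = 1 \<and> q = 0) \<or> (s = 0 \<and> q = 1)" using D.types by auto
      then have c1: "c = 1" using inv no_central_derivation by (auto split: if_splits)
      then have "\<not> ((s = 1 \<and> q = 0 \<and> 2 \<le> m) \<or> (s = 0 \<and> q = 1 \<and> c = 1))"
        using inv not_square_zero_separates by auto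
      then have "s = 1" "q = 0" "m = 1" using t c1 D.m_pos by auto
      then show ?thesis using D.type_10_order_eight c1 by (auto simp: has_type_def)
    qed
  qed
qed

lemma type_10_iff:
  assumes A: "char2_group_algebra F G" and D: "dihedral_ext G a x z s q m c"
    and no: "\<not> has_type G m c 0 0"
  shows "has_type G m c 1 0 \<longleftrightarrow> square_zero_derivation F (group_algebra F G)"
proof -
  have alg: "dihedral_algebra F G a x z s q m c" if "dihedral_ext G a x z s q m c" for a x z s q
    using A that by (simp add: dihedral_algebra_def)
  show ?thesis
  proof
    assume "has_type G m c 1 0"
    then obtain a x z where "dihedral_ext G a x z 1 0 m c" by (auto simp: has_type_def)
    then interpret dihedral_algebra F G a x z 1 0 m c by (rule alg)
    show "square_zero_derivation F (group_algebra F G)" by (rule square_zero_derivation_if) simp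
  next
    assume inv: "square_zero_derivation F (group_algebra F G)"
    interpret dihedral_algebra F G a x z s q m c by (rule alg[OF D])
    show "has_type G m c 1 0"
    proof (cases "s = 1")
      case True
      then show ?thesis using D D.types by (auto simp: has_type_def)
    next
      case False
      have "\<not> (s = 0 \<and> q = 0)" using no D by (auto simp: has_type_def)
      then have t: "s = 0" "q = 1" using False D.types by auto
      then have "\<not> (2 \<le> m \<or> c = 1)" using inv no_square_zero_derivation by blast
      then have "m = 1" "2 \<le> c" using D.m_pos D.c_pos by auto
      then show ?thesis using D.type_01_modular t by (auto simp: has_type_def)
    qed
  qed
qed

lemma has_type_cases:
  assumes "dihedral_ext G a x z s q m c"
  shows "has_type G m c 0 0 \<or> has_type G m c 1 0 \<or> has_type G m c 0 1"
  using assms dihedral_ext.types[OF assms] by (auto simp: has_type_def)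

lemma has_type_iso: "has_type G m c s q \<Longrightarrow> has_type H m c s q \<Longrightarrow> G \<cong> H"
  by (auto simp: has_type_def intro: dihedral_ext_iso)

theorem theorem5p6:
  fixes p :: nat
    and G :: "'g monoid"
    and F :: "'f ring"
    and H :: "'h monoid"
  assumes "prime p"
    and "finite_p_group p G"
    and "cyclic_group (G\<lparr>carrier := center G\<rparr>)"
    and "dihedral (G Mod center G)"
    and "field F" and "ring_char F = p"
    and "finite_p_group p H"
    and "algebras_isomorphic F (group_algebra F G) (group_algebra F H)"
  shows "G \<cong> H"
proof -
  interpret G: group G using assms(2) by (simp add: finite_p_group_def)
  have finG: "finite (carrier G)" using assms(2) by (simp add: finite_p_group_def)
  have p2: "p = 2"
  proof -
    let ?K = "G Mod center G"
    interpret Z: normal "center G" G by (rule G.center_normal)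
    interpret K: group ?K by (rule Z.factorgroup_is_group)
    obtain X where X: "X \<in> carrier ?K" "K.ord X = 2" using assms(4) by (auto simp: dihedral_def)
    have "2 dvd order ?K" using K.ord_dvd_group_order[OF X(1)] X(2) by simp
    moreover have "order ?K * card (center G) = order G"
      using G.lagrange[OF G.center_subgroup] by (simp add: order_def FactGroup_def)
    ultimately have "2 dvd order G" by (metis dvd_mult2)
    moreover obtain n where "order G = p ^ n" using assms(2) by (auto simp: finite_p_group_def)
    ultimately have "2 dvd p" using prime_dvd_power[OF two_is_prime_nat] by simp
    then show ?thesis using primes_dvd_imp_eq[OF two_is_prime_nat assms(1)] by simp
  qed
  have tG: "two_group G" and tH: "two_group H"
    using assms(2,7) p2 by (simp_all add: finite_p_group_def two_group_def two_group_axioms_def)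
  have cF: "char2_field F" using char2_fieldI assms(5,6) p2 by simp
  have AG: "char2_group_algebra F G" and AH: "char2_group_algebra F H"
    using cF tG tH by (simp_all add: char2_group_algebra_def)
  interpret G2: two_group G by (rule tG)
  obtain \<phi> \<psi> where iso: "group_algebra_iso F G H \<phi> \<psi>"
    using group_algebra_isoI[OF AG AH assms(8)] by blast
  interpret I: group_algebra_iso F G H \<phi> \<psi> by (rule iso)
  interpret R: group_algebra_iso F H G \<psi> \<phi> by (rule I.reverse)
  have gZ: "group (G\<lparr>carrier := center G\<rparr>)"
    by (rule subgroup.subgroup_is_group[OF G.center_subgroup G.is_group])
  obtain z where z: "z \<in> center G"
    "center G = range (\<lambda>j::int. z [^]\<^bsub>G\<lparr>carrier := center G\<rparr>\<^esub> j)"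
    using assms(3) group.cyclic_group[OF gZ] by auto
  have zc: "z \<in> carrier G" using z(1) by (rule centerD(1))
  have ceq: "center G = range (\<lambda>j::int. z [^]\<^bsub>G\<^esub> j)"
    using z(2) G.int_pow_consistent[OF G.center_subgroup z(1)] by simp
  obtain x y where xy: "x \<in> carrier G" "y \<in> carrier G" "x \<otimes>\<^bsub>G\<^esub> x \<in> center G" "y \<otimes>\<^bsub>G\<^esub> y \<in> center G"
    "\<And>U. subgroup U G \<Longrightarrow> x \<in> U \<Longrightarrow> y \<in> U \<Longrightarrow> center G \<subseteq> U \<Longrightarrow> U = carrier G"
    using G2.pair_of_dihedral_quotient(1)[OF assms(4)] by blast
  obtain a x z s q m c where DG: "dihedral_ext G a x z s q m c"
    using G2.dihedral_ext_exists[OF zc ceq xy G2.pair_of_dihedral_quotient(2)[OF assms(4)]] by blast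
  obtain a' x' z' s' q' where DH: "dihedral_ext H a' x' z' s' q' m c"
    using I.dihedral_ext_transfer[OF DG] by blast
  have "square_zero_separates F (group_algebra F G) \<longleftrightarrow> square_zero_separates F (group_algebra F H)"
    using I.square_zero_separates_push R.square_zero_separates_push by blast
  moreover have "central_derivation F (group_algebra F G) \<longleftrightarrow> central_derivation F (group_algebra F H)"
    using I.central_derivation_pullback R.central_derivation_pullback by blast
  ultimately have t00: "has_type G m c 0 0 \<longleftrightarrow> has_type H m c 0 0"
    unfolding type_00_iff[OF AG DG] type_00_iff[OF AH DH] by simp
  have sz: "square_zero_derivation F (group_algebra F G) \<longleftrightarrow> square_zero_derivation F (group_algebra F H)"
    using I.square_zero_derivation_pullback R.square_zero_derivation_pullback by blast
  show ?thesis
  proof (cases "has_type G m c 0 0")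
    case True
    then show ?thesis using t00 has_type_iso by blast
  next
    case False
    then have nH: "\<not> has_type H m c 0 0" using t00 by simp
    have t10: "has_type G m c 1 0 \<longleftrightarrow> has_type H m c 1 0"
      unfolding type_10_iff[OF AG DG False] type_10_iff[OF AH DH nH] by (rule sz)
    show ?thesis
      using has_type_cases[OF DG] has_type_cases[OF DH] t10 False nH has_type_iso by blast
  qed
qed

end
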